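(* Let $G$ be a DAG on $\{1,\dots,K\}$ such that for every $k$ the parent set $\mathrm{pa}(k)$ is fully connected. Fix $L>0$ and let $\mathcal{Q}$ be the set of measures $\mu\in\mathcal{P}_G$ which satisfy the TV-Lipschitz condition with constant $L$ (defined in the context). Then there exists a constant $C$ depending only on $G$, $L$ and $d_{\rm loc}$ such that for every $n\ge1$ $$V_{\mathcal{Q}}(n)\le C\cdot\max\{\log(n),1\}\left(n^{-2/(2+d_{\rm loc})}+n^{-1/d_{\rm max}}\right).$$
   Context: Setting: $G$ is a directed acyclic graph with nodes $\{1,\dots,K\}$, topologically sorted (every edge $i\to j$ has $i<j$); $\mathrm{pa}(k)$ is the set of parents of $k$ and $\mathrm{pre}(k)=\{1,\dots,k-1\}\setminus\mathrm{pa}(k)$. A set $J$ of nodes is fully connected if there is an edge $k\to\ell$ for all $k,\ell\in J$ with $k<\ell$. $\mathcal{X}=[0,1]^d=\mathcal{X}_1\times\dots\times\mathcal{X}_K$ with $\mathcal{X}_k=[0,1]^{d_k}$, $\mathcal{X}_I=\prod_{i\in I}\mathcal{X}_i$, $x_I=(x_i)_{i\in I}$. $\|\cdot\|$ is the sup-norm. $\mathcal{P}_G$ is the set of Borel probability measures $\mu$ on $\mathcal{X}$ with $\mu(dx)=\prod_{k=1}^K\mu(dx_k\mid x_{\mathrm{pa}(k)})$ (regular conditional distributions; marginal if $\mathrm{pa}(k)=\emptyset$). $\mathcal{W}$ is the first-order Wasserstein distance w.r.t. $\|\cdot\|$; $\mathrm{TV}(\nu,\tilde\nu)=\sup_f(\int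 f\,d\nu-\int f\,d\tilde\nu)$ over measurable $|f|\le1/2$. TV-Lipschitz condition with constant $L$ for $\mu\in\mathcal{P}_G$: for all $2\le k\le K$, all $x_{\mathrm{pa}(k)},\tilde x_{\mathrm{pa}(k)}\in\mathcal{X}_{\mathrm{pa}(k)}$ and all $x_k,\tilde x_k\in\mathcal{X}_k$: $\mathrm{TV}(\mu(dx_k\mid x_{\mathrm{pa}(k)}),\mu(dx_k\mid\tilde x_{\mathrm{pa}(k)}))\le L\|x_{\mathrm{pa}(k)}-\tilde x_{\mathrm{pa}(k)}\|$; $\mathrm{TV}(\mu(dx_{\mathrm{pre}(k)}\mid x_{\mathrm{pa}(k)}),\mu(dx_{\mathrm{pre}(k)}\mid\tilde x_{\mathrm{pa}(k)}))\le L\|x_{\mathrm{pa}(k)}-\tilde x_{\mathrm{pa}(k)}\|$; $\mathrm{TV}(\mu(dx_{\mathrm{pa}(k)}\mid x_k),\mu(dx_{\mathrm{pa}(k)}\mid\tilde x_k))\le L\|x_k-\tilde x_k\|$. (I.e. the conditional distributions admit versions with these properties; conditions involving empty index sets are void.) $d_{\mathrm{pa}(k)}=\sum_{\ell\in\mathrm{pa}(k)}d_\ell$, $d_{\rm loc}=\max_k(\max\{2,d_k\}+d_{\mathrm{pa}(k)})$, $d_{\rm max}=\max_k\max\{2,d_k\}$. $V_{\mathcal{Q}}(n)=\inf_{E_n}\sup_{\mu\in\mathcal{Q}}\int\mathcal{W}(\mu,E_n)\,d\mu^{\otimes n}$, infimum over measurable estimators $E_n:\mathcal{X}^n\to\mathcal{P}(\mathcal{X})$.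 *)

theory Defs
  imports "HOL-Probability.Probability"
begin

section \<open>Graphs\<close>

text \<open>A graph on the nodes \<open>{1..K}\<close> is given by its edge set. Topological sortedness
  (every edge goes from a smaller to a larger node) subsumes acyclicity.\<close>

definition sorted_dag :: "nat \<Rightarrow> (nat \<times> nat) set \<Rightarrow> bool" where
  "sorted_dag K G \<longleftrightarrow> G \<subseteq> {1..K} \<times> {1..K} \<and> (\<forall>(i, j)\<in>G. i < j)"

definition pa :: "(nat \<times> nat) set \<Rightarrow> nat \<Rightarrow> nat set" where
  "pa G k = {i. (i, k) \<in> G}"

definition pre :: "(nat \<times> nat) set \<Rightarrow> nat \<Rightarrow> nat set" where
  "pre G k = {1..<k} - pa G k"

definition fully_connected :: "(nat \<times> nat) set \<Rightarrow> nat set \<Rightarrow> bool" where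
  "fully_connected G J \<longleftrightarrow> (\<forall>k\<in>J. \<forall>l\<in>J. k < l \<longrightarrow> (k, l) \<in> G)"

definition d_loc :: "nat \<Rightarrow> (nat \<times> nat) set \<Rightarrow> (nat \<Rightarrow> nat) \<Rightarrow> nat" where
  "d_loc K G d = Max ((\<lambda>k. max 2 (d k) + (\<Sum>l\<in>pa G k. d l)) ` {1..K})"

definition d_max :: "nat \<Rightarrow> (nat \<Rightarrow> nat) \<Rightarrow> nat" where
  "d_max K d = Max ((\<lambda>k. max 2 (d k)) ` {1..K})"

section \<open>The cube and its subproducts\<close>

text \<open>\<open>cube d I\<close> is the product over \<open>k \<in> I\<close> of the spaces \<open>[0,1]^(d k)\<close>; a point \<open>x\<close> has
  the real coordinates \<open>x k i\<close> for \<open>k \<in> I\<close> and \<open>i < d k\<close>. For finite \<open>I\<close> the product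
  sigma-algebra is the Borel sigma-algebra of the product topology. The factor belonging to a
  single node \<open>k\<close> is represented throughout by \<open>cube d {k}\<close>, and the projection to
  the coordinates in \<open>I\<close> is \<open>\<lambda>x. restrict x I\<close>.\<close>

definition cube :: "(nat \<Rightarrow> nat) \<Rightarrow> nat set \<Rightarrow> (nat \<Rightarrow> nat \<Rightarrow> real) measure" where
  "cube d I = PiM I (\<lambda>k. PiM {..<d k} (\<lambda>_. restrict_space borel {0..1}))"

text \<open>The sup-norm distance; meaningful if \<open>I\<close> is finite and nonempty and \<open>d k \<ge> 1\<close> for
  \<open>k \<in> I\<close>.\<close>

definition sup_dist ::
  "(nat \<Rightarrow> nat) \<Rightarrow> nat set \<Rightarrow> (nat \<Rightarrow> nat \<Rightarrow> real) \<Rightarrow> (nat \<Rightarrow> nat \<Rightarrow> real) \<Rightarrow> real" where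
  "sup_dist d I x y = Max ((\<lambda>(k, i). \<bar>x k i - y k i\<bar>) ` (SIGMA k:I. {..<d k}))"

section \<open>Distances between probability measures\<close>

definition tv_dist :: "'a measure \<Rightarrow> 'a measure \<Rightarrow> real" where
  "tv_dist M N =
    (SUP f\<in>{f \<in> borel_measurable M. \<forall>x\<in>space M. \<bar>f x\<bar> \<le> 1/2}.
      integral\<^sup>L M f - integral\<^sup>L N f)"

definition couplings :: "'a measure \<Rightarrow> 'a measure \<Rightarrow> ('a \<times> 'a) measure set" where
  "couplings M N =
    {P. sets P = sets (M \<Otimes>\<^sub>M N) \<and> distr P M fst = M \<and> distr P N snd = N}"

definition wasserstein :: "('a \<Rightarrow> 'a \<Rightarrow> real) \<Rightarrow> 'a measure \<Rightarrow> 'a measure \<Rightarrow> ennreal" where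
  "wasserstein \<rho> M N = (INF P\<in>couplings M N. \<integral>\<^sup>+(x, y). ennreal (\<rho> x y) \<partial>P)"

section \<open>Conditional distributions and Bayesian networks\<close>

text \<open>\<open>\<kappa>\<close> is a version of the regular conditional distribution of \<open>x\<^sub>J\<close> given \<open>x\<^sub>I\<close> under \<open>\<mu>\<close>.
  For \<open>I = {}\<close> the space \<open>cube d I\<close> has a single point, and \<open>\<kappa>\<close> is the marginal of \<open>x\<^sub>J\<close>.\<close>

definition regular_cond_distr ::
  "(nat \<Rightarrow> nat) \<Rightarrow> (nat \<Rightarrow> nat \<Rightarrow> real) measure \<Rightarrow> nat set \<Rightarrow> nat set
    \<Rightarrow> ((nat \<Rightarrow> nat \<Rightarrow> real) \<Rightarrow> (nat \<Rightarrow> nat \<Rightarrow> real) measure) \<Rightarrow> bool" where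
  "regular_cond_distr d \<mu> I J \<kappa> \<longleftrightarrow>
    \<kappa> \<in> cube d I \<rightarrow>\<^sub>M prob_algebra (cube d J) \<and>
    (\<forall>A\<in>sets (cube d I). \<forall>B\<in>sets (cube d J).
      emeasure \<mu> {x \<in> space \<mu>. restrict x I \<in> A \<and> restrict x J \<in> B} =
      (\<integral>\<^sup>+y\<in>A. emeasure (\<kappa> y) B \<partial>distr \<mu> (cube d I) (\<lambda>x. restrict x I)))"

text \<open>The measure \<open>\<Prod>\<^sub>i \<kappa>\<^sub>i(dx\<^sub>i | x\<^sub>p\<^sub>a\<^sub>(\<^sub>i\<^sub>))\<close> on \<open>cube d {1..k}\<close>, the product running over
  \<open>i = 1, \<dots>, k\<close>.\<close>

primrec kernel_prod ::
  "(nat \<Rightarrow> nat) \<Rightarrow> (nat \<times> nat) set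
    \<Rightarrow> (nat \<Rightarrow> (nat \<Rightarrow> nat \<Rightarrow> real) \<Rightarrow> (nat \<Rightarrow> nat \<Rightarrow> real) measure)
    \<Rightarrow> nat \<Rightarrow> (nat \<Rightarrow> nat \<Rightarrow> real) measure" where
  "kernel_prod d G \<kappa> 0 = return (cube d {}) (\<lambda>_. undefined)"
| "kernel_prod d G \<kappa> (Suc k) =
    kernel_prod d G \<kappa> k \<bind> (\<lambda>x.
      \<kappa> (Suc k) (restrict x (pa G (Suc k))) \<bind> (\<lambda>y.
        return (cube d {1..Suc k}) (merge {1..k} {Suc k} (x, y))))"

text \<open>The set \<open>P\<^sub>G\<close>. The product does not depend on the chosen versions of the conditional
  distributions.\<close>

definition bayes_net ::
  "nat \<Rightarrow> (nat \<times> nat) set \<Rightarrow> (nat \<Rightarrow> nat) \<Rightarrow> (nat \<Rightarrow> nat \<Rightarrow> real) measure set" where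
  "bayes_net K G d =
    {\<mu> \<in> space (prob_algebra (cube d {1..K})).
      \<exists>\<kappa>. (\<forall>k\<in>{1..K}. regular_cond_distr d \<mu> (pa G k) {k} (\<kappa> k)) \<and>
          \<mu> = kernel_prod d G \<kappa> K}"

text \<open>Some version of the conditional distribution of \<open>x\<^sub>J\<close> given \<open>x\<^sub>I\<close> is \<open>L\<close>-Lipschitz in total
  variation; void if one of the index sets is empty.\<close>

definition tv_lipschitz_cond ::
  "(nat \<Rightarrow> nat) \<Rightarrow> real \<Rightarrow> (nat \<Rightarrow> nat \<Rightarrow> real) measure \<Rightarrow> nat set \<Rightarrow> nat set \<Rightarrow> bool" where
  "tv_lipschitz_cond d L \<mu> I J \<longleftrightarrow>
    (I \<noteq> {} \<and> J \<noteq> {} \<longrightarrow>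
      (\<exists>\<kappa>. regular_cond_distr d \<mu> I J \<kappa> \<and>
        (\<forall>x\<in>space (cube d I). \<forall>y\<in>space (cube d I).
          tv_dist (\<kappa> x) (\<kappa> y) \<le> L * sup_dist d I x y)))"

definition tv_lipschitz ::
  "nat \<Rightarrow> (nat \<times> nat) set \<Rightarrow> (nat \<Rightarrow> nat) \<Rightarrow> real \<Rightarrow> (nat \<Rightarrow> nat \<Rightarrow> real) measure \<Rightarrow> bool" where
  "tv_lipschitz K G d L \<mu> \<longleftrightarrow>
    (\<forall>k\<in>{2..K}.
      tv_lipschitz_cond d L \<mu> (pa G k) {k} \<and>
      tv_lipschitz_cond d L \<mu> (pa G k) (pre G k) \<and>
      tv_lipschitz_cond d L \<mu> {k} (pa G k))"

section \<open>The minimax risk\<close>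

text \<open>An estimator is measurable for the sigma-algebra generated by the evaluations
  \<open>\<nu> \<mapsto> \<nu>(A)\<close>, which is the Borel sigma-algebra of the weak topology. As \<open>wasserstein\<close> takes
  values in \<open>ennreal\<close>, all suprema, infima and integrals below are unconditionally defined.\<close>

definition minimax_risk ::
  "nat \<Rightarrow> (nat \<Rightarrow> nat) \<Rightarrow> (nat \<Rightarrow> nat \<Rightarrow> real) measure set \<Rightarrow> nat \<Rightarrow> ennreal" where
  "minimax_risk K d Q n =
    (INF E \<in> PiM {..<n} (\<lambda>_. cube d {1..K}) \<rightarrow>\<^sub>M prob_algebra (cube d {1..K}).
      SUP \<mu>\<in>Q. \<integral>\<^sup>+s. wasserstein (sup_dist d {1..K}) \<mu> (E s) \<partial>PiM {..<n} (\<lambda>_. \<mu>))"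

end

(*
  Round the observations to a dyadic grid of width 2^-J, where 2^-J is about n^(-1/d_max), and
  let m be the coarser level at which 2^-m is about n^(-1/(2 + d_loc)). The estimator is the
  Bayesian network whose kernels are empirical: draw the level-m cell of x_k given the level-m
  cells of its parents, then x_k itself given only its own cell.

  Bias. Replacing the true kernels by population kernels of this form costs O(4^-m) in Wasserstein
  distance and not just O(2^-m): by Kantorovich duality one tests against a Lipschitz function,
  whose variation over a cell and the total variation between the two kernels are both
  O(2^-m); the remaining term integrates a function that is constant on cells against
  a signed kernel whose mean over each cell vanishes, up to the variation of the law of x_pre(k) given
  x_pa(k).

  Variance. Exchanging the kernels one at a time, estimated ones upstream and population ones downstream,
  leaves a function of the cells of the parents only. Since pa(k) is fully connected, the
  law of these cells under the estimated network is exactly the empirical one, so that only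
  empirical frequencies of d_loc-dimensional cells enter.
*)

theory Submission
  imports Defs
begin

text \<open>The Wasserstein distance is a supremum over Lipschitz functions that is taken before the
  expectation, so both error bounds are proved uniformly in the test function; randomness enters
  only through L1 deviations of cell frequencies. A test function is chained along the dyadic tree:
  its increment at level j is O(2^-j) and meets the frequencies of level-j cells alone. The kernels
  forget the parents below level m. Hence beyond level m only d_k-dimensional marginal frequencies
  are needed, which allows a finer grid of width n^(-1/d_max). The price is that the position of x_k
  in its cell no longer correlates with the parents; the Lipschitz condition on the parents given
  x_k makes this loss O(2^-m) in total variation. At level j \<le> m the chained error is 2^-j
  sqrt(2^(m d_pa(k) + j d_k) / n). For d_k \<ge> 2 it is largest at j = m, and there it is of the
  order of the bias 4^-m or less once n is about 2^(m (2 + d_loc)); for d_k < 2 the dimension is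
  rounded up to 2. All levels are bounded by the worst one, and their number gives the
  logarithm.\<close>

section \<open>Kantorovich duality on a finite set\<close>

text \<open>A minimiser of the squared defect of the marginals and of the cost bound has
  zero defect: the first order conditions turn into dual potentials, and the c-transform of the
  second potential is a Lipschitz function to which the assumed bound applies.\<close>

lemma finite_kantorovich:
  fixes c :: "'a \<Rightarrow> 'a \<Rightarrow> real" and p q :: "'a \<Rightarrow> real" and B :: real
  assumes S: "finite S" "S \<noteq> {}"
    and c0: "\<And>x. x \<in> S \<Longrightarrow> c x x = 0"
    and ct: "\<And>x y z. x \<in> S \<Longrightarrow> y \<in> S \<Longrightarrow> z \<in> S \<Longrightarrow> c x z \<le> c x y + c y z"
    and p: "\<And>x. x \<in> S \<Longrightarrow> 0 \<le> p x" "(\<Sum>x\<in>S. p x) = 1"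
    and q: "\<And>x. x \<in> S \<Longrightarrow> 0 \<le> q x" "(\<Sum>x\<in>S. q x) = 1"
    and B: "\<And>f. (\<And>x y. x \<in> S \<Longrightarrow> y \<in> S \<Longrightarrow> f x - f y \<le> c x y)
              \<Longrightarrow> (\<Sum>x\<in>S. p x * f x) - (\<Sum>x\<in>S. q x * f x) \<le> B"
  obtains \<pi> :: "'a \<Rightarrow> 'a \<Rightarrow> real"
  where "\<And>x y. x \<in> S \<Longrightarrow> y \<in> S \<Longrightarrow> 0 \<le> \<pi> x y"
    "\<And>x. x \<in> S \<Longrightarrow> (\<Sum>y\<in>S. \<pi> x y) = p x"
    "\<And>y. y \<in> S \<Longrightarrow> (\<Sum>x\<in>S. \<pi> x y) = q y"
    "(\<Sum>x\<in>S. \<Sum>y\<in>S. \<pi> x y * c x y) \<le> B"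
proof -
  define m1 where "m1 \<pi> x = (\<Sum>y\<in>S. \<pi> (x, y))" for \<pi> :: "'a \<times> 'a \<Rightarrow> real" and x
  define m2 where "m2 \<pi> y = (\<Sum>x\<in>S. \<pi> (x, y))" for \<pi> :: "'a \<times> 'a \<Rightarrow> real" and y
  define co where "co \<pi> = (\<Sum>x\<in>S. \<Sum>y\<in>S. \<pi> (x, y) * c x y)" for \<pi> :: "'a \<times> 'a \<Rightarrow> real"
  define \<Phi> where "\<Phi> \<pi> = (\<Sum>x\<in>S. (m1 \<pi> x - p x)^2) + (\<Sum>y\<in>S. (m2 \<pi> y - q y)^2)
      + (max 0 (co \<pi> - B))^2" for \<pi>
  \<comment> \<open>Joint laws on \<open>S \<times> S\<close> with arbitrary marginals, so that the
    set is convex and mass may be moved towards any point. Forcing the value 0 elsewhere makes it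
    compact in the product topology even if the type is infinite.\<close>
  define T where "T = (PiE UNIV (\<lambda>z. if z \<in> S \<times> S then {0..1::real} else {0}))
      \<inter> {\<pi>. (\<Sum>x\<in>S. \<Sum>y\<in>S. \<pi> (x, y)) = 1}"
  have [continuous_intros]: "continuous_on A (\<lambda>\<pi>. \<pi> z)" for A :: "('a \<times> 'a \<Rightarrow> real) set" and z
    by (rule continuous_on_subset[OF continuous_on_product_coordinates]) auto
  have "compactin (product_topology (\<lambda>_. euclidean) UNIV)
      (PiE UNIV (\<lambda>z. if z \<in> S \<times> S then {0..1::real} else {0}))"
    by (subst compactin_PiE) auto
  then have "compact (PiE UNIV (\<lambda>z. if z \<in> S \<times> S then {0..1::real} else {0}))"
    by (simp add: euclidean_product_topology)
  moreover have "closed {\<pi> :: 'a \<times> 'a \<Rightarrow> real. (\<Sum>x\<in>S. \<Sum>y\<in>S. \<pi> (x, y)) = 1}"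
    by (intro closed_Collect_eq continuous_intros)
  ultimately have cT: "compact T"
    unfolding T_def by (rule compact_Int_closed)
  have point: "(\<lambda>z. of_bool (z = (x0, y0))) \<in> T" if "x0 \<in> S" "y0 \<in> S" for x0 y0
  proof -
    have "(\<Sum>x\<in>S. \<Sum>y\<in>S. of_bool ((x, y) = (x0, y0)) :: real)
        = (\<Sum>x\<in>S. if x = x0 then (\<Sum>y\<in>S. if y = y0 then 1 else 0) else 0)"
      by (intro sum.cong refl) (auto simp: of_bool_def)
    also have "\<dots> = 1" using S that by simp
    finally show ?thesis using that by (auto simp: T_def)
  qed
  obtain s0 where s0: "s0 \<in> S" using S by auto
  have "T \<noteq> {}" using point[OF s0 s0] by auto
  moreover have "continuous_on T \<Phi>"
    unfolding \<Phi>_def m1_def m2_def co_def by (intro continuous_intros)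
  ultimately obtain \<pi> where \<pi>: "\<pi> \<in> T" and min: "\<And>\<pi>'. \<pi>' \<in> T \<Longrightarrow> \<Phi> \<pi> \<le> \<Phi> \<pi>'"
    using continuous_attains_inf[OF cT] by blast
  have tot: "(\<Sum>x\<in>S. \<Sum>y\<in>S. \<pi> (x, y)) = 1"
    and nn: "\<And>x y. x \<in> S \<Longrightarrow> y \<in> S \<Longrightarrow> 0 \<le> \<pi> (x, y)"
    using \<pi> by (auto simp: T_def PiE_def Pi_def split: if_splits)
  define a where "a x = m1 \<pi> x - p x" for x
  define b where "b y = m2 \<pi> y - q y" for y
  define s where "s = max 0 (co \<pi> - B)"
  define l where "l = (\<Sum>x\<in>S. m1 \<pi> x * a x) + (\<Sum>y\<in>S. m2 \<pi> y * b y) + s * co \<pi>"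
  \<comment> \<open>Half the slope of \<open>\<Phi>\<close> at the minimiser towards the point mass
    at \<open>(x0, y0)\<close> is \<open>a x0 + b y0 + s * c x0 y0 - l\<close>; as the point mass
    lies in \<open>T\<close>, it cannot be negative.\<close>
  have foc: "l \<le> a x0 + b y0 + s * c x0 y0" if x0: "x0 \<in> S" and y0: "y0 \<in> S" for x0 y0
  proof -
    define e1 where "e1 x = of_bool (x = x0) - m1 \<pi> x" for x
    define e2 where "e2 y = of_bool (y = y0) - m2 \<pi> y" for y
    define r where "r = c x0 y0 - co \<pi>"
    define E where "E = (\<Sum>x\<in>S. (e1 x)^2) + (\<Sum>y\<in>S. (e2 y)^2) + r^2"
    define D where "D = (\<Sum>x\<in>S. a x * e1 x) + (\<Sum>y\<in>S. b y * e2 y) + s * r"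
    have key: "0 \<le> 2 * D + t * E" if t: "0 < t" "t \<le> 1" for t
    proof -
      define \<pi>t where "\<pi>t z = (1 - t) * \<pi> z + t * of_bool (z = (x0, y0))" for z
      have "\<pi>t \<in> T"
      proof -
        have "(\<Sum>x\<in>S. \<Sum>y\<in>S. \<pi>t (x, y)) = (1 - t) * (\<Sum>x\<in>S. \<Sum>y\<in>S. \<pi> (x, y))
            + t * (\<Sum>x\<in>S. \<Sum>y\<in>S. of_bool ((x, y) = (x0, y0)))"
          by (simp add: \<pi>t_def sum.distrib sum_distrib_left del: of_bool_eq_iff)
        also have "\<dots> = 1" using tot point[OF x0 y0] by (simp add: T_def)
        finally have 1: "(\<Sum>x\<in>S. \<Sum>y\<in>S. \<pi>t (x, y)) = 1" .
        have 2: "\<pi>t z \<in> (if z \<in> S \<times> S then {0..1} else {0})" for z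
        proof (cases "z \<in> S \<times> S")
          case True
          then have "0 \<le> \<pi> z" "\<pi> z \<le> 1" using \<pi> by (auto simp: T_def PiE_def Pi_def split: if_splits)
          then have "(1 - t) * \<pi> z \<le> (1 - t) * 1" "0 \<le> (1 - t) * \<pi> z"
            using t by (intro mult_left_mono mult_nonneg_nonneg; simp)+
          then show ?thesis using True t by (auto simp: \<pi>t_def)
        next
          case False
          then have "\<pi> z = 0" using \<pi> by (cases z) (auto simp: T_def PiE_def Pi_def split: if_splits)
          moreover have "z \<noteq> (x0, y0)" using False x0 y0 by auto
          ultimately show ?thesis using False by (simp add: \<pi>t_def)
        qed
        show ?thesis using 1 2 by (auto simp: T_def)
      qed
      then have le: "\<Phi> \<pi> \<le> \<Phi> \<pi>t" by (rule min)
      have M1: "m1 \<pi>t x - p x = a x + t * e1 x" if "x \<in> S" for x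
      proof -
        have "(\<Sum>y\<in>S. of_bool ((x, y) = (x0, y0)) :: real) = of_bool (x = x0)"
          using S y0 by (cases "x = x0") (auto simp: of_bool_def)
        moreover have "m1 \<pi>t x = (1 - t) * m1 \<pi> x + t * (\<Sum>y\<in>S. of_bool ((x, y) = (x0, y0)))"
          by (simp add: m1_def \<pi>t_def sum.distrib sum_distrib_left)
        ultimately show ?thesis by (simp add: a_def e1_def algebra_simps)
      qed
      have M2: "m2 \<pi>t y - q y = b y + t * e2 y" if "y \<in> S" for y
      proof -
        have "(\<Sum>x\<in>S. of_bool ((x, y) = (x0, y0)) :: real) = of_bool (y = y0)"
          using S x0 by (cases "y = y0") (auto simp: of_bool_def)
        moreover have "m2 \<pi>t y = (1 - t) * m2 \<pi> y + t * (\<Sum>x\<in>S. of_bool ((x, y) = (x0, y0)))"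
          by (simp add: m2_def \<pi>t_def sum.distrib sum_distrib_left)
        ultimately show ?thesis by (simp add: b_def e2_def algebra_simps)
      qed
      have C: "co \<pi>t - B = (co \<pi> - B) + t * r"
      proof -
        have "(\<Sum>x\<in>S. \<Sum>y\<in>S. of_bool ((x, y) = (x0, y0)) * c x y)
            = (\<Sum>x\<in>S. if x = x0 then (\<Sum>y\<in>S. if y = y0 then c x0 y0 else 0) else 0)"
          by (intro sum.cong refl) (auto intro!: sum.cong simp: of_bool_def)
        also have "\<dots> = c x0 y0" using S x0 y0 by simp
        finally have "(\<Sum>x\<in>S. \<Sum>y\<in>S. of_bool ((x, y) = (x0, y0)) * c x y) = c x0 y0" .
        moreover have "co \<pi>t = (1 - t) * co \<pi>
            + t * (\<Sum>x\<in>S. \<Sum>y\<in>S. of_bool ((x, y) = (x0, y0)) * c x y)"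
          unfolding co_def \<pi>t_def
          by (simp only: sum.distrib[symmetric] sum_distrib_left) (simp add: algebra_simps)
        ultimately show ?thesis by (simp add: r_def algebra_simps)
      qed
      \<comment> \<open>Dropping the positive part only increases the square. So a quadratic in
        \<open>t\<close> dominates \<open>\<Phi>\<close> along the segment, with equality at
        \<open>t = 0\<close>, and the maximum need not be differentiated.\<close>
      have "(max 0 (co \<pi>t - B))^2 \<le> (s + t * r)^2"
      proof -
        have "max 0 (co \<pi>t - B) \<le> \<bar>s + t * r\<bar>" unfolding C s_def by auto
        then have "(max 0 (co \<pi>t - B))^2 \<le> \<bar>s + t * r\<bar>^2" by (intro power_mono) auto
        then show ?thesis by simp
      qed
      then have "\<Phi> \<pi>t \<le> (\<Sum>x\<in>S. (a x + t * e1 x)^2) + (\<Sum>y\<in>S. (b y + t * e2 y)^2) + (s + t * r)^2"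
        unfolding \<Phi>_def using M1 M2 by (simp cong: sum.cong)
      also have "\<dots> = \<Phi> \<pi> + t * (2 * D + t * E)"
        unfolding \<Phi>_def D_def E_def a_def[symmetric] b_def[symmetric] s_def[symmetric]
        by (simp add: power2_sum sum.distrib sum_distrib_left algebra_simps power2_eq_square)
      finally have "0 \<le> t * (2 * D + t * E)" using le by linarith
      then show ?thesis using t by (simp add: zero_le_mult_iff)
    qed
    have "0 \<le> D"
    proof (rule ccontr)
      assume "\<not> 0 \<le> D"
      then have D: "D < 0" by simp
      have E0: "0 \<le> E" unfolding E_def by (intro add_nonneg_nonneg sum_nonneg) auto
      \<comment> \<open>Small enough that \<open>t * E \<le> - D\<close>, which makes
        \<open>2 * D + t * E\<close> negative; the 1 in the denominator covers
        \<open>E = 0\<close>.\<close>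
      define t where "t = min 1 (- D / (E + 1))"
      have t: "0 < t" "t \<le> 1" using D E0 by (auto simp: t_def field_simps)
      have "t * E \<le> (- D / (E + 1)) * E" using E0 by (intro mult_right_mono) (auto simp: t_def)
      also have "\<dots> \<le> - D" using D E0 by (simp add: field_simps mult_nonneg_nonpos)
      finally show False using key[OF t] D by linarith
    qed
    moreover have "(\<Sum>x\<in>S. a x * of_bool (x = x0)) = a x0" "(\<Sum>y\<in>S. b y * of_bool (y = y0)) = b y0"
      using S x0 y0 by (simp_all add: of_bool_def if_distrib cong: if_cong)
    ultimately show ?thesis
      unfolding D_def l_def e1_def e2_def r_def
      by (simp add: right_diff_distrib sum_subtractf algebra_simps)
  qed
  define f where "f x = Min ((\<lambda>y. s * c x y + b y) ` S)" for x
  have fin: "finite ((\<lambda>y. s * c x y + b y) ` S)" "(\<lambda>y. s * c x y + b y) ` S \<noteq> {}" for x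
    using S by auto
  have s_nn: "0 \<le> s" by (simp add: s_def)
  have f_lip: "f x - f y \<le> s * c x y" if "x \<in> S" "y \<in> S" for x y
  proof -
    have "f y \<in> (\<lambda>z. s * c y z + b z) ` S" unfolding f_def by (rule Min_in[OF fin])
    then obtain z where z: "z \<in> S" "f y = s * c y z + b z" by auto
    have "f x \<le> s * c x z + b z" unfolding f_def using fin(1) z by (intro Min_le) auto
    moreover have "s * c x z \<le> s * (c x y + c y z)"
      using ct that z s_nn by (intro mult_left_mono) auto
    ultimately show ?thesis using z by (simp add: algebra_simps)
  qed
  have f_b: "f x \<le> b x" if "x \<in> S" for x
  proof -
    have "f x \<le> s * c x x + b x" unfolding f_def using fin(1) that by (intro Min_le) auto
    then show ?thesis using c0 that by simp
  qed
  have f_a: "l \<le> a x + f x" if "x \<in> S" for x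
  proof -
    have "f x \<in> (\<lambda>z. s * c x z + b z) ` S" unfolding f_def by (rule Min_in[OF fin])
    then obtain z where z: "z \<in> S" "f x = s * c x z + b z" by auto
    then show ?thesis using foc[OF that z(1)] by simp
  qed
  \<comment> \<open>\<open>f\<close> is \<open>s\<close> times an admissible test function. For
    \<open>s = 0\<close> it is constant, and the two means agree because both weights sum to
    1.\<close>
  have f_B: "(\<Sum>x\<in>S. p x * f x) - (\<Sum>x\<in>S. q x * f x) \<le> s * B"
  proof (cases "s = 0")
    case True
    have "f x = f s0" if "x \<in> S" for x
      using f_lip[OF that s0] f_lip[OF s0 that] True by simp
    then have "(\<Sum>x\<in>S. p x * f x) = (\<Sum>x\<in>S. p x) * f s0" "(\<Sum>x\<in>S. q x * f x) = (\<Sum>x\<in>S. q x) * f s0"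
      by (simp_all add: sum_distrib_right)
    then show ?thesis using True p q by simp
  next
    case False
    then have sp: "s > 0" using s_nn by simp
    have "(\<Sum>x\<in>S. p x * (f x / s)) - (\<Sum>x\<in>S. q x * (f x / s)) \<le> B"
      using f_lip sp by (intro B) (simp add: diff_divide_distrib[symmetric] field_simps)
    then have "((\<Sum>x\<in>S. p x * f x) - (\<Sum>x\<in>S. q x * f x)) / s \<le> B"
      by (simp add: sum_divide_distrib diff_divide_distrib)
    then show ?thesis using sp by (simp add: field_simps)
  qed
  have "l - (\<Sum>x\<in>S. p x * f x) = (\<Sum>x\<in>S. p x * (l - f x))"
    using p by (simp add: right_diff_distrib sum_subtractf sum_distrib_right[symmetric])
  also have "\<dots> \<le> (\<Sum>x\<in>S. p x * a x)"
    using p f_a by (intro sum_mono mult_left_mono) (auto simp: algebra_simps)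
  finally have 1: "l - (\<Sum>x\<in>S. p x * f x) \<le> (\<Sum>x\<in>S. p x * a x)" .
  have 2: "(\<Sum>x\<in>S. q x * f x) \<le> (\<Sum>x\<in>S. q x * b x)"
    using q f_b by (intro sum_mono mult_left_mono) auto
  have 3: "(\<Sum>x\<in>S. m1 \<pi> x * a x) = (\<Sum>x\<in>S. p x * a x) + (\<Sum>x\<in>S. (a x)^2)"
    unfolding sum.distrib[symmetric] by (intro sum.cong) (auto simp: a_def power2_eq_square algebra_simps)
  have 4: "(\<Sum>x\<in>S. m2 \<pi> x * b x) = (\<Sum>x\<in>S. q x * b x) + (\<Sum>x\<in>S. (b x)^2)"
    unfolding sum.distrib[symmetric] by (intro sum.cong) (auto simp: b_def power2_eq_square algebra_simps)
  have 5: "s * co \<pi> - s * B = s^2"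
    by (auto simp: s_def power2_eq_square max_def algebra_simps)
  \<comment> \<open>Inserting the marginals \<open>p + a\<close> and \<open>q + b\<close> into
    \<open>l\<close> (3, 4) and using 5 splits \<open>l\<close> into dual terms and squares; 1, 2
    and \<open>f_B\<close> dispose of the dual terms.\<close>
  have "(\<Sum>x\<in>S. (a x)^2) + (\<Sum>x\<in>S. (b x)^2) + s^2 \<le> 0"
    using 1 2 3 4 5 f_B unfolding l_def by linarith
  moreover have "0 \<le> (\<Sum>x\<in>S. (a x)^2)" "0 \<le> (\<Sum>x\<in>S. (b x)^2)" "0 \<le> s^2"
    by (auto intro: sum_nonneg)
  ultimately have z: "(\<Sum>x\<in>S. (a x)^2) = 0" "(\<Sum>x\<in>S. (b x)^2) = 0" "s^2 = 0" by linarith+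
  show ?thesis
  proof (rule that[of "\<lambda>x y. \<pi> (x, y)"])
    show "(\<Sum>y\<in>S. \<pi> (x, y)) = p x" if "x \<in> S" for x
      using z(1) S that by (simp add: sum_nonneg_eq_0_iff a_def m1_def)
    show "(\<Sum>x\<in>S. \<pi> (x, y)) = q y" if "y \<in> S" for y
      using z(2) S that by (simp add: sum_nonneg_eq_0_iff b_def m2_def)
    show "(\<Sum>x\<in>S. \<Sum>y\<in>S. \<pi> (x, y) * c x y) \<le> B"
      using z(3) by (auto simp: s_def co_def[symmetric])
  qed (use nn in auto)
qed

section \<open>Wasserstein distance to a finitely supported measure\<close>

text \<open>Transport along the identity replaces the power set of \<open>S\<close> by the
  sigma-algebra of \<open>M\<close>, on which an estimator has to live.\<close>

definition discrete_measure :: "'a measure \<Rightarrow> 'a set \<Rightarrow> ('a \<Rightarrow> real) \<Rightarrow> 'a measure" where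
  "discrete_measure M S w = distr (point_measure S (\<lambda>x. ennreal (w x))) M (\<lambda>x. x)"

lemma sets_discrete_measure [simp]: "sets (discrete_measure M S w) = sets M"
  and space_discrete_measure [simp]: "space (discrete_measure M S w) = space M"
  by (simp_all add: discrete_measure_def)

lemma nn_integral_discrete_measure:
  assumes "finite S" "S \<subseteq> space M" "f \<in> borel_measurable M"
  shows "(\<integral>\<^sup>+x. f x \<partial>discrete_measure M S w) = (\<Sum>x\<in>S. ennreal (w x) * f x)"
proof -
  have "(\<integral>\<^sup>+x. f x \<partial>discrete_measure M S w) = (\<integral>\<^sup>+x. f x \<partial>point_measure S (\<lambda>x. ennreal (w x)))"
    unfolding discrete_measure_def
    using assms by (intro nn_integral_distr) (auto simp: measurable_def space_point_measure sets_point_measure)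
  also have "\<dots> = (\<Sum>x\<in>S. ennreal (w x) * f x)"
    using assms by (simp add: nn_integral_point_measure_finite)
  finally show ?thesis .
qed

lemma emeasure_discrete_measure:
  assumes "finite S" "S \<subseteq> space M" "A \<in> sets M"
  shows "emeasure (discrete_measure M S w) A = (\<Sum>x\<in>S. ennreal (w x) * indicator A x)"
  using nn_integral_discrete_measure[OF assms(1,2), of "indicator A" w] assms
  by (simp add: nn_integral_indicator)

text \<open>The optimal coupling \<open>\<pi>\<close> of the law \<open>p\<close> of the rounded point with \<open>w\<close> is lifted to \<open>M\<close> by the
  density \<open>\<pi> (r x) t / p (r x)\<close>.\<close>

lemma wasserstein_discrete_le:
  fixes M :: "'a measure" and \<rho> :: "'a \<Rightarrow> 'a \<Rightarrow> real"
  assumes M: "prob_space M"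
    and S: "finite S" "S \<noteq> {}" "S \<subseteq> space M" "\<And>s. s \<in> S \<Longrightarrow> {s} \<in> sets M"
    and r: "\<And>x. x \<in> space M \<Longrightarrow> r x \<in> S" "\<And>s. s \<in> S \<Longrightarrow> {x \<in> space M. r x = s} \<in> sets M"
    and w: "\<And>x. x \<in> S \<Longrightarrow> 0 \<le> w x" "(\<Sum>x\<in>S. w x) = 1"
    and rho0: "\<And>x. x \<in> S \<Longrightarrow> \<rho> x x = 0"
    and tri: "\<And>x y z. x \<in> S \<Longrightarrow> y \<in> S \<Longrightarrow> z \<in> S \<Longrightarrow> \<rho> x z \<le> \<rho> x y + \<rho> y z"
    and near: "\<And>x y. x \<in> space M \<Longrightarrow> y \<in> S \<Longrightarrow> \<rho> x y \<le> e + \<rho> (r x) y"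
    and nonneg: "\<And>x y. x \<in> S \<Longrightarrow> y \<in> S \<Longrightarrow> 0 \<le> \<rho> x y" "0 \<le> e"
    and B: "\<And>f. (\<And>x y. x \<in> S \<Longrightarrow> y \<in> S \<Longrightarrow> f x - f y \<le> \<rho> x y)
      \<Longrightarrow> (\<Sum>s\<in>S. measure M {x \<in> space M. r x = s} * f s) - (\<Sum>s\<in>S. w s * f s) \<le> B"
  shows "wasserstein \<rho> M (discrete_measure M S w) \<le> ennreal (e + B)"
proof -
  interpret prob_space M by fact
  define E where "E = discrete_measure M S w"
  define p where "p s = measure M {x \<in> space M. r x = s}" for s
  have p_nn: "0 \<le> p s" for s by (simp add: p_def)
  have p_em: "emeasure M {x \<in> space M. r x = s} = ennreal (p s)" for s
    by (simp add: p_def emeasure_eq_measure)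
  have p1: "(\<Sum>s\<in>S. p s) = 1"
  proof -
    have "(\<Sum>s\<in>S. p s) = measure M (\<Union>s\<in>S. {x \<in> space M. r x = s})"
      unfolding p_def using S r by (intro finite_measure_finite_Union[symmetric])
        (auto simp: disjoint_family_on_def)
    also have "(\<Union>s\<in>S. {x \<in> space M. r x = s}) = space M" using r by auto
    finally show ?thesis by (simp add: prob_space)
  qed
  have "\<exists>\<pi>. (\<forall>x\<in>S. \<forall>y\<in>S. 0 \<le> \<pi> x y) \<and> (\<forall>x\<in>S. (\<Sum>y\<in>S. \<pi> x y) = p x)
      \<and> (\<forall>y\<in>S. (\<Sum>x\<in>S. \<pi> x y) = w y) \<and> (\<Sum>x\<in>S. \<Sum>y\<in>S. \<pi> x y * \<rho> x y) \<le> B"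
    by (rule finite_kantorovich[of S \<rho> p w B];
        (rule S(1,2) rho0 tri p_nn p1 w; assumption | rule B[folded p_def]; blast | blast))
  then obtain \<pi> where \<pi>: "\<And>x y. x \<in> S \<Longrightarrow> y \<in> S \<Longrightarrow> 0 \<le> \<pi> x y"
    "\<And>x. x \<in> S \<Longrightarrow> (\<Sum>y\<in>S. \<pi> x y) = p x"
    "\<And>y. y \<in> S \<Longrightarrow> (\<Sum>x\<in>S. \<pi> x y) = w y"
    "(\<Sum>x\<in>S. \<Sum>y\<in>S. \<pi> x y * \<rho> x y) \<le> B"
    by blast
  \<comment> \<open>Cells of probability zero carry no coupling mass, so the value
    \<open>0 / 0 = 0\<close> of the density below loses nothing.\<close>
  have \<pi>0: "\<pi> s t = 0" if "p s = 0" "s \<in> S" "t \<in> S" for s t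
  proof -
    have "(\<Sum>y\<in>S. \<pi> s y) = 0" using \<pi>(2) that by simp
    then show ?thesis using \<pi>(1) that S by (simp add: sum_nonneg_eq_0_iff)
  qed
  define g where "g x t = ennreal (\<pi> (r x) t / p (r x))" for x t
  let ?C = "count_space S"
  define Q where "Q = density (M \<Otimes>\<^sub>M ?C) (\<lambda>z. g (fst z) (snd z))"
  \<comment> \<open>\<open>Q\<close> lives on \<open>M\<close> times the discrete set
    \<open>S\<close>; the identity moves it to the product with the sigma-algebra of
    \<open>E\<close>, as \<open>couplings\<close> demands.\<close>
  define P where "P = distr Q (M \<Otimes>\<^sub>M E) (\<lambda>z. z)"
  have r_meas: "r \<in> M \<rightarrow>\<^sub>M ?C"
    using r S by (intro measurable_count_space_eq2[THEN iffD2]) (auto simp: vimage_def Int_def conj_commute)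
  have g_eq: "g x t = (\<Sum>s\<in>S. \<Sum>u\<in>S. ennreal (\<pi> s u / p s) * (of_bool (r x = s) * of_bool (t = u)))"
    if "x \<in> space M" "t \<in> S" for x t
  proof -
    have "(\<Sum>s\<in>S. \<Sum>u\<in>S. ennreal (\<pi> s u / p s) * (of_bool (r x = s) * of_bool (t = u)))
      = (\<Sum>s\<in>S. if s = r x then (\<Sum>u\<in>S. if u = t then ennreal (\<pi> s u / p s) else 0) else 0)"
      by (intro sum.cong refl) (auto intro!: sum.cong)
    also have "\<dots> = g x t" using S r that by (simp add: g_def)
    finally show ?thesis by simp
  qed
  have sC: "sigma_finite_measure ?C" using S(1) by (rule sigma_finite_measure_count_space_finite)
  have idm: "(\<lambda>z. z) \<in> M \<Otimes>\<^sub>M ?C \<rightarrow>\<^sub>M M \<Otimes>\<^sub>M E"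
  proof -
    have "(\<lambda>z. (fst z, snd z)) \<in> M \<Otimes>\<^sub>M ?C \<rightarrow>\<^sub>M M \<Otimes>\<^sub>M E"
    proof (intro measurable_Pair)
      have "(\<lambda>x. x) \<in> ?C \<rightarrow>\<^sub>M E" using S by (auto simp: E_def measurable_def)
      then show "snd \<in> M \<Otimes>\<^sub>M ?C \<rightarrow>\<^sub>M E" using measurable_compose[OF measurable_snd, where g="\<lambda>x. x"] by blast
    qed simp
    then show ?thesis by simp
  qed
  have gm: "(\<lambda>z. g (fst z) (snd z)) \<in> borel_measurable (M \<Otimes>\<^sub>M ?C)"
  proof -
    have "(\<lambda>z. (r (fst z), snd z)) \<in> M \<Otimes>\<^sub>M ?C \<rightarrow>\<^sub>M ?C \<Otimes>\<^sub>M ?C"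
      using r_meas by (intro measurable_Pair measurable_compose[OF measurable_fst]) auto
    moreover have "(\<lambda>z. ennreal (\<pi> (fst z) (snd z) / p (fst z))) \<in> borel_measurable (?C \<Otimes>\<^sub>M ?C)"
      using S by (simp add: pair_measure_countable uncountable_def countable_finite)
    ultimately have "(\<lambda>z. ennreal (\<pi> (r (fst z)) (snd z) / p (r (fst z)))) \<in> borel_measurable (M \<Otimes>\<^sub>M ?C)"
      using measurable_compose[where f="\<lambda>z. (r (fst z), snd z)" and g="\<lambda>z. ennreal (\<pi> (fst z) (snd z) / p (fst z))"]
      by (metis (no_types, lifting) fst_conv snd_conv measurable_cong)
    then show ?thesis by (simp add: g_def)
  qed
  have int_P: "(\<integral>\<^sup>+z. f z \<partial>P) = (\<Sum>s\<in>S. \<Sum>t\<in>S. ennreal (\<pi> s t / p s) * (\<integral>\<^sup>+x. f (x, t) * indicator {x \<in> space M. r x = s} x \<partial>M))"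
    if f: "f \<in> borel_measurable (M \<Otimes>\<^sub>M E)" for f
  proof -
    have f': "f \<in> borel_measurable (M \<Otimes>\<^sub>M ?C)"
      using measurable_compose[OF idm f] by simp
    have ft: "(\<lambda>x. f (x, t)) \<in> borel_measurable M" if "t \<in> S" for t
      using measurable_compose[OF measurable_Pair2'[of t E M] f] that S by (auto simp: E_def)
    have "(\<integral>\<^sup>+z. f z \<partial>P) = (\<integral>\<^sup>+z. f z \<partial>Q)"
      unfolding P_def using idm f by (intro nn_integral_distr) (auto simp: Q_def)
    also have "\<dots> = (\<integral>\<^sup>+z. g (fst z) (snd z) * f z \<partial>(M \<Otimes>\<^sub>M ?C))"
      unfolding Q_def using gm f' by (intro nn_integral_density)
    also have "\<dots> = (\<integral>\<^sup>+x. \<integral>\<^sup>+t. g x t * f (x, t) \<partial>?C \<partial>M)"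
      using gm f' by (subst sigma_finite_measure.nn_integral_fst[OF sC, symmetric]) auto
    also have "\<dots> = (\<integral>\<^sup>+x. (\<Sum>s\<in>S. \<Sum>t\<in>S. ennreal (\<pi> s t / p s) * (f (x, t) * indicator {x \<in> space M. r x = s} x)) \<partial>M)"
    proof (intro nn_integral_cong)
      fix x assume x: "x \<in> space M"
      have "(\<integral>\<^sup>+t. g x t * f (x, t) \<partial>?C) = (\<Sum>t\<in>S. g x t * f (x, t))"
        using S by (simp add: nn_integral_count_space_finite)
      also have "\<dots> = (\<Sum>s\<in>S. if s = r x then (\<Sum>t\<in>S. ennreal (\<pi> s t / p s) * f (x, t)) else 0)"
        using S r x by (simp add: g_def)
      also have "\<dots> = (\<Sum>s\<in>S. \<Sum>t\<in>S. ennreal (\<pi> s t / p s) * (f (x, t) * indicator {x \<in> space M. r x = s} x))"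
        using x by (intro sum.cong refl) (auto simp: indicator_def)
      finally show "(\<integral>\<^sup>+t. g x t * f (x, t) \<partial>?C) = \<dots>" .
    qed
    also have "\<dots> = (\<Sum>s\<in>S. \<Sum>t\<in>S. ennreal (\<pi> s t / p s) * (\<integral>\<^sup>+x. f (x, t) * indicator {x \<in> space M. r x = s} x \<partial>M))"
      using ft r(2) by (simp add: nn_integral_sum nn_integral_cmult)
    finally show ?thesis .
  qed
  have ratio: "ennreal (\<pi> s t / p s) * ennreal (p s) = ennreal (\<pi> s t)" if "s \<in> S" "t \<in> S" for s t
    using \<pi>0[OF _ that] \<pi>(1)[OF that] p_nn[of s] by (cases "p s = 0") (auto simp: ennreal_mult[symmetric])
  have sP: "sets P = sets (M \<Otimes>\<^sub>M E)" by (simp add: P_def)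
  have fstP: "distr P M fst = M"
  proof (rule measure_eqI)
    fix A assume "A \<in> sets (distr P M fst)"
    then have A: "A \<in> sets M" by simp
    have "emeasure (distr P M fst) A = (\<integral>\<^sup>+z. indicator A z \<partial>distr P M fst)"
      using A by simp
    also have "\<dots> = (\<integral>\<^sup>+z. indicator A (fst z) \<partial>P)"
      using A by (subst nn_integral_distr) (auto simp: measurable_cong_sets[OF sP refl])
    also have "\<dots> = (\<Sum>s\<in>S. \<Sum>t\<in>S. ennreal (\<pi> s t / p s) * emeasure M (A \<inter> {x \<in> space M. r x = s}))"
      using A r(2) by (subst int_P) (auto simp: nn_integral_indicator[symmetric] indicator_inter_arith
          simp del: nn_integral_indicator intro!: sum.cong)
    also have "\<dots> = (\<Sum>s\<in>S. emeasure M (A \<inter> {x \<in> space M. r x = s}))"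
    proof (intro sum.cong refl)
      fix s assume s: "s \<in> S"
      have "(\<Sum>t\<in>S. ennreal (\<pi> s t / p s)) = ennreal ((\<Sum>t\<in>S. \<pi> s t) / p s)"
        using \<pi>(1) s p_nn[of s] by (subst sum_ennreal) (auto simp: sum_divide_distrib)
      also have "\<dots> = ennreal (p s / p s)" using \<pi>(2) s by simp
      finally have 1: "(\<Sum>t\<in>S. ennreal (\<pi> s t / p s)) = ennreal (p s / p s)" .
      show "(\<Sum>t\<in>S. ennreal (\<pi> s t / p s) * emeasure M (A \<inter> {x \<in> space M. r x = s}))
          = emeasure M (A \<inter> {x \<in> space M. r x = s})"
      proof (cases "p s = 0")
        case True
        have "emeasure M (A \<inter> {x \<in> space M. r x = s}) \<le> emeasure M {x \<in> space M. r x = s}"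
          using r(2)[OF s] by (intro emeasure_mono) auto
        then have "emeasure M (A \<inter> {x \<in> space M. r x = s}) = 0" using True p_em[of s] by simp
        then show ?thesis by simp
      next
        case False
        then show ?thesis using 1 by (simp add: sum_distrib_right[symmetric])
      qed
    qed
    also have "\<dots> = emeasure M (\<Union>s\<in>S. A \<inter> {x \<in> space M. r x = s})"
      using S r(2) A by (intro sum_emeasure) (auto simp: disjoint_family_on_def)
    also have "(\<Union>s\<in>S. A \<inter> {x \<in> space M. r x = s}) = A"
      using r(1) sets.sets_into_space[OF A] by auto
    finally show "emeasure (distr P M fst) A = emeasure M A" .
  qed simp
  have sndP: "distr P E snd = E"
  proof (rule measure_eqI)
    fix A assume "A \<in> sets (distr P E snd)"
    then have A: "A \<in> sets M" by (simp add: E_def)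
    have AE: "A \<in> sets E" using A by (simp add: E_def)
    have "emeasure (distr P E snd) A = (\<integral>\<^sup>+z. indicator A z \<partial>distr P E snd)"
      using AE by simp
    also have "\<dots> = (\<integral>\<^sup>+z. indicator A (snd z) \<partial>P)"
      using AE by (subst nn_integral_distr) (auto simp: measurable_cong_sets[OF sP refl])
    also have "\<dots> = (\<Sum>s\<in>S. \<Sum>t\<in>S. ennreal (\<pi> s t) * indicator A t)"
      using AE r(2) by (subst int_P) (auto simp: nn_integral_cmult_indicator p_em ratio[symmetric] mult_ac
          intro!: sum.cong)
    also have "\<dots> = (\<Sum>t\<in>S. (\<Sum>s\<in>S. ennreal (\<pi> s t)) * indicator A t)"
      by (subst sum.swap) (simp add: sum_distrib_right)
    also have "\<dots> = (\<Sum>t\<in>S. ennreal (w t) * indicator A t)"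
      using \<pi>(1,3) by (intro sum.cong refl) (auto simp: sum_ennreal)
    also have "\<dots> = emeasure E A"
      unfolding E_def using S A by (intro emeasure_discrete_measure[symmetric])
    finally show "emeasure (distr P E snd) A = emeasure E A" .
  qed simp
  \<comment> \<open>A measurable majorant of the cost, since \<open>\<rho>\<close> is not assumed
    measurable. The value \<open>\<top>\<close> off \<open>S\<close> costs nothing, because
    \<open>P\<close> is carried by points with second component in \<open>S\<close>.\<close>
  define h where "h z = (\<Sum>s\<in>S. \<Sum>t\<in>S. ennreal (e + \<rho> s t) * indicator ({x \<in> space M. r x = s} \<times> {t}) z)
      + \<top> * indicator (space M \<times> (space M - S)) z" for z
  have SM: "S \<in> sets M"
    using S sets.finite_UN[of S "\<lambda>s. {s}" M] by simp
  have hm: "h \<in> borel_measurable (M \<Otimes>\<^sub>M E)"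
    unfolding h_def using S r SM
    by (intro borel_measurable_add borel_measurable_sum borel_measurable_times_ennreal
        borel_measurable_indicator pair_measureI borel_measurable_const) (auto simp: E_def)
  have h_S: "h (x, t) = ennreal (e + \<rho> (r x) t)" if "x \<in> space M" "t \<in> S" for x t
  proof -
    have "h (x, t) = (\<Sum>s\<in>S. if s = r x then (\<Sum>u\<in>S. if u = t then ennreal (e + \<rho> s u) else 0) else 0)"
      using that unfolding h_def by (auto simp: indicator_def intro!: sum.cong)
    then show ?thesis using S r that by simp
  qed
  have "(\<integral>\<^sup>+(x, y). ennreal (\<rho> x y) \<partial>P) \<le> (\<integral>\<^sup>+z. h z \<partial>P)"
  proof (intro nn_integral_mono, clarify)
    fix x y assume "(x, y) \<in> space P"
    then have xy: "x \<in> space M" "y \<in> space M" by (auto simp: P_def E_def space_pair_measure)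
    show "ennreal (\<rho> x y) \<le> h (x, y)"
    proof (cases "y \<in> S")
      case True then show ?thesis using h_S[of x y] xy near[of x y] by (auto intro!: ennreal_leI)
    next
      case False then show ?thesis using xy by (simp add: h_def)
    qed
  qed
  also have "\<dots> = (\<Sum>s\<in>S. \<Sum>t\<in>S. ennreal (\<pi> s t * (e + \<rho> s t)))"
  proof (subst int_P[OF hm], intro sum.cong refl)
    fix s t assume st: "s \<in> S" "t \<in> S"
    have "(\<integral>\<^sup>+x. h (x, t) * indicator {x \<in> space M. r x = s} x \<partial>M)
       = (\<integral>\<^sup>+x. ennreal (e + \<rho> s t) * indicator {x \<in> space M. r x = s} x \<partial>M)"
      using st h_S by (intro nn_integral_cong) (auto simp: indicator_def)
    also have "\<dots> = ennreal (e + \<rho> s t) * ennreal (p s)"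
      using r(2)[OF st(1)] by (simp add: nn_integral_cmult_indicator p_em)
    finally show "ennreal (\<pi> s t / p s) * (\<integral>\<^sup>+x. h (x, t) * indicator {x \<in> space M. r x = s} x \<partial>M)
        = ennreal (\<pi> s t * (e + \<rho> s t))"
      using nonneg st \<pi>(1) by (simp add: ennreal_mult ratio[OF st, symmetric] mult_ac del: ennreal_plus)
  qed
  also have "\<dots> = ennreal (\<Sum>s\<in>S. \<Sum>t\<in>S. \<pi> s t * (e + \<rho> s t))"
    using nonneg \<pi>(1) by (simp add: sum_ennreal sum_nonneg)
  also have "(\<Sum>s\<in>S. \<Sum>t\<in>S. \<pi> s t * (e + \<rho> s t)) = e + (\<Sum>s\<in>S. \<Sum>t\<in>S. \<pi> s t * \<rho> s t)"
    using \<pi>(2) p1 by (simp add: distrib_left sum.distrib sum_distrib_right[symmetric])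
  also have "ennreal \<dots> \<le> ennreal (e + B)"
    using \<pi>(4) by (intro ennreal_leI) simp
  finally have "(\<integral>\<^sup>+(x, y). ennreal (\<rho> x y) \<partial>P) \<le> ennreal (e + B)" .
  moreover have "P \<in> couplings M E" using sP fstP sndP by (simp add: couplings_def)
  ultimately show ?thesis
    unfolding wasserstein_def E_def[symmetric] by (rule INF_lower2[rotated])
qed

section \<open>Integration against a network of kernels\<close>

definition net_step ::
  "(nat \<Rightarrow> 'b set) \<Rightarrow> (nat \<Rightarrow> (nat \<Rightarrow> 'b) \<Rightarrow> 'b \<Rightarrow> real) \<Rightarrow> nat \<Rightarrow> ((nat \<Rightarrow> 'b) \<Rightarrow> real) \<Rightarrow> (nat \<Rightarrow> 'b) \<Rightarrow> real"
  where "net_step S q k F x = (\<Sum>y\<in>S k. q k x y * F (x(k := y)))"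

text \<open>\<open>foldr\<close> makes the last node of the list the innermost integral, so a kernel
  sees the values already drawn for the nodes before it; the argument supplies the coordinates
  outside the list.\<close>

definition net ::
  "(nat \<Rightarrow> 'b set) \<Rightarrow> (nat \<Rightarrow> (nat \<Rightarrow> 'b) \<Rightarrow> 'b \<Rightarrow> real) \<Rightarrow> nat list \<Rightarrow> ((nat \<Rightarrow> 'b) \<Rightarrow> real) \<Rightarrow> (nat \<Rightarrow> 'b) \<Rightarrow> real"
  where "net S q l F = foldr (net_step S q) l F"

lemma net_Nil [simp]: "net S q [] F = F"
  and net_Cons: "net S q (k # l) F = net_step S q k (net S q l F)"
  and net_append: "net S q (l1 @ l2) F = net S q l1 (net S q l2 F)"
  by (simp_all add: net_def)

lemma net_upt_split:
  assumes "a \<le> b" "b \<le> c"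
  shows "net S q [a..<c] F = net S q [a..<b] (net S q [b..<c] F)"
  using upt_add_eq_append[of a b "c - b"] assms by (simp add: net_append[symmetric])

lemma net_upt_Suc:
  assumes "a \<le> b"
  shows "net S q [a..<Suc b] F = net S q [a..<b] (net_step S q b F)"
  using assms by (simp add: net_append net_Cons)

lemma net_upt_rec:
  assumes "a < b"
  shows "net S q [a..<b] F = net_step S q a (net S q [Suc a..<b] F)"
  using assms by (simp add: upt_conv_Cons net_Cons)

lemma net_diff: "net S q l (\<lambda>z. F z - F' z) x = net S q l F x - net S q l F' x"
  by (induction l arbitrary: x) (simp_all add: net_Cons net_step_def right_diff_distrib sum_subtractf)

lemma net_cmult: "net S q l (\<lambda>z. c * F z) x = c * net S q l F x"
  by (induction l arbitrary: x) (simp_all add: net_Cons net_step_def sum_distrib_left mult_ac)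

lemma net_zero: "net S q l (\<lambda>z. 0) x = 0"
  by (induction l arbitrary: x) (simp_all add: net_Cons net_step_def)

lemma net_add: "net S q l (\<lambda>z. F z + F' z) x = net S q l F x + net S q l F' x"
  by (induction l arbitrary: x) (simp_all add: net_Cons net_step_def distrib_left sum.distrib)

lemma net_sum: "net S q l (\<lambda>z. \<Sum>i\<in>I. F i z) x = (\<Sum>i\<in>I. net S q l (F i) x)"
  by (induction I rule: infinite_finite_induct) (simp_all add: net_zero net_add)

text \<open>Only the nodes before \<open>a\<close> are constrained: these have been drawn, while
  later coordinates of the total function are still to be overwritten.\<close>

definition grid_pt :: "(nat \<Rightarrow> 'b set) \<Rightarrow> nat \<Rightarrow> (nat \<Rightarrow> 'b) \<Rightarrow> bool" where
  "grid_pt S a x \<longleftrightarrow> (\<forall>i\<in>{1..<a}. x i \<in> S i)"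

definition stochastic :: "nat \<Rightarrow> (nat \<Rightarrow> 'b set) \<Rightarrow> (nat \<Rightarrow> (nat \<Rightarrow> 'b) \<Rightarrow> 'b \<Rightarrow> real) \<Rightarrow> bool" where
  "stochastic K S q \<longleftrightarrow> (\<forall>k\<in>{1..K}. \<forall>x. grid_pt S k x \<longrightarrow>
      (\<forall>y\<in>S k. 0 \<le> q k x y) \<and> (\<Sum>y\<in>S k. q k x y) = 1)"

lemma grid_pt_upd: "grid_pt S a x \<Longrightarrow> y \<in> S a \<Longrightarrow> grid_pt S (Suc a) (x(a := y))"
  by (auto simp: grid_pt_def)

text \<open>The comparison is needed only at points that agree with \<open>x\<close> off
  \<open>{a..<b}\<close>, since nothing else is overwritten. This clause yields
  \<open>net_indep\<close> and keeps the points sampled by the estimator extensional.\<close>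

lemma net_mono:
  assumes "stochastic K S q" "1 \<le> a" "a \<le> b" "b \<le> Suc K" "grid_pt S a x"
    and "\<And>z. grid_pt S b z \<Longrightarrow> (\<And>i. i \<notin> {a..<b} \<Longrightarrow> z i = x i) \<Longrightarrow> F z \<le> F' z"
  shows "net S q [a..<b] F x \<le> net S q [a..<b] F' x"
  using assms(3) assms(2,4,5,6)
proof (induction a arbitrary: x rule: inc_induct)
  case base
  then show ?case by simp
next
  case (step a)
  have "net S q [Suc a..<b] F (x(a := y)) \<le> net S q [Suc a..<b] F' (x(a := y))" if "y \<in> S a" for y
  proof (rule step.IH)
    show "grid_pt S (Suc a) (x(a := y))" using step.prems that by (blast intro: grid_pt_upd)
    show "F z \<le> F' z" if "grid_pt S b z" "\<And>i. i \<notin> {Suc a..<b} \<Longrightarrow> z i = (x(a := y)) i" for z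
    proof (rule step.prems(4)[OF that(1)])
      fix i assume "i \<notin> {a..<b}"
      then show "z i = x i" using that(2)[of i] step.hyps by (cases "i = a") auto
    qed
  qed (use step.prems in auto)
  moreover have "0 \<le> q a x y" if "y \<in> S a" for y
    using assms(1) step.prems step.hyps that by (auto simp: stochastic_def)
  ultimately show ?case
    using step.hyps by (auto simp: net_upt_rec net_step_def intro!: sum_mono mult_left_mono)
qed

lemma net_const:
  assumes "stochastic K S q" "1 \<le> a" "a \<le> b" "b \<le> Suc K" "grid_pt S a x"
  shows "net S q [a..<b] (\<lambda>_. c) x = c"
  using assms(3) assms(2,4,5)
proof (induction a arbitrary: x rule: inc_induct)
  case base
  then show ?case by simp
next
  case (step a)
  have "net S q [Suc a..<b] (\<lambda>_. c) (x(a := y)) = c" if "y \<in> S a" for y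
    using step.prems that by (intro step.IH grid_pt_upd) auto
  moreover have "(\<Sum>y\<in>S a. q a x y) = 1"
    using assms(1) step.prems step.hyps by (auto simp: stochastic_def)
  ultimately show ?case
    using step.hyps by (simp add: net_upt_rec net_step_def sum_distrib_right[symmetric])
qed

lemma net_cong:
  assumes "stochastic K S q" "1 \<le> a" "a \<le> b" "b \<le> Suc K" "grid_pt S a x"
    and "\<And>z. grid_pt S b z \<Longrightarrow> (\<And>i. i \<notin> {a..<b} \<Longrightarrow> z i = x i) \<Longrightarrow> F z = F' z"
  shows "net S q [a..<b] F x = net S q [a..<b] F' x"
  using assms by (intro antisym net_mono) auto

lemma net_abs_le:
  assumes "stochastic K S q" "1 \<le> a" "a \<le> b" "b \<le> Suc K" "grid_pt S a x"
    and "\<And>z. grid_pt S b z \<Longrightarrow> \<bar>F z\<bar> \<le> c"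
  shows "\<bar>net S q [a..<b] F x\<bar> \<le> c"
proof -
  have "net S q [a..<b] F x \<le> net S q [a..<b] (\<lambda>_. c) x"
    using assms(6) by (intro net_mono[OF assms(1-5)]) fastforce
  moreover have "net S q [a..<b] (\<lambda>_. - c) x \<le> net S q [a..<b] F x"
    using assms(6) by (intro net_mono[OF assms(1-5)]) fastforce
  ultimately show ?thesis using net_const[OF assms(1-5)] by (simp add: abs_le_iff)
qed

lemma net_indep:
  assumes "stochastic K S q" "1 \<le> a" "a \<le> b" "b \<le> Suc K" "grid_pt S a x"
    and "\<And>z. (\<And>i. i \<notin> {a..<b} \<Longrightarrow> z i = x i) \<Longrightarrow> H z = H x"
  shows "net S q [a..<b] H x = H x"
proof -
  have "net S q [a..<b] H x = net S q [a..<b] (\<lambda>_. H x) x"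
    using assms(6) by (intro net_cong[OF assms(1-5)]) blast
  then show ?thesis using net_const[OF assms(1-5)] by simp
qed

text \<open>Each node contributes the L1 change of its kernel times the bound 1 on the function
  downstream, and averaging preserves that bound; so the constants add up over the nodes instead of
  multiplying. With equality for \<open>A\<close> and \<open>\<delta> = 0\<close> the lemma says
  that irrelevant coordinates may be changed.\<close>

lemma net_lipschitz:
  fixes \<delta> :: real
  assumes st: "stochastic K S q" and a: "1 \<le> a" "a \<le> Suc K"
    and F: "\<And>z. grid_pt S (Suc K) z \<Longrightarrow> \<bar>F z\<bar> \<le> 1"
      "\<And>z z'. grid_pt S (Suc K) z \<Longrightarrow> grid_pt S (Suc K) z' \<Longrightarrow> (\<And>i. i \<in> {1..K} \<Longrightarrow> A i (z i) (z' i))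
        \<Longrightarrow> \<bar>F z - F z'\<bar> \<le> \<delta>"
    and q: "\<And>k z z'. k \<in> {1..K} \<Longrightarrow> grid_pt S k z \<Longrightarrow> grid_pt S k z' \<Longrightarrow> (\<And>i. i \<in> {1..<k} \<Longrightarrow> A i (z i) (z' i))
        \<Longrightarrow> (\<Sum>y\<in>S k. \<bar>q k z y - q k z' y\<bar>) \<le> C * \<delta>"
    and A: "\<And>i y. A i y y"
    and x: "grid_pt S a x" "grid_pt S a x'" "\<And>i. i \<in> {1..<a} \<Longrightarrow> A i (x i) (x' i)"
    and nn: "0 \<le> C" "0 \<le> \<delta>"
  shows "\<bar>net S q [a..<Suc K] F x - net S q [a..<Suc K] F x'\<bar> \<le> (1 + C * real (Suc K - a)) * \<delta>"
  using a(2) a(1) x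
proof (induction a arbitrary: x x' rule: inc_induct)
  case base
  then show ?case using F(2)[of x x'] by (auto simp: atLeastLessThanSuc_atLeastAtMost)
next
  case (step a)
  let ?f = "net S q [Suc a..<Suc K] F"
  have IH: "\<bar>?f (x(a := y)) - ?f (x'(a := y))\<bar> \<le> (1 + C * real (K - a)) * \<delta>" if "y \<in> S a" for y
  proof -
    have "\<bar>?f (x(a := y)) - ?f (x'(a := y))\<bar> \<le> (1 + C * real (Suc K - Suc a)) * \<delta>"
    proof (rule step.IH)
      show "grid_pt S (Suc a) (x(a := y))" "grid_pt S (Suc a) (x'(a := y))"
        using step.prems that by (blast intro: grid_pt_upd)+
      show "A i ((x(a := y)) i) ((x'(a := y)) i)" if "i \<in> {1..<Suc a}" for i
        using step.prems(4)[of i] that A by (cases "i = a") auto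
    qed simp
    then show ?thesis by (simp del: upt_Suc)
  qed
  have ka: "a \<in> {1..K}" using step by auto
  have "\<bar>net S q [a..<Suc K] F x - net S q [a..<Suc K] F x'\<bar>
      = \<bar>(\<Sum>y\<in>S a. q a x y * (?f (x(a := y)) - ?f (x'(a := y)))) + (\<Sum>y\<in>S a. (q a x y - q a x' y) * ?f (x'(a := y)))\<bar>"
    using step.hyps by (simp add: net_upt_rec net_step_def sum.distrib[symmetric] sum_subtractf[symmetric] algebra_simps
        del: upt_Suc)
  also have "\<dots> \<le> (\<Sum>y\<in>S a. q a x y * ((1 + C * real (K - a)) * \<delta>)) + (\<Sum>y\<in>S a. \<bar>q a x y - q a x' y\<bar> * 1)"
  proof (intro order_trans[OF abs_triangle_ineq] add_mono order_trans[OF sum_abs] sum_mono)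
    fix y assume y: "y \<in> S a"
    show "\<bar>q a x y * (?f (x(a := y)) - ?f (x'(a := y)))\<bar> \<le> q a x y * ((1 + C * real (K - a)) * \<delta>)"
      using IH[OF y] st ka step.prems y by (auto simp: abs_mult stochastic_def intro!: mult_left_mono)
    have "\<bar>?f (x'(a := y))\<bar> \<le> 1"
      using F(1) step.prems ka y by (intro net_abs_le[OF st] grid_pt_upd) auto
    then show "\<bar>(q a x y - q a x' y) * ?f (x'(a := y))\<bar> \<le> \<bar>q a x y - q a x' y\<bar> * 1"
      unfolding abs_mult by (intro mult_left_mono) auto
  qed
  also have "\<dots> \<le> (1 + C * real (K - a)) * \<delta> + C * \<delta>"
    using q[OF ka step.prems(2,3,4)] st ka step.prems(2)
    by (auto simp: sum_distrib_right[symmetric] stochastic_def)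
  also have "\<dots> = (1 + C * real (Suc K - a)) * \<delta>"
    using step.hyps by (simp add: Suc_diff_le algebra_simps)
  finally show ?case .
qed

text \<open>Chaining: \<open>g\<close> is its value at the level-0 representative plus the
  increments from level \<open>j - 1\<close> to level \<open>j\<close>. Each is a function of the
  level-\<open>j\<close> cell, so the signed weight \<open>D\<close> enters only through its total
  over each cell. An increment compares points of one cell of level \<open>j - 1\<close>, whence
  \<open>2 * (1/2)^j\<close>.\<close>

lemma abs_sum_tree_le:
  fixes g D :: "'b \<Rightarrow> real" and r :: "nat \<Rightarrow> 'b \<Rightarrow> 'b"
  assumes S: "finite S" and r: "\<And>j y. j \<le> J \<Longrightarrow> y \<in> S \<Longrightarrow> r j y \<in> S"
    "\<And>y. y \<in> S \<Longrightarrow> r J y = y"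
    "\<And>i j y. j \<le> i \<Longrightarrow> i \<le> J \<Longrightarrow> y \<in> S \<Longrightarrow> r j (r i y) = r j y"
    and g: "\<And>y. y \<in> S \<Longrightarrow> \<bar>g y\<bar> \<le> a"
      "\<And>j y y'. j \<le> J \<Longrightarrow> y \<in> S \<Longrightarrow> y' \<in> S \<Longrightarrow> r j y = r j y' \<Longrightarrow> \<bar>g y - g y'\<bar> \<le> a * (1/2)^j"
  shows "\<bar>\<Sum>y\<in>S. D y * g y\<bar>
    \<le> (\<Sum>j\<le>J. a * (2 * (1/2)^j) * (\<Sum>w\<in>r j ` S. \<bar>\<Sum>y | y \<in> S \<and> r j y = w. D y\<bar>))"
proof (cases "S = {}")
  case False
  then obtain s where "s \<in> S" by auto
  then have a0: "0 \<le> a" using g(1)[of s] by linarith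
  define u where "u j w = (case j of 0 \<Rightarrow> g w | Suc i \<Rightarrow> g w - g (r i w))" for j w
  have u_sum: "(\<Sum>j\<le>n. u j (r j y)) = g (r n y)" if "n \<le> J" "y \<in> S" for n y
    using that by (induction n) (auto simp: u_def r(3))
  have u_le: "\<bar>u j w\<bar> \<le> a * (2 * (1/2)^j)" if j: "j \<le> J" and w: "w \<in> r j ` S" for j w
  proof (cases j)
    case 0
    then have "\<bar>g w\<bar> \<le> a" using w r(1)[of 0] g(1) by auto
    then show ?thesis using 0 a0 by (simp add: u_def)
  next
    case (Suc i)
    have "\<bar>g w - g (r i w)\<bar> \<le> a * (1/2)^i"
      using w r j Suc by (intro g(2)) auto
    then show ?thesis using Suc by (simp add: u_def)
  qed
  have "(\<Sum>y\<in>S. D y * g y) = (\<Sum>y\<in>S. \<Sum>j\<le>J. D y * u j (r j y))"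
    using u_sum[of J] r(2) by (simp add: sum_distrib_left[symmetric])
  also have "\<dots> = (\<Sum>j\<le>J. \<Sum>y\<in>S. D y * u j (r j y))" by (rule sum.swap)
  also have "\<dots> = (\<Sum>j\<le>J. \<Sum>w\<in>r j ` S. \<Sum>y | y \<in> S \<and> r j y = w. D y * u j (r j y))"
    using S by (intro sum.cong refl sum.group[symmetric]) auto
  also have "\<dots> = (\<Sum>j\<le>J. \<Sum>w\<in>r j ` S. u j w * (\<Sum>y | y \<in> S \<and> r j y = w. D y))"
    by (auto intro!: sum.cong simp: sum_distrib_left mult_ac)
  also have "\<bar>\<dots>\<bar> \<le> (\<Sum>j\<le>J. \<Sum>w\<in>r j ` S. \<bar>u j w * (\<Sum>y | y \<in> S \<and> r j y = w. D y)\<bar>)"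
    by (intro order_trans[OF sum_abs] sum_mono order_refl)
  also have "\<dots> \<le> (\<Sum>j\<le>J. \<Sum>w\<in>r j ` S. a * (2 * (1/2)^j) * \<bar>\<Sum>y | y \<in> S \<and> r j y = w. D y\<bar>)"
    unfolding abs_mult using u_le by (intro sum_mono mult_right_mono) auto
  finally show ?thesis by (simp add: sum_distrib_left)
qed simp

section \<open>Networks on nested finite partitions\<close>

text \<open>\<open>S k\<close> is the finest grid, of level \<open>J\<close>, and
  \<open>R j k\<close> sends a point to the representative of its level-\<open>j\<close> cell. Cells
  are identified with their representatives, so the cells of every level up to \<open>J\<close> are
  again points of \<open>S k\<close>.\<close>

locale clique_net =
  fixes K :: nat and G :: "(nat \<times> nat) set" and S :: "nat \<Rightarrow> 'b set"
    and R :: "nat \<Rightarrow> nat \<Rightarrow> 'b \<Rightarrow> 'b" and m J :: nat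
  assumes dag: "sorted_dag K G"
    and conn: "\<And>k. k \<in> {1..K} \<Longrightarrow> fully_connected G (pa G k)"
    and fin_S: "\<And>k. finite (S k)"
    and ne_S: "\<And>k. S k \<noteq> {}"
    and R_in: "\<And>j k y. j \<le> J \<Longrightarrow> y \<in> S k \<Longrightarrow> R j k y \<in> S k"
    and R_J: "\<And>k y. y \<in> S k \<Longrightarrow> R J k y = y"
    and R_R: "\<And>i j k y. j \<le> i \<Longrightarrow> i \<le> J \<Longrightarrow> R j k (R i k y) = R j k y"
    and m_J: "m \<le> J"
begin

definition \<Omega> :: "(nat \<Rightarrow> 'b) set" where "\<Omega> = PiE {1..K} S"

definition E :: "((nat \<Rightarrow> 'b) \<Rightarrow> real) \<Rightarrow> ((nat \<Rightarrow> 'b) \<Rightarrow> real) \<Rightarrow> real" where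
  "E p F = (\<Sum>x\<in>\<Omega>. p x * F x)"

definition cp :: "nat \<Rightarrow> (nat \<Rightarrow> 'b) \<Rightarrow> nat \<Rightarrow> 'b" where
  "cp k x = (\<lambda>i\<in>pa G k. R m i (x i))"

definition cells :: "nat \<Rightarrow> nat \<Rightarrow> 'b set" where "cells j k = R j k ` S k"

definition pa_cells :: "nat \<Rightarrow> (nat \<Rightarrow> 'b) set" where
  "pa_cells k = PiE (pa G k) (cells m)"

definition ker ::
  "(nat \<Rightarrow> (nat \<Rightarrow> 'b) \<Rightarrow> 'b \<Rightarrow> real) \<Rightarrow> (nat \<Rightarrow> 'b \<Rightarrow> real) \<Rightarrow> nat \<Rightarrow> (nat \<Rightarrow> 'b) \<Rightarrow> 'b \<Rightarrow> real" where
  "ker qc qf k x y = qc k (cp k x) (R m k y) * qf k y"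

text \<open>\<open>qc k\<close> is the conditional distribution of the cell of \<open>x\<^sub>k\<close> given the cells of the parents and
  \<open>qf k\<close> is the distribution of \<open>x\<^sub>k\<close> within its cell. The kernels are only required to be
  stochastic, not determined, on cells of probability zero.\<close>

definition stoch :: "(nat \<Rightarrow> (nat \<Rightarrow> 'b) \<Rightarrow> 'b \<Rightarrow> real) \<Rightarrow> (nat \<Rightarrow> 'b \<Rightarrow> real) \<Rightarrow> bool" where
  "stoch qc qf \<longleftrightarrow> (\<forall>k\<in>{1..K}.
      (\<forall>c\<in>pa_cells k. (\<forall>v\<in>cells m k. 0 \<le> qc k c v) \<and> (\<Sum>v\<in>cells m k. qc k c v) = 1) \<and>
      (\<forall>y\<in>S k. 0 \<le> qf k y) \<and>
      (\<forall>v\<in>cells m k. (\<Sum>y | y \<in> S k \<and> R m k y = v. qf k y) = 1))"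

text \<open>Written with products instead of quotients, so that cells of probability zero impose
  nothing. What is prescribed is the joint law of the level-\<open>m\<close> cells of a node and its
  parents and the exact marginal of the node, but no finer joint law.\<close>

definition compat ::
  "((nat \<Rightarrow> 'b) \<Rightarrow> real) \<Rightarrow> (nat \<Rightarrow> (nat \<Rightarrow> 'b) \<Rightarrow> 'b \<Rightarrow> real) \<Rightarrow> (nat \<Rightarrow> 'b \<Rightarrow> real) \<Rightarrow> bool" where
  "compat p qc qf \<longleftrightarrow> (\<forall>k\<in>{1..K}.
      (\<forall>c\<in>pa_cells k. \<forall>v\<in>cells m k.
        E p (\<lambda>x. of_bool (cp k x = c \<and> R m k (x k) = v)) = E p (\<lambda>x. of_bool (cp k x = c)) * qc k c v) \<and>
      (\<forall>y\<in>S k. E p (\<lambda>x. of_bool (x k = y)) = E p (\<lambda>x. of_bool (R m k (x k) = R m k y)) * qf k y))"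

lemma pa_less: "i \<in> pa G k \<Longrightarrow> i < k" "i \<in> pa G k \<Longrightarrow> i \<in> {1..K}" "pa G k \<subseteq> {1..<k}"
  using dag unfolding sorted_dag_def pa_def by fastforce+

lemma fin_pa: "finite (pa G k)"
  using pa_less(3) finite_subset by blast

lemma fin_\<Omega>: "finite \<Omega>"
  unfolding \<Omega>_def using fin_S by (intro finite_PiE) auto

lemma \<Omega>_in: "x \<in> \<Omega> \<Longrightarrow> k \<in> {1..K} \<Longrightarrow> x k \<in> S k"
  by (auto simp: \<Omega>_def)

lemma \<Omega>_grid: "x \<in> \<Omega> \<Longrightarrow> k \<le> Suc K \<Longrightarrow> grid_pt S k x"
  by (auto simp: \<Omega>_def grid_pt_def)

lemma fin_cells [simp]: "finite (cells j k)"
  using fin_S by (simp add: cells_def)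

lemma fin_pa_cells [simp]: "finite (pa_cells k)"
  unfolding pa_cells_def using fin_pa by (intro finite_PiE) auto

lemma cells_S: "j \<le> J \<Longrightarrow> cells j k \<subseteq> S k"
  using R_in by (auto simp: cells_def)

lemma R_cells: "j \<le> i \<Longrightarrow> i \<le> J \<Longrightarrow> w \<in> cells i k \<Longrightarrow> R j k w \<in> cells j k"
  by (auto simp: cells_def R_R)

lemma R_fix: "j \<le> J \<Longrightarrow> w \<in> cells j k \<Longrightarrow> R j k w = w"
  by (auto simp: cells_def R_R)

lemma cells_in: "y \<in> S k \<Longrightarrow> R j k y \<in> cells j k"
  by (simp add: cells_def)

lemma cp_cells: "grid_pt S k x \<Longrightarrow> cp k x \<in> pa_cells k"
  using pa_less(3)[of k] by (fastforce simp: cp_def pa_cells_def grid_pt_def cells_def)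

lemma cp_\<Omega>: "x \<in> \<Omega> \<Longrightarrow> k \<in> {1..K} \<Longrightarrow> cp k x \<in> pa_cells k"
  by (intro cp_cells \<Omega>_grid) auto

lemma cp_upd: "l \<notin> pa G k \<Longrightarrow> cp k (x(l := y)) = cp k x"
  by (auto simp: cp_def)

lemma k_notin_pa: "k \<notin> pa G k"
  using pa_less(1) by blast

lemma E_cmult: "E p (\<lambda>x. c * F x) = c * E p F"
  by (simp add: E_def sum_distrib_left mult_ac)

lemma E_sum: "E p (\<lambda>x. \<Sum>i\<in>I. F i x) = (\<Sum>i\<in>I. E p (F i))"
  unfolding E_def sum_distrib_left by (rule sum.swap)

lemma E_cong: "(\<And>x. x \<in> \<Omega> \<Longrightarrow> F x = H x) \<Longrightarrow> E p F = E p H"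
  by (simp add: E_def)

lemma E_mono: "(\<And>x. x \<in> \<Omega> \<Longrightarrow> 0 \<le> p x) \<Longrightarrow> (\<And>x. x \<in> \<Omega> \<Longrightarrow> F x \<le> H x) \<Longrightarrow> E p F \<le> E p H"
  by (auto simp: E_def intro!: sum_mono mult_left_mono)

lemma E_nonneg: "(\<And>x. x \<in> \<Omega> \<Longrightarrow> 0 \<le> p x) \<Longrightarrow> (\<And>x. x \<in> \<Omega> \<Longrightarrow> 0 \<le> F x) \<Longrightarrow> 0 \<le> E p F"
  by (auto simp: E_def intro!: sum_nonneg mult_nonneg_nonneg)

lemma E_expand:
  assumes "finite C" "\<And>x. x \<in> \<Omega> \<Longrightarrow> f x \<in> C"
  shows "E p (\<lambda>x. H (f x)) = (\<Sum>c\<in>C. E p (\<lambda>x. of_bool (f x = c)) * H c)"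
proof -
  have "E p (\<lambda>x. H (f x)) = E p (\<lambda>x. \<Sum>c\<in>C. H c * of_bool (f x = c))"
    using assms by (intro E_cong) (simp add: of_bool_def if_distrib cong: if_cong)
  also have "\<dots> = (\<Sum>c\<in>C. E p (\<lambda>x. of_bool (f x = c)) * H c)"
    by (simp add: E_sum E_cmult mult.commute)
  finally show ?thesis .
qed

lemma E_marginal:
  assumes "finite C" "\<And>x. x \<in> \<Omega> \<Longrightarrow> f x \<in> C"
  shows "E p (\<lambda>x. of_bool (P x)) = (\<Sum>c\<in>C. E p (\<lambda>x. of_bool (P x \<and> f x = c)))"
proof -
  have "E p (\<lambda>x. of_bool (P x)) = E p (\<lambda>x. \<Sum>c\<in>C. of_bool (P x \<and> f x = c))"
    using assms by (intro E_cong) (auto simp: of_bool_def if_distrib cong: if_cong)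
  then show ?thesis by (simp add: E_sum)
qed

lemma sum_fine:
  assumes "stoch qc qf" "k \<in> {1..K}"
  shows "(\<Sum>y\<in>S k. H (R m k y) * qf k y) = (\<Sum>v\<in>cells m k. H v)"
proof -
  have "(\<Sum>y\<in>S k. H (R m k y) * qf k y) = (\<Sum>v\<in>cells m k. \<Sum>y | y \<in> S k \<and> R m k y = v. H (R m k y) * qf k y)"
    using fin_S by (intro sum.group[symmetric]) (auto simp: cells_def)
  also have "\<dots> = (\<Sum>v\<in>cells m k. H v * (\<Sum>y | y \<in> S k \<and> R m k y = v. qf k y))"
    by (simp add: sum_distrib_left)
  also have "\<dots> = (\<Sum>v\<in>cells m k. H v)"
    using assms by (simp add: stoch_def)
  finally show ?thesis .
qed

lemma ker_stochastic:
  assumes "stoch qc qf"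
  shows "stochastic K S (ker qc qf)"
  unfolding stochastic_def
proof (intro ballI allI impI conjI)
  fix k x assume k: "k \<in> {1..K}" and x: "grid_pt S k x"
  show "(\<Sum>y\<in>S k. ker qc qf k x y) = 1"
    using sum_fine[OF assms k, of "qc k (cp k x)"] assms k cp_cells[OF x]
    by (simp add: ker_def stoch_def)
  show "0 \<le> ker qc qf k x y" if "y \<in> S k" for y
    using assms k cp_cells[OF x] that by (simp add: ker_def stoch_def cells_in)
qed

text \<open>The kernel is a conditional distribution for the joint law of the level-\<open>m\<close>
  cells of \<open>k\<close> and its parents, so redrawing \<open>x k\<close> leaves that law alone.
  \<open>H\<close> must not look below level \<open>m\<close>, where the kernel forgets the
  parents.\<close>

lemma compat_step:
  assumes p: "compat p qc qf" "stoch qc qf" and k: "k \<in> {1..K}"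
    and H: "\<And>x x'. (\<And>i. i \<in> insert k (pa G k) \<Longrightarrow> R m i (x i) = R m i (x' i)) \<Longrightarrow> H x = H x'"
  shows "E p (net_step S (ker qc qf) k H) = E p H"
proof -
  \<comment> \<open>A parent cell \<open>c\<close> is undefined off the parents, but
    \<open>H\<close> reads only \<open>k\<close> and the parents, and it does not distinguish a
    point from the representative of its cell.\<close>
  define h where "h c v = H (c(k := v))" for c v
  have hH: "h (cp k x) (R m k (x k)) = H x" for x
    unfolding h_def using k_notin_pa m_J by (intro H) (auto simp: cp_def R_R)
  have st: "net_step S (ker qc qf) k H x = (\<Sum>v\<in>cells m k. qc k (cp k x) v * h (cp k x) v)" for x
  proof -
    have "H (x(k := y)) = h (cp k x) (R m k y)" for y
      using hH[of "x(k := y)"] by (simp add: cp_upd k_notin_pa)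
    then have "net_step S (ker qc qf) k H x
        = (\<Sum>y\<in>S k. (qc k (cp k x) (R m k y) * h (cp k x) (R m k y)) * qf k y)"
      by (simp add: net_step_def ker_def mult_ac)
    then show ?thesis using sum_fine[OF p(2) k, of "\<lambda>v. qc k (cp k x) v * h (cp k x) v"] by simp
  qed
  have "E p (net_step S (ker qc qf) k H)
     = (\<Sum>c\<in>pa_cells k. E p (\<lambda>x. of_bool (cp k x = c)) * (\<Sum>v\<in>cells m k. qc k c v * h c v))"
    unfolding st using cp_\<Omega> k by (intro E_expand) auto
  also have "\<dots> = (\<Sum>c\<in>pa_cells k. \<Sum>v\<in>cells m k. E p (\<lambda>x. of_bool ((cp k x, R m k (x k)) = (c, v))) * h c v)"
    using p(1) k by (intro sum.cong refl) (simp add: compat_def sum_distrib_left mult.assoc)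
  also have "\<dots> = (\<Sum>z\<in>pa_cells k \<times> cells m k. E p (\<lambda>x. of_bool ((cp k x, R m k (x k)) = z)) * (case z of (c, v) \<Rightarrow> h c v))"
    unfolding sum.cartesian_product by (intro sum.cong) auto
  also have "\<dots> = E p (\<lambda>x. case (cp k x, R m k (x k)) of (c, v) \<Rightarrow> h c v)"
    using cp_\<Omega> k cells_in \<Omega>_in by (intro E_expand[symmetric]) auto
  also have "\<dots> = E p H" by (simp add: hH)
  finally show ?thesis .
qed

text \<open>As \<open>pa k\<close> is fully connected, \<open>pa k\<close> is contained in \<open>insert l (pa l)\<close> for its largest element \<open>l\<close>,
  so the law of the cells of a node and its parents is recovered by induction.\<close>

lemma net_clique:
  assumes p: "compat p qc qf" "stoch qc qf" "(\<Sum>x\<in>\<Omega>. p x) = 1" and k: "k \<in> {1..K}"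
    and H: "\<And>x x'. (\<And>i. i \<in> pa G k \<Longrightarrow> R m i (x i) = R m i (x' i)) \<Longrightarrow> H x = H x'"
  shows "net S (ker qc qf) [1..<k] H x0 = E p H"
  using k H
proof (induction k arbitrary: H rule: less_induct)
  case (less k)
  note st = ker_stochastic[OF p(2)]
  show ?case
  proof (cases "pa G k = {}")
    case True
    then have "H x = H x0" for x by (intro less.prems) auto
    then have "H = (\<lambda>_. H x0)" by (intro ext)
    moreover have "net S (ker qc qf) [1..<k] (\<lambda>_. H x0) x0 = H x0"
      using less.prems(1) by (intro net_const[OF st]) (auto simp: grid_pt_def)
    moreover have "E p (\<lambda>_. H x0) = H x0" using p(3) by (simp add: E_def sum_distrib_right[symmetric])
    ultimately show ?thesis by metis
  next
    case False
    define l where "l = Max (pa G k)"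
    have l: "l \<in> pa G k" unfolding l_def using False fin_pa by (intro Max_in) auto
    have lk: "l < k" "l \<in> {1..K}" using l pa_less by auto
    have sub: "pa G k \<subseteq> insert l (pa G l)"
    proof
      fix i assume i: "i \<in> pa G k"
      then have "i \<le> l" unfolding l_def using fin_pa by (intro Max_ge) auto
      moreover have "(i, l) \<in> G" if "i < l"
        using conn[OF less.prems(1)] i l that by (auto simp: fully_connected_def)
      ultimately show "i \<in> insert l (pa G l)" by (cases "i = l") (auto simp: pa_def)
    qed
    have Hl: "H x = H x'" if "\<And>i. i \<in> insert l (pa G l) \<Longrightarrow> R m i (x i) = R m i (x' i)" for x x'
      using that sub by (intro less.prems(2)) auto
    \<comment> \<open>The nodes strictly between \<open>l\<close> and \<open>k\<close> are not
      parents of \<open>k\<close>, so averaging over them does not change \<open>H\<close>.\<close>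
    have "net S (ker qc qf) [1..<k] H x0 = net S (ker qc qf) [1..<Suc l] (net S (ker qc qf) [Suc l..<k] H) x0"
      using lk by (subst net_upt_split[of 1 "Suc l" k]) auto
    also have "\<dots> = net S (ker qc qf) [1..<Suc l] H x0"
    proof (rule net_cong[OF st])
      fix z assume z: "grid_pt S (Suc l) z"
      show "net S (ker qc qf) [Suc l..<k] H z = H z"
      proof (rule net_indep[OF st])
        fix z' assume z': "\<And>i. i \<notin> {Suc l..<k} \<Longrightarrow> z' i = z i"
        have "z' i = z i" if "i \<in> pa G k" for i
          using z'[of i] that sub pa_less(1)[of i l] by auto
        then show "H z' = H z" by (intro less.prems(2)) auto
      qed (use lk less.prems z in auto)
    qed (use lk in \<open>auto simp: grid_pt_def\<close>)
    also have "\<dots> = net S (ker qc qf) [1..<l] (net_step S (ker qc qf) l H) x0"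
      using lk by (subst net_upt_Suc) auto
    \<comment> \<open>After averaging over \<open>x l\<close> only the cells of the parents of
      \<open>l\<close> remain, because every parent of \<open>k\<close> other than \<open>l\<close>
      is among them.\<close>
    also have "\<dots> = E p (net_step S (ker qc qf) l H)"
    proof (rule less.IH[OF lk])
      fix x x' assume xx: "\<And>i. i \<in> pa G l \<Longrightarrow> R m i (x i) = R m i (x' i)"
      then have "cp l x = cp l x'" by (auto simp: cp_def fun_eq_iff)
      moreover have "H (x(l := y)) = H (x'(l := y))" for y using xx by (intro Hl) auto
      ultimately show "net_step S (ker qc qf) l H x = net_step S (ker qc qf) l H x'"
        by (simp add: net_step_def ker_def)
    qed
    also have "\<dots> = E p H" using Hl by (intro compat_step[OF p(1,2) lk(2)]) blast
    finally show ?thesis .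
  qed
qed

end

section \<open>Deviation of the estimated from the population network\<close>

context clique_net
begin

definition ker_level ::
  "(nat \<Rightarrow> (nat \<Rightarrow> 'b) \<Rightarrow> 'b \<Rightarrow> real) \<Rightarrow> (nat \<Rightarrow> 'b \<Rightarrow> real) \<Rightarrow> nat \<Rightarrow> nat \<Rightarrow> (nat \<Rightarrow> 'b) \<Rightarrow> 'b \<Rightarrow> real" where
  "ker_level qc qf j k c w = (\<Sum>y | y \<in> S k \<and> R j k y = w. qc k c (R m k y) * qf k y)"

definition dev_joint :: "((nat \<Rightarrow> 'b) \<Rightarrow> real) \<Rightarrow> ((nat \<Rightarrow> 'b) \<Rightarrow> real) \<Rightarrow> nat \<Rightarrow> nat \<Rightarrow> real" where
  "dev_joint p p' k j = (\<Sum>c\<in>pa_cells k. \<Sum>w\<in>cells j k.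
      \<bar>E p' (\<lambda>x. of_bool (cp k x = c \<and> R j k (x k) = w)) - E p (\<lambda>x. of_bool (cp k x = c \<and> R j k (x k) = w))\<bar>)"

definition dev_marg :: "((nat \<Rightarrow> 'b) \<Rightarrow> real) \<Rightarrow> ((nat \<Rightarrow> 'b) \<Rightarrow> real) \<Rightarrow> nat \<Rightarrow> nat \<Rightarrow> real" where
  "dev_marg p p' k j = (\<Sum>w\<in>cells j k.
      \<bar>E p' (\<lambda>x. of_bool (R j k (x k) = w)) - E p (\<lambda>x. of_bool (R j k (x k) = w))\<bar>)"

lemma E_filter:
  assumes "\<And>x. x \<in> \<Omega> \<Longrightarrow> T x \<longleftrightarrow> b \<and> P x"
  shows "(if b then E p (\<lambda>x. of_bool (P x)) else 0) = E p (\<lambda>x. of_bool (T x))"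
  using assms by (simp add: E_def)

lemma ker_level_coarse:
  assumes "stoch qc qf" "k \<in> {1..K}" "j \<le> m"
  shows "ker_level qc qf j k c w = (\<Sum>v | v \<in> cells m k \<and> R j k v = w. qc k c v)"
proof -
  have "ker_level qc qf j k c w = (\<Sum>y\<in>S k. if R j k y = w then qc k c (R m k y) * qf k y else 0)"
    unfolding ker_level_def using fin_S by (intro sum.inter_filter)
  also have "\<dots> = (\<Sum>y\<in>S k. (of_bool (R j k (R m k y) = w) * qc k c (R m k y)) * qf k y)"
    using assms(3) m_J by (intro sum.cong) (auto simp: R_R)
  also have "\<dots> = (\<Sum>v\<in>cells m k. of_bool (R j k v = w) * qc k c v)"
    by (rule sum_fine[OF assms(1,2), where H="\<lambda>v. of_bool (R j k v = w) * qc k c v"])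
  also have "\<dots> = (\<Sum>v\<in>cells m k. if R j k v = w then qc k c v else 0)"
    by (intro sum.cong) auto
  also have "\<dots> = (\<Sum>v | v \<in> cells m k \<and> R j k v = w. qc k c v)"
    by (intro sum.inter_filter[symmetric]) auto
  finally show ?thesis .
qed

text \<open>From level \<open>m\<close> on, the dependence on the parents sits in the coarse factor
  alone; this is what keeps \<open>d_loc\<close> out of the fine levels.\<close>

lemma ker_level_fine:
  assumes "m \<le> j" "j \<le> J" "w \<in> cells j k"
  shows "ker_level qc qf j k c w = qc k c (R m k w) * (\<Sum>y | y \<in> S k \<and> R j k y = w. qf k y)"
  unfolding ker_level_def sum_distrib_left using assms by (intro sum.cong) (auto simp: R_R)

lemma ker_level_nonneg:
  "stoch qc qf \<Longrightarrow> k \<in> {1..K} \<Longrightarrow> c \<in> pa_cells k \<Longrightarrow> 0 \<le> ker_level qc qf j k c w"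
  unfolding ker_level_def by (intro sum_nonneg) (auto simp: stoch_def cells_in)

lemma ker_level_sum:
  assumes "stoch qc qf" "k \<in> {1..K}" "c \<in> pa_cells k"
  shows "(\<Sum>w\<in>cells j k. ker_level qc qf j k c w) = 1"
proof -
  have "(\<Sum>w\<in>cells j k. ker_level qc qf j k c w) = (\<Sum>y\<in>S k. qc k c (R m k y) * qf k y)"
    unfolding ker_level_def using fin_S by (intro sum.group) (auto simp: cells_def)
  also have "\<dots> = 1"
    using sum_fine[OF assms(1,2), of "qc k c"] assms by (simp add: stoch_def)
  finally show ?thesis .
qed

lemma ker_level_compat:
  assumes "compat p qc qf" "stoch qc qf" "k \<in> {1..K}" "j \<le> m" "c \<in> pa_cells k" "w \<in> cells j k"
  shows "E p (\<lambda>x. of_bool (cp k x = c)) * ker_level qc qf j k c w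
    = E p (\<lambda>x. of_bool (cp k x = c \<and> R j k (x k) = w))"
proof -
  have "E p (\<lambda>x. of_bool (cp k x = c)) * ker_level qc qf j k c w
      = (\<Sum>v | v \<in> cells m k \<and> R j k v = w. E p (\<lambda>x. of_bool (cp k x = c \<and> R m k (x k) = v)))"
    using assms by (auto simp: ker_level_coarse sum_distrib_left compat_def intro!: sum.cong)
  also have "\<dots> = (\<Sum>v\<in>cells m k. if R j k v = w then E p (\<lambda>x. of_bool (cp k x = c \<and> R m k (x k) = v)) else 0)"
    by (intro sum.inter_filter) auto
  also have "\<dots> = (\<Sum>v\<in>cells m k. E p (\<lambda>x. of_bool ((cp k x = c \<and> R j k (x k) = w) \<and> R m k (x k) = v)))"
    using assms m_J by (intro sum.cong refl E_filter) (auto simp: R_R)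
  also have "\<dots> = E p (\<lambda>x. of_bool (cp k x = c \<and> R j k (x k) = w))"
    using assms \<Omega>_in cells_in by (intro E_marginal[symmetric]) auto
  finally show ?thesis .
qed

text \<open>Weighting with the probability of the parent cell removes the denominators:
  \<open>P' * (a' - a) = (Q' - Q) - (P' - P) * a\<close>. As \<open>a\<close> sums to 1 and the
  deviation of the parents is a marginal of the joint one, each of the two terms costs one
  \<open>dev_joint\<close>. The weight belongs to \<open>p'\<close> because the network upstream
  does.\<close>

lemma ker_level_diff_coarse:
  assumes p: "compat p qc qf" "stoch qc qf" and p': "compat p' qc' qf'" "stoch qc' qf'" "\<And>x. x \<in> \<Omega> \<Longrightarrow> 0 \<le> p' x"
    and k: "k \<in> {1..K}" and j: "j \<le> m"
  shows "(\<Sum>c\<in>pa_cells k. E p' (\<lambda>x. of_bool (cp k x = c)) *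
      (\<Sum>w\<in>cells j k. \<bar>ker_level qc' qf' j k c w - ker_level qc qf j k c w\<bar>)) \<le> 2 * dev_joint p p' k j"
proof -
  let ?P = "\<lambda>p c. E p (\<lambda>x. of_bool (cp k x = c))"
  let ?Q = "\<lambda>p c w. E p (\<lambda>x. of_bool (cp k x = c \<and> R j k (x k) = w))"
  have marg: "?P p c = (\<Sum>w\<in>cells j k. ?Q p c w)" for p c
    using \<Omega>_in k cells_in by (intro E_marginal) auto
  have "?P p' c * (\<Sum>w\<in>cells j k. \<bar>ker_level qc' qf' j k c w - ker_level qc qf j k c w\<bar>)
      \<le> 2 * (\<Sum>w\<in>cells j k. \<bar>?Q p' c w - ?Q p c w\<bar>)" if c: "c \<in> pa_cells k" for c
  proof -
    have nn: "0 \<le> ?P p' c" using p'(3) by (intro E_nonneg) auto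
    have "?P p' c * (\<Sum>w\<in>cells j k. \<bar>ker_level qc' qf' j k c w - ker_level qc qf j k c w\<bar>)
       \<le> (\<Sum>w\<in>cells j k. \<bar>?Q p' c w - ?Q p c w\<bar> + \<bar>?P p' c - ?P p c\<bar> * ker_level qc qf j k c w)"
      unfolding sum_distrib_left
    proof (rule sum_mono)
      fix w assume w: "w \<in> cells j k"
      let ?a = "ker_level qc qf j k c w"
      have "?P p' c * \<bar>ker_level qc' qf' j k c w - ?a\<bar> = \<bar>?P p' c * ker_level qc' qf' j k c w - ?P p' c * ?a\<bar>"
        using nn by (simp add: abs_mult right_diff_distrib[symmetric])
      also have "\<dots> = \<bar>(?Q p' c w - ?Q p c w) - (?P p' c - ?P p c) * ?a\<bar>"
        unfolding ker_level_compat[OF p'(1,2) k j c w] ker_level_compat[OF p k j c w, symmetric]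
        by (simp add: algebra_simps)
      also have "\<dots> \<le> \<bar>?Q p' c w - ?Q p c w\<bar> + \<bar>(?P p' c - ?P p c) * ?a\<bar>" by (rule abs_triangle_ineq4)
      also have "\<bar>(?P p' c - ?P p c) * ?a\<bar> = \<bar>?P p' c - ?P p c\<bar> * ?a"
        using ker_level_nonneg[OF p(2) k c] by (simp add: abs_mult)
      finally show "?P p' c * \<bar>ker_level qc' qf' j k c w - ?a\<bar> \<le> \<bar>?Q p' c w - ?Q p c w\<bar> + \<bar>?P p' c - ?P p c\<bar> * ?a"
        by simp
    qed
    also have "\<dots> = (\<Sum>w\<in>cells j k. \<bar>?Q p' c w - ?Q p c w\<bar>) + \<bar>?P p' c - ?P p c\<bar>"
      by (simp add: sum.distrib sum_distrib_left[symmetric] ker_level_sum[OF p(2) k c])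
    also have "\<bar>?P p' c - ?P p c\<bar> \<le> (\<Sum>w\<in>cells j k. \<bar>?Q p' c w - ?Q p c w\<bar>)"
      unfolding marg sum_subtractf[symmetric] by (rule sum_abs)
    finally show ?thesis by simp
  qed
  then show ?thesis
    unfolding dev_joint_def by (simp add: sum_distrib_left sum_mono)
qed

lemma fine_compat:
  assumes "compat p qc qf" "k \<in> {1..K}" "m \<le> j" "j \<le> J" "w \<in> cells j k"
  shows "E p (\<lambda>x. of_bool (R m k (x k) = R m k w)) * (\<Sum>y | y \<in> S k \<and> R j k y = w. qf k y)
    = E p (\<lambda>x. of_bool (R j k (x k) = w))"
proof -
  have "E p (\<lambda>x. of_bool (R m k (x k) = R m k w)) * (\<Sum>y | y \<in> S k \<and> R j k y = w. qf k y)
      = (\<Sum>y | y \<in> S k \<and> R j k y = w. E p (\<lambda>x. of_bool (x k = y)))"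
    unfolding sum_distrib_left using assms by (intro sum.cong) (auto simp: compat_def R_R)
  also have "\<dots> = (\<Sum>y\<in>S k. if R j k y = w then E p (\<lambda>x. of_bool (x k = y)) else 0)"
    using fin_S by (intro sum.inter_filter)
  also have "\<dots> = (\<Sum>y\<in>S k. E p (\<lambda>x. of_bool (R j k (x k) = w \<and> x k = y)))"
    by (intro sum.cong refl E_filter) auto
  also have "\<dots> = E p (\<lambda>x. of_bool (R j k (x k) = w))"
    using assms \<Omega>_in fin_S by (intro E_marginal[symmetric]) auto
  finally show ?thesis .
qed

text \<open>Product rule for the coarse factor times the mass \<open>\<phi>\<close> within the cell.
  The change of the coarse factor, summed with weights \<open>\<phi>\<close>, is the coarse case at
  level \<open>m\<close>. In the change of \<open>\<phi>\<close> the weights add up over the parents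
  to the marginal of \<open>x k\<close>, so that only marginal frequencies appear.\<close>

lemma ker_level_diff_fine:
  assumes p: "compat p qc qf" "stoch qc qf" and p': "compat p' qc' qf'" "stoch qc' qf'" "\<And>x. x \<in> \<Omega> \<Longrightarrow> 0 \<le> p' x"
    and k: "k \<in> {1..K}" and j: "m \<le> j" "j \<le> J"
  shows "(\<Sum>c\<in>pa_cells k. E p' (\<lambda>x. of_bool (cp k x = c)) *
      (\<Sum>w\<in>cells j k. \<bar>ker_level qc' qf' j k c w - ker_level qc qf j k c w\<bar>))
    \<le> 2 * dev_joint p p' k m + 2 * dev_marg p p' k j"
proof -
  let ?P = "\<lambda>p c. E p (\<lambda>x. of_bool (cp k x = c))"
  let ?M = "\<lambda>p v. E p (\<lambda>x. of_bool (R m k (x k) = v))"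
  let ?N = "\<lambda>p w. E p (\<lambda>x. of_bool (R j k (x k) = w))"
  let ?Q = "\<lambda>p c v. E p (\<lambda>x. of_bool (cp k x = c \<and> R m k (x k) = v))"
  define \<phi> where "\<phi> w = (\<Sum>y | y \<in> S k \<and> R j k y = w. qf k y)" for w
  define \<phi>' where "\<phi>' w = (\<Sum>y | y \<in> S k \<and> R j k y = w. qf' k y)" for w
  have \<phi>_nn: "0 \<le> \<phi> w" for w
    unfolding \<phi>_def using p(2) k by (intro sum_nonneg) (auto simp: stoch_def)
  have P_nn: "0 \<le> ?P p' c" for c using p'(3) by (intro E_nonneg) auto
  have M_nn: "0 \<le> ?M p' v" for v using p'(3) by (intro E_nonneg) auto
  have group: "(\<Sum>w\<in>cells j k. h (R m k w) * \<phi> w) = (\<Sum>v\<in>cells m k. h v)" for h :: "'b \<Rightarrow> real"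
  proof -
    have "(\<Sum>w\<in>cells j k. h (R m k w) * \<phi> w)
        = (\<Sum>w\<in>cells j k. \<Sum>y | y \<in> S k \<and> R j k y = w. h (R m k y) * qf k y)"
      unfolding \<phi>_def sum_distrib_left using j by (intro sum.cong) (auto simp: R_R)
    also have "\<dots> = (\<Sum>y\<in>S k. h (R m k y) * qf k y)"
      using fin_S by (intro sum.group) (auto simp: cells_def)
    finally show ?thesis using sum_fine[OF p(2) k] by simp
  qed
  have coarse_eq: "ker_level qc qf m k c v = qc k c v" if "stoch qc qf" "v \<in> cells m k" for qc qf c v
  proof -
    have "{v'. v' \<in> cells m k \<and> R m k v' = v} = {v}"
      using that m_J by (auto simp: R_fix)
    then show ?thesis using that k by (simp add: ker_level_coarse)
  qed
  have "(\<Sum>c\<in>pa_cells k. ?P p' c * (\<Sum>w\<in>cells j k. \<bar>ker_level qc' qf' j k c w - ker_level qc qf j k c w\<bar>))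
    \<le> (\<Sum>c\<in>pa_cells k. \<Sum>w\<in>cells j k. ?P p' c * \<bar>qc' k c (R m k w) - qc k c (R m k w)\<bar> * \<phi> w
        + ?Q p' c (R m k w) * \<bar>\<phi>' w - \<phi> w\<bar>)"
    unfolding sum_distrib_left
  proof (intro sum_mono)
    fix c w assume c: "c \<in> pa_cells k" and w: "w \<in> cells j k"
    let ?v = "R m k w"
    have v: "?v \<in> cells m k" using w j by (intro R_cells) auto
    have Q: "?Q p' c ?v = ?P p' c * qc' k c ?v" using p'(1) k c v by (simp add: compat_def)
    have nn: "0 \<le> qc' k c ?v" using p'(2) k c v by (auto simp: stoch_def)
    have "\<bar>ker_level qc' qf' j k c w - ker_level qc qf j k c w\<bar>
        = \<bar>qc' k c ?v * (\<phi>' w - \<phi> w) + (qc' k c ?v - qc k c ?v) * \<phi> w\<bar>"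
      using ker_level_fine[OF j w] by (simp add: \<phi>_def \<phi>'_def algebra_simps)
    also have "\<dots> \<le> qc' k c ?v * \<bar>\<phi>' w - \<phi> w\<bar> + \<bar>qc' k c ?v - qc k c ?v\<bar> * \<phi> w"
      using nn \<phi>_nn[of w] by (intro order_trans[OF abs_triangle_ineq]) (simp add: abs_mult)
    finally have "?P p' c * \<bar>ker_level qc' qf' j k c w - ker_level qc qf j k c w\<bar>
      \<le> ?P p' c * (qc' k c ?v * \<bar>\<phi>' w - \<phi> w\<bar> + \<bar>qc' k c ?v - qc k c ?v\<bar> * \<phi> w)"
      using P_nn by (intro mult_left_mono) auto
    then show "?P p' c * \<bar>ker_level qc' qf' j k c w - ker_level qc qf j k c w\<bar>
      \<le> ?P p' c * \<bar>qc' k c ?v - qc k c ?v\<bar> * \<phi> w + ?Q p' c ?v * \<bar>\<phi>' w - \<phi> w\<bar>"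
      unfolding Q by (simp add: algebra_simps)
  qed
  also have "\<dots> = (\<Sum>c\<in>pa_cells k. \<Sum>w\<in>cells j k. ?P p' c * \<bar>qc' k c (R m k w) - qc k c (R m k w)\<bar> * \<phi> w)
     + (\<Sum>w\<in>cells j k. ?M p' (R m k w) * \<bar>\<phi>' w - \<phi> w\<bar>)"
  proof -
    have marg: "?M p' v = (\<Sum>c\<in>pa_cells k. ?Q p' c v)" for v
    proof -
      have "?M p' v = (\<Sum>c\<in>pa_cells k. E p' (\<lambda>x. of_bool (R m k (x k) = v \<and> cp k x = c)))"
        using cp_\<Omega> k by (intro E_marginal) auto
      then show ?thesis by (simp add: conj_commute)
    qed
    show ?thesis unfolding sum.distrib marg sum_distrib_right
      by (simp add: sum.swap[of _ "pa_cells k" "cells j k"])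
  qed
  also have "(\<Sum>c\<in>pa_cells k. \<Sum>w\<in>cells j k. ?P p' c * \<bar>qc' k c (R m k w) - qc k c (R m k w)\<bar> * \<phi> w)
      = (\<Sum>c\<in>pa_cells k. ?P p' c * (\<Sum>v\<in>cells m k. \<bar>ker_level qc' qf' m k c v - ker_level qc qf m k c v\<bar>))"
    using coarse_eq p(2) p'(2)
    by (intro sum.cong refl) (simp add: group[symmetric] sum_distrib_left mult.assoc cong: sum.cong)
  also have "\<dots> \<le> 2 * dev_joint p p' k m"
    by (rule ker_level_diff_coarse[OF p p' k order_refl])
  also have "(\<Sum>w\<in>cells j k. ?M p' (R m k w) * \<bar>\<phi>' w - \<phi> w\<bar>)
     \<le> (\<Sum>w\<in>cells j k. \<bar>?N p' w - ?N p w\<bar> + \<bar>?M p' (R m k w) - ?M p (R m k w)\<bar> * \<phi> w)"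
  proof (intro sum_mono)
    fix w assume w: "w \<in> cells j k"
    let ?v = "R m k w"
    have "?M p' ?v * \<bar>\<phi>' w - \<phi> w\<bar> = \<bar>?M p' ?v * \<phi>' w - ?M p' ?v * \<phi> w\<bar>"
      using M_nn by (simp add: abs_mult right_diff_distrib[symmetric])
    also have "\<dots> = \<bar>(?N p' w - ?N p w) - (?M p' ?v - ?M p ?v) * \<phi> w\<bar>"
      unfolding fine_compat[OF p'(1) k j w, symmetric] fine_compat[OF p(1) k j w, symmetric] \<phi>_def \<phi>'_def
      by (simp add: algebra_simps)
    also have "\<dots> \<le> \<bar>?N p' w - ?N p w\<bar> + \<bar>(?M p' ?v - ?M p ?v) * \<phi> w\<bar>" by (rule abs_triangle_ineq4)
    finally show "?M p' ?v * \<bar>\<phi>' w - \<phi> w\<bar> \<le> \<bar>?N p' w - ?N p w\<bar> + \<bar>?M p' ?v - ?M p ?v\<bar> * \<phi> w"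
      using \<phi>_nn[of w] by (simp add: abs_mult)
  qed
  also have "\<dots> = dev_marg p p' k j + (\<Sum>v\<in>cells m k. \<bar>?M p' v - ?M p v\<bar>)"
    unfolding sum.distrib dev_marg_def group[of "\<lambda>v. \<bar>?M p' v - ?M p v\<bar>"] by simp
  \<comment> \<open>Level-\<open>m\<close> cells are unions of level-\<open>j\<close> cells, so the
    marginal deviation at level \<open>m\<close> is dominated by the one at level
    \<open>j\<close>.\<close>
  also have "(\<Sum>v\<in>cells m k. \<bar>?M p' v - ?M p v\<bar>) \<le> dev_marg p p' k j"
  proof -
    have "?M p v = (\<Sum>w | w \<in> cells j k \<and> R m k w = v. ?N p w)" for p v
    proof -
      have "?M p v = (\<Sum>w\<in>cells j k. E p (\<lambda>x. of_bool (R m k (x k) = v \<and> R j k (x k) = w)))"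
        using \<Omega>_in k cells_in by (intro E_marginal) auto
      also have "\<dots> = (\<Sum>w\<in>cells j k. if R m k w = v then ?N p w else 0)"
        using j by (intro sum.cong refl E_filter[symmetric]) (auto simp: R_R)
      also have "\<dots> = (\<Sum>w | w \<in> cells j k \<and> R m k w = v. ?N p w)"
        by (intro sum.inter_filter[symmetric]) auto
      finally show ?thesis .
    qed
    then have "(\<Sum>v\<in>cells m k. \<bar>?M p' v - ?M p v\<bar>)
        \<le> (\<Sum>v\<in>cells m k. \<Sum>w | w \<in> cells j k \<and> R m k w = v. \<bar>?N p' w - ?N p w\<bar>)"
      by (intro sum_mono) (simp add: sum_subtractf[symmetric] sum_abs)
    also have "\<dots> = dev_marg p p' k j"
      unfolding dev_marg_def using j by (intro sum.group) (auto intro: R_cells)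
    finally show ?thesis .
  qed
  finally show ?thesis by simp
qed

lemma dev_marg_nonneg: "0 \<le> dev_marg p p' k j"
  by (simp add: dev_marg_def sum_nonneg)

text \<open>The right-hand side is free of \<open>F\<close>: the bound covers all test functions at
  once, for each \<open>p'\<close>. The factor \<open>1 + C * real K\<close> is the Lipschitz
  constant of the downstream integrals from \<open>net_lipschitz\<close>; \<open>min j m\<close>
  appears because beyond level \<open>m\<close> the joint frequencies are needed at level
  \<open>m\<close> only.\<close>

theorem net_deviation:
  assumes p: "compat p qc qf" "stoch qc qf"
    and p': "compat p' qc' qf'" "stoch qc' qf'" "\<And>x. x \<in> \<Omega> \<Longrightarrow> 0 \<le> p' x" "(\<Sum>x\<in>\<Omega>. p' x) = 1"
    and F: "\<And>z. grid_pt S (Suc K) z \<Longrightarrow> \<bar>F z\<bar> \<le> 1"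
      "\<And>j z z'. j \<le> J \<Longrightarrow> grid_pt S (Suc K) z \<Longrightarrow> grid_pt S (Suc K) z'
        \<Longrightarrow> (\<And>i. i \<in> {1..K} \<Longrightarrow> R j i (z i) = R j i (z' i)) \<Longrightarrow> \<bar>F z - F z'\<bar> \<le> (1/2)^j"
    and lip: "\<And>j k z z'. j \<le> J \<Longrightarrow> k \<in> {1..K} \<Longrightarrow> grid_pt S k z \<Longrightarrow> grid_pt S k z'
        \<Longrightarrow> (\<And>i. i \<in> {1..<k} \<Longrightarrow> R j i (z i) = R j i (z' i))
        \<Longrightarrow> (\<Sum>y\<in>S k. \<bar>ker qc qf k z y - ker qc qf k z' y\<bar>) \<le> C * (1/2)^j"
    and C: "0 \<le> C"
  shows "\<bar>net S (ker qc' qf') [1..<Suc K] F x0 - net S (ker qc qf) [1..<Suc K] F x0\<bar>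
    \<le> (\<Sum>k=1..K. \<Sum>j\<le>J. (1 + C * real K) * (2 * (1/2)^j) *
          (2 * dev_joint p p' k (min j m) + 2 * dev_marg p p' k j))"
proof -
  let ?q = "ker qc qf" and ?q' = "ker qc' qf'"
  let ?a = "1 + C * real K"
  note st = ker_stochastic[OF p(2)] and st' = ker_stochastic[OF p'(2)]
  define T where "T k = net S ?q' [1..<k] (net S ?q [k..<Suc K] F) x0" for k
  define f where "f k = net S ?q [Suc k..<Suc K] F" for k
  \<comment> \<open>The chaining bound at node \<open>k\<close>. It reads \<open>x\<close> only
    through the cells of the parents, so \<open>net_clique\<close> applies to it, although not to
    the difference that it dominates, which depends on all earlier nodes.\<close>
  define Z where "Z k x = (\<Sum>j\<le>J. ?a * (2 * (1/2)^j) *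
      (\<Sum>w\<in>cells j k. \<bar>ker_level qc' qf' j k (cp k x) w - ker_level qc qf j k (cp k x) w\<bar>))" for k x
  have step: "\<bar>T (Suc k) - T k\<bar> \<le> (\<Sum>j\<le>J. ?a * (2 * (1/2)^j) *
          (2 * dev_joint p p' k (min j m) + 2 * dev_marg p p' k j))" if k: "k \<in> {1..K}" for k
  proof -
    have g0: "grid_pt S 1 x0" by (simp add: grid_pt_def)
    have f_abs: "\<bar>f k x\<bar> \<le> 1" if "grid_pt S (Suc k) x" for x
      unfolding f_def using F(1) k that by (intro net_abs_le[OF st]) auto
    have f_lip: "\<bar>f k x - f k x'\<bar> \<le> ?a * (1/2)^j"
      if "j \<le> J" "grid_pt S (Suc k) x" "grid_pt S (Suc k) x'" "\<And>i. i \<in> {1..<Suc k} \<Longrightarrow> R j i (x i) = R j i (x' i)" for j x x'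
    proof -
      have "\<bar>f k x - f k x'\<bar> \<le> (1 + C * real (Suc K - Suc k)) * (1/2)^j"
        unfolding f_def
        by (rule net_lipschitz[OF st, where A="\<lambda>i u v. R j i u = R j i v"])
           (use F(1) F(2)[OF that(1)] lip[OF that(1)] C k that in auto)
      also have "\<dots> \<le> ?a * (1/2)^j"
        using C by (intro mult_right_mono add_left_mono mult_left_mono) auto
      finally show ?thesis .
    qed
    have point: "\<bar>net_step S ?q' k (f k) x - net_step S ?q k (f k) x\<bar> \<le> Z k x" if x: "grid_pt S k x" for x
    proof -
      have eq: "net_step S ?q' k (f k) x - net_step S ?q k (f k) x
          = (\<Sum>y\<in>S k. (?q' k x y - ?q k x y) * f k (x(k := y)))"
        by (simp add: net_step_def sum_subtractf[symmetric] left_diff_distrib)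
      have "\<bar>\<Sum>y\<in>S k. (?q' k x y - ?q k x y) * f k (x(k := y))\<bar> \<le> (\<Sum>j\<le>J. ?a * (2 * (1/2)^j) *
          (\<Sum>w\<in>(\<lambda>y. R j k y) ` S k. \<bar>\<Sum>y | y \<in> S k \<and> R j k y = w. ?q' k x y - ?q k x y\<bar>))"
      proof (rule abs_sum_tree_le)
        have "1 * 1 \<le> ?a" using C by simp
        then show "\<bar>f k (x(k := y))\<bar> \<le> ?a" if "y \<in> S k" for y
          using f_abs[OF grid_pt_upd[OF x that]] by linarith
        show "\<bar>f k (x(k := y)) - f k (x(k := y'))\<bar> \<le> ?a * (1/2)^j"
          if "j \<le> J" "y \<in> S k" "y' \<in> S k" "R j k y = R j k y'" for j y y'
          using that x by (intro f_lip grid_pt_upd) auto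
      qed (use R_in R_J R_R fin_S in auto)
      also have "\<dots> = Z k x"
        by (simp only: Z_def cells_def ker_level_def ker_def sum_subtractf)
      finally show ?thesis unfolding eq .
    qed
    have "T (Suc k) - T k = net S ?q' [1..<k] (\<lambda>x. net_step S ?q' k (f k) x - net_step S ?q k (f k) x) x0"
      using k unfolding T_def net_diff f_def by (simp add: net_append net_Cons net_upt_rec[of k] del: upt_Suc)
        (simp add: net_append net_Cons)
    moreover have "\<bar>net S ?q' [1..<k] (\<lambda>x. net_step S ?q' k (f k) x - net_step S ?q k (f k) x) x0\<bar>
        \<le> net S ?q' [1..<k] (Z k) x0"
    proof -
      have "net S ?q' [1..<k] (\<lambda>x. net_step S ?q' k (f k) x - net_step S ?q k (f k) x) x0 \<le> net S ?q' [1..<k] (Z k) x0"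
        using k g0 point by (intro net_mono[OF st']) (auto simp: abs_le_iff)
      moreover have "net S ?q' [1..<k] (\<lambda>x. (-1) * (net_step S ?q' k (f k) x - net_step S ?q k (f k) x)) x0
          \<le> net S ?q' [1..<k] (Z k) x0"
        using k g0 point by (intro net_mono[OF st']) (auto simp: abs_le_iff)
      ultimately show ?thesis unfolding net_cmult by (simp add: abs_le_iff)
    qed
    moreover have "net S ?q' [1..<k] (Z k) x0 = E p' (Z k)"
    proof (rule net_clique[OF p'(1,2,4) k])
      fix x x' assume "\<And>i. i \<in> pa G k \<Longrightarrow> R m i (x i) = R m i (x' i)"
      then have "cp k x = cp k x'" by (auto simp: cp_def fun_eq_iff)
      then show "Z k x = Z k x'" by (simp add: Z_def)
    qed
    moreover have "E p' (Z k) = (\<Sum>j\<le>J. ?a * (2 * (1/2)^j) * (\<Sum>c\<in>pa_cells k. E p' (\<lambda>x. of_bool (cp k x = c)) *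
      (\<Sum>w\<in>cells j k. \<bar>ker_level qc' qf' j k c w - ker_level qc qf j k c w\<bar>)))"
      unfolding Z_def E_sum[where I="{..J}"] E_cmult using cp_\<Omega> k
      by (intro sum.cong refl arg_cong2[where f=times] E_expand) auto
    moreover have "\<dots> \<le> (\<Sum>j\<le>J. ?a * (2 * (1/2)^j) *
          (2 * dev_joint p p' k (min j m) + 2 * dev_marg p p' k j))"
    proof (intro sum_mono mult_left_mono)
      fix j assume j: "j \<in> {..J}"
      show "(\<Sum>c\<in>pa_cells k. E p' (\<lambda>x. of_bool (cp k x = c)) *
        (\<Sum>w\<in>cells j k. \<bar>ker_level qc' qf' j k c w - ker_level qc qf j k c w\<bar>))
        \<le> 2 * dev_joint p p' k (min j m) + 2 * dev_marg p p' k j"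
      proof (cases "j \<le> m")
        case True
        then show ?thesis
          using ker_level_diff_coarse[OF p p'(1-3) k True] dev_marg_nonneg[of p p' k j]
          by (simp add: min_absorb1)
      next
        case False
        then show ?thesis
          using ker_level_diff_fine[OF p p'(1-3) k, of j] j by (simp add: min_absorb2)
      qed
    qed (use C in auto)
    ultimately show ?thesis by linarith
  qed
  have eq: "T (Suc K) - T 1 = (\<Sum>k=1..K. T (Suc k) - T k)"
    by (simp add: sum_Suc_diff)
  have "\<bar>T (Suc K) - T 1\<bar> \<le> (\<Sum>k=1..K. \<bar>T (Suc k) - T k\<bar>)" unfolding eq by (rule sum_abs)
  also have "\<dots> \<le> (\<Sum>k=1..K. \<Sum>j\<le>J. ?a * (2 * (1/2)^j) *
          (2 * dev_joint p p' k (min j m) + 2 * dev_marg p p' k j))"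
    using step by (intro sum_mono) auto
  finally show ?thesis by (simp add: T_def del: upt_Suc)
qed

end

section \<open>Bounded measurable functions\<close>

text \<open>Under a finite measure this gives integrability and, unlike integrability, it is
  preserved by products.\<close>

definition bounded_meas :: "'m measure \<Rightarrow> ('m \<Rightarrow> real) \<Rightarrow> bool" where
  "bounded_meas M f \<longleftrightarrow> f \<in> borel_measurable M \<and> (\<exists>B. \<forall>x\<in>space M. \<bar>f x\<bar> \<le> B)"

lemma bounded_meas_const: "bounded_meas M (\<lambda>_. c)"
  by (auto simp: bounded_meas_def)

lemma bounded_meas_add:
  assumes "bounded_meas M f" "bounded_meas M g"
  shows "bounded_meas M (\<lambda>x. f x + g x)"
proof -
  obtain A B where "\<forall>x\<in>space M. \<bar>f x\<bar> \<le> A" "\<forall>x\<in>space M. \<bar>g x\<bar> \<le> B"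
    using assms by (auto simp: bounded_meas_def)
  then have "\<forall>x\<in>space M. \<bar>f x + g x\<bar> \<le> A + B" by (smt (verit))
  then show ?thesis using assms by (auto simp: bounded_meas_def)
qed

lemma bounded_meas_mult:
  assumes "bounded_meas M f" "bounded_meas M g"
  shows "bounded_meas M (\<lambda>x. f x * g x)"
proof -
  obtain A B where AB: "\<forall>x\<in>space M. \<bar>f x\<bar> \<le> A" "\<forall>x\<in>space M. \<bar>g x\<bar> \<le> B"
    using assms by (auto simp: bounded_meas_def)
  have "\<bar>f x * g x\<bar> \<le> \<bar>A\<bar> * \<bar>B\<bar>" if "x \<in> space M" for x
    unfolding abs_mult using AB that by (intro mult_mono) force+
  then have "\<exists>C. \<forall>x\<in>space M. \<bar>f x * g x\<bar> \<le> C" by blast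
  then show ?thesis using assms by (auto simp: bounded_meas_def)
qed

lemma bounded_meas_diff:
  assumes "bounded_meas M f" "bounded_meas M g"
  shows "bounded_meas M (\<lambda>x. f x - g x)"
  using bounded_meas_add[OF assms(1) bounded_meas_mult[OF bounded_meas_const[of M "-1"] assms(2)]]
  by simp

lemma bounded_meas_abs: "bounded_meas M f \<Longrightarrow> bounded_meas M (\<lambda>x. \<bar>f x\<bar>)"
  by (auto simp: bounded_meas_def)

lemma bounded_meas_sum:
  "(\<And>i. i \<in> I \<Longrightarrow> bounded_meas M (f i)) \<Longrightarrow> bounded_meas M (\<lambda>x. \<Sum>i\<in>I. f i x)"
  by (induction I rule: infinite_finite_induct) (auto intro: bounded_meas_const bounded_meas_add)

lemma bounded_meas_simple:
  assumes "W \<in> M \<rightarrow>\<^sub>M count_space UNIV" "finite C" "\<And>x. x \<in> space M \<Longrightarrow> W x \<in> C"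
  shows "bounded_meas M (\<lambda>x. h (W x))"
proof -
  have "\<bar>h (W x)\<bar> \<le> (\<Sum>c\<in>C. \<bar>h c\<bar>)" if "x \<in> space M" for x
    using assms that by (intro member_le_sum[where f="\<lambda>c. \<bar>h c\<bar>"]) auto
  moreover have "(\<lambda>x. h (W x)) \<in> borel_measurable M"
    by (rule measurable_compose[OF assms(1)]) simp
  ultimately show ?thesis by (auto simp: bounded_meas_def)
qed

lemma (in finite_measure) bounded_meas_integrable: "bounded_meas M f \<Longrightarrow> integrable M f"
  unfolding bounded_meas_def by (elim conjE exE, rule integrable_const_bound) (auto intro!: AE_I2)

lemmas bounded_meas_intros = bounded_meas_const bounded_meas_add bounded_meas_diff bounded_meas_mult
  bounded_meas_abs bounded_meas_sum

section \<open>Bias of a single kernel and of the network\<close>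

context clique_net
begin

text \<open>The bias of replacing the conditional distribution of \<open>x\<^sub>k\<close> is a product of two small factors:
  the total variation between the conditional distribution and its replacement is at most
  \<open>4 * \<epsilon>\<close>, and the difference between the two integrates to zero over the cells, so that only the variation of the integrand
  and of the conditional distribution \<open>kpre\<close> of \<open>x\<^sub>p\<^sub>r\<^sub>e\<^sub>(\<^sub>k\<^sub>)\<close> within a cell contributes.\<close>

lemma bias_step:
  fixes M :: "'m measure" and kap :: "'b \<Rightarrow> 'm \<Rightarrow> real" and kpre :: "(nat \<Rightarrow> 'b) \<Rightarrow> 'm \<Rightarrow> real"
    and W :: "'m \<Rightarrow> nat \<Rightarrow> 'b"
  assumes M: "prob_space M" and k: "k \<in> {1..K}"
    and q: "compat p qc qf" "stoch qc qf"
    and W: "W \<in> M \<rightarrow>\<^sub>M count_space UNIV" "\<And>\<omega>. \<omega> \<in> space M \<Longrightarrow> W \<omega> \<in> PiE (pa G k) S"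
    and kap: "\<And>y. y \<in> S k \<Longrightarrow> bounded_meas M (kap y)"
      "\<And>\<omega> y. \<omega> \<in> space M \<Longrightarrow> y \<in> S k \<Longrightarrow> 0 \<le> kap y \<omega>" "\<And>\<omega>. \<omega> \<in> space M \<Longrightarrow> (\<Sum>y\<in>S k. kap y \<omega>) = 1"
    and kpre: "\<And>u. u \<in> PiE (pre G k) S \<Longrightarrow> bounded_meas M (kpre u)"
      "\<And>\<omega> u. \<omega> \<in> space M \<Longrightarrow> u \<in> PiE (pre G k) S \<Longrightarrow> 0 \<le> kpre u \<omega>"
      "\<And>\<omega>. \<omega> \<in> space M \<Longrightarrow> (\<Sum>u\<in>PiE (pre G k) S. kpre u \<omega>) = 1"
    and law: "\<And>H. E p (\<lambda>x. H (restrict x (pre G k)) (restrict x (pa G k)) (x k))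
      = (\<integral>\<omega>. (\<Sum>y\<in>S k. \<Sum>u\<in>PiE (pre G k) S. kap y \<omega> * kpre u \<omega> * H u (W \<omega>) y) \<partial>M)"
    and kap_ref: "\<And>\<omega>. \<omega> \<in> space M \<Longrightarrow> (\<Sum>y\<in>S k. \<bar>kap y \<omega> - kap_ref (cp k (W \<omega>)) y\<bar>) \<le> \<epsilon>"
    and kpre_ref: "\<And>\<omega>. \<omega> \<in> space M \<Longrightarrow> (\<Sum>u\<in>PiE (pre G k) S. \<bar>kpre u \<omega> - kpre_ref (cp k (W \<omega>)) u\<bar>) \<le> \<epsilon>"
    and third: "\<And>y. y \<in> S k \<Longrightarrow> (\<Sum>c\<in>pa_cells k. \<bar>E p (\<lambda>x. of_bool (cp k x = c \<and> x k = y))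
        - t (R m k y) c * E p (\<lambda>x. of_bool (x k = y))\<bar>) \<le> \<epsilon> * E p (\<lambda>x. of_bool (x k = y))"
    and f: "\<And>x. grid_pt S (Suc k) x \<Longrightarrow> \<bar>f x\<bar> \<le> 1"
      "\<And>x x'. grid_pt S (Suc k) x \<Longrightarrow> grid_pt S (Suc k) x' \<Longrightarrow> (\<And>i. i \<in> {1..k} \<Longrightarrow> x i = x' i) \<Longrightarrow> f x = f x'"
      "\<And>x x'. grid_pt S (Suc k) x \<Longrightarrow> grid_pt S (Suc k) x' \<Longrightarrow> (\<And>i. i \<in> {1..k} \<Longrightarrow> R m i (x i) = R m i (x' i))
        \<Longrightarrow> \<bar>f x - f x'\<bar> \<le> \<delta>"
    and nn: "0 \<le> \<delta>" "0 \<le> \<epsilon>"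
  shows "\<bar>E p f - E p (net_step S (ker qc qf) k f)\<bar> \<le> 4 * \<epsilon> * (\<delta> + \<epsilon>)"
proof -
  interpret prob_space M by fact
  define SU where "SU = PiE (pre G k) S"
  have fin_SU: "finite SU"
    unfolding SU_def using fin_S by (intro finite_PiE) (auto simp: pre_def)
  define SW where "SW = PiE (pa G k) S"
  have fin_SW: "finite SW" unfolding SW_def using fin_S fin_pa by (intro finite_PiE) auto
  \<comment> \<open>\<open>f\<close> in terms of the three groups of nodes that \<open>law\<close>
    treats separately: the predecessors that are not parents, the parents, and \<open>k\<close>
    itself.\<close>
  define g where "g u w y = f (\<lambda>i. if i = k then y else if i \<in> pa G k then w i else u i)" for u w y
  define c where "c \<omega> = cp k (W \<omega>)" for \<omega>
  define q where "q cc y = qc k cc (R m k y) * qf k y" for cc y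
  have SW_S: "w i \<in> S i" if "w \<in> SW" "i \<in> pa G k" for w i using that by (auto simp: SW_def)
  have cells_SW: "cc \<in> SW" if "cc \<in> pa_cells k" for cc
    using that cells_S[OF m_J] by (fastforce simp: SW_def pa_cells_def PiE_def Pi_def)
  have SU_S: "u i \<in> S i" if "u \<in> SU" "i \<in> {1..<k} - pa G k" for u i
    using that by (auto simp: SU_def pre_def)
  have glue: "grid_pt S (Suc k) (\<lambda>i. if i = k then y else if i \<in> pa G k then w i else u i)"
    if "u \<in> SU" "w \<in> SW" "y \<in> S k" for u w y
    using that SW_S SU_S by (auto simp: grid_pt_def)
  have cW: "c \<omega> \<in> pa_cells k" if "\<omega> \<in> space M" for \<omega>
    unfolding c_def using W(2)[OF that] pa_less(3)[of k]
    by (auto simp: cp_def pa_cells_def cells_def PiE_def Pi_def)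
  have WS: "W \<omega> \<in> SW" if "\<omega> \<in> space M" for \<omega> using W(2)[OF that] by (simp add: SW_def)
  have cp_restrict: "cp k (restrict x (pa G k)) = cp k x" for x by (auto simp: cp_def)
  have law': "E p (\<lambda>x. H (restrict x (pre G k)) (restrict x (pa G k)) (x k))
      = (\<integral>\<omega>. (\<Sum>y\<in>S k. \<Sum>u\<in>SU. kap y \<omega> * kpre u \<omega> * H u (W \<omega>) y) \<partial>M)" for H
    using law unfolding SU_def .
  have kpre1: "(\<Sum>u\<in>SU. kpre u \<omega>) = 1" if "\<omega> \<in> space M" for \<omega> using kpre(3)[OF that] by (simp add: SU_def)
  have law2: "E p (\<lambda>x. H (restrict x (pa G k)) (x k)) = (\<integral>\<omega>. (\<Sum>y\<in>S k. kap y \<omega> * H (W \<omega>) y) \<partial>M)" for H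
  proof -
    have "(\<Sum>y\<in>S k. \<Sum>u\<in>SU. kap y \<omega> * kpre u \<omega> * H (W \<omega>) y) = (\<Sum>y\<in>S k. kap y \<omega> * H (W \<omega>) y)"
      if "\<omega> \<in> space M" for \<omega>
    proof (intro sum.cong refl)
      fix y
      have "(\<Sum>u\<in>SU. kap y \<omega> * kpre u \<omega> * H (W \<omega>) y) = (kap y \<omega> * H (W \<omega>) y) * (\<Sum>u\<in>SU. kpre u \<omega>)"
        by (simp add: sum_distrib_left mult_ac)
      then show "(\<Sum>u\<in>SU. kap y \<omega> * kpre u \<omega> * H (W \<omega>) y) = kap y \<omega> * H (W \<omega>) y"
        using kpre1[OF that] by simp
    qed
    then show ?thesis
      by (subst law'[of "\<lambda>u. H"]) (intro Bochner_Integration.integral_cong refl, simp)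
  qed
  have bmW: "bounded_meas M (\<lambda>\<omega>. h (W \<omega>))" for h :: "(nat \<Rightarrow> 'b) \<Rightarrow> real"
    by (rule bounded_meas_simple[OF W(1) fin_SW WS])
  have bmc: "bounded_meas M (\<lambda>\<omega>. h (c \<omega>))" for h :: "(nat \<Rightarrow> 'b) \<Rightarrow> real"
    unfolding c_def by (rule bmW)
  have bmkpre: "u \<in> SU \<Longrightarrow> bounded_meas M (kpre u)" for u using kpre(1) by (simp add: SU_def)
  \<comment> \<open>The signed kernel, true minus replaced: \<open>kap\<close> depends on the exact
    parents, \<open>q\<close> only on their cells.\<close>
  define D where "D y \<omega> = kap y \<omega> - q (c \<omega>) y" for y \<omega>
  have bmD: "bounded_meas M (D y)" if "y \<in> S k" for y
    unfolding D_def[abs_def] using kap(1) that bmc[of "\<lambda>c. q c y"] by (intro bounded_meas_intros) auto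
  have Pcy: "E p (\<lambda>x. of_bool (cp k x = cc \<and> x k = y)) = (\<integral>\<omega>. kap y \<omega> * of_bool (c \<omega> = cc) \<partial>M)"
    if "y \<in> S k" for cc y
  proof -
    have "E p (\<lambda>x. of_bool (cp k x = cc \<and> x k = y))
      = (\<integral>\<omega>. (\<Sum>y'\<in>S k. kap y' \<omega> * of_bool (c \<omega> = cc \<and> y' = y)) \<partial>M)"
      using law2[of "\<lambda>w y'. of_bool (cp k w = cc \<and> y' = y)"] by (simp add: cp_restrict c_def)
    also have "(\<lambda>\<omega>. \<Sum>y'\<in>S k. kap y' \<omega> * of_bool (c \<omega> = cc \<and> y' = y)) = (\<lambda>\<omega>. kap y \<omega> * of_bool (c \<omega> = cc))"
    proof
      fix \<omega>
      have "(\<Sum>y'\<in>S k. kap y' \<omega> * of_bool (c \<omega> = cc \<and> y' = y))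
          = (\<Sum>y'\<in>S k. if y' = y then kap y \<omega> * of_bool (c \<omega> = cc) else 0)"
        by (intro sum.cong) auto
      then show "(\<Sum>y'\<in>S k. kap y' \<omega> * of_bool (c \<omega> = cc \<and> y' = y)) = kap y \<omega> * of_bool (c \<omega> = cc)"
        using fin_S that by simp
    qed
    finally show ?thesis .
  qed
  have Pc: "E p (\<lambda>x. of_bool (cp k x = cc)) = (\<integral>\<omega>. of_bool (c \<omega> = cc) \<partial>M)" for cc
  proof -
    have "E p (\<lambda>x. of_bool (cp k x = cc)) = (\<integral>\<omega>. (\<Sum>y'\<in>S k. kap y' \<omega> * of_bool (c \<omega> = cc)) \<partial>M)"
      using law2[of "\<lambda>w y'. of_bool (cp k w = cc)"] by (simp add: cp_restrict c_def)
    also have "\<dots> = (\<integral>\<omega>. of_bool (c \<omega> = cc) \<partial>M)"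
      using kap(3) by (intro Bochner_Integration.integral_cong) (auto simp: sum_distrib_right[symmetric])
    finally show ?thesis .
  qed
  let ?P = "\<lambda>cc. E p (\<lambda>x. of_bool (cp k x = cc))"
  let ?Pcy = "\<lambda>cc y. E p (\<lambda>x. of_bool (cp k x = cc \<and> x k = y))"
  let ?Pcv = "\<lambda>cc v. E p (\<lambda>x. of_bool (cp k x = cc \<and> R m k (x k) = v))"
  let ?Py = "\<lambda>y. E p (\<lambda>x. of_bool (x k = y))"
  let ?Pv = "\<lambda>v. E p (\<lambda>x. of_bool (R m k (x k) = v))"
  have Pcv: "?Pcv cc v = (\<Sum>y | y \<in> S k \<and> R m k y = v. ?Pcy cc y)" for cc v
  proof -
    have "?Pcv cc v = (\<Sum>y\<in>S k. E p (\<lambda>x. of_bool ((cp k x = cc \<and> R m k (x k) = v) \<and> x k = y)))"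
      using \<Omega>_in k fin_S by (intro E_marginal) auto
    also have "\<dots> = (\<Sum>y\<in>S k. if R m k y = v then ?Pcy cc y else 0)"
      by (intro sum.cong refl E_filter[symmetric]) auto
    also have "\<dots> = (\<Sum>y | y \<in> S k \<and> R m k y = v. ?Pcy cc y)"
      using fin_S by (intro sum.inter_filter[symmetric]) auto
    finally show ?thesis .
  qed
  have Pv: "?Pv v = (\<Sum>y | y \<in> S k \<and> R m k y = v. ?Py y)" for v
  proof -
    have "?Pv v = (\<Sum>y\<in>S k. E p (\<lambda>x. of_bool (R m k (x k) = v \<and> x k = y)))"
      using \<Omega>_in k fin_S by (intro E_marginal) auto
    also have "\<dots> = (\<Sum>y\<in>S k. if R m k y = v then ?Py y else 0)"
      by (intro sum.cong refl E_filter[symmetric]) auto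
    also have "\<dots> = (\<Sum>y | y \<in> S k \<and> R m k y = v. ?Py y)"
      using fin_S by (intro sum.inter_filter[symmetric]) auto
    finally show ?thesis .
  qed
  have Py1: "(\<Sum>y\<in>S k. ?Py y) = 1"
  proof -
    have "(\<Sum>y\<in>S k. ?Py y) = E p (\<lambda>x. of_bool True)"
      using E_marginal[of "S k" "\<lambda>x. x k" p "\<lambda>_. True"] \<Omega>_in k fin_S by simp
    also have "\<dots> = 1"
      using law2[of "\<lambda>w y. 1"] kap(3) by (simp cong: Bochner_Integration.integral_cong add: prob_space)
    finally show ?thesis .
  qed
  have qv: "?P cc * qc k cc v = ?Pcv cc v" if "cc \<in> pa_cells k" "v \<in> cells m k" for cc v
    using q(1) k that by (simp add: compat_def)
  have Py: "?Py y = ?Pv (R m k y) * qf k y" if "y \<in> S k" for y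
    using q(1) k that by (simp add: compat_def)
  have qf_nn: "0 \<le> qf k y" if "y \<in> S k" for y using q(2) k that by (simp add: stoch_def)

  \<comment> \<open>Four comparisons at cost \<open>\<epsilon>\<close> each: \<open>kap\<close> with
    its reference value on the parent cell, that value with the joint law of parent cell and
    \<open>x k\<close>, the joint law with the product of \<open>t\<close> and the law of
    \<open>x k\<close>, and this product with the replaced kernel.\<close>
  have A: "(\<integral>\<omega>. (\<Sum>y\<in>S k. \<bar>D y \<omega>\<bar>) \<partial>M) \<le> 4 * \<epsilon>"
  proof -
    have th: "(\<Sum>cc\<in>pa_cells k. \<Sum>y\<in>S k. \<bar>?Pcy cc y - t (R m k y) cc * ?Py y\<bar>) \<le> \<epsilon>"
    proof -
      have "(\<Sum>cc\<in>pa_cells k. \<Sum>y\<in>S k. \<bar>?Pcy cc y - t (R m k y) cc * ?Py y\<bar>)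
          = (\<Sum>y\<in>S k. \<Sum>cc\<in>pa_cells k. \<bar>?Pcy cc y - t (R m k y) cc * ?Py y\<bar>)" by (rule sum.swap)
      also have "\<dots> \<le> (\<Sum>y\<in>S k. \<epsilon> * ?Py y)" by (intro sum_mono third)
      finally show ?thesis using Py1 by (simp add: sum_distrib_left[symmetric])
    qed
    \<comment> \<open>Both terms of the difference spread a mass over each level-\<open>m\<close>
      cell by the same weights \<open>qf\<close>. Hence only the totals over the cells differ, and
      these are handled by the triangle inequality.\<close>
    have fine: "(\<Sum>y\<in>S k. \<bar>t (R m k y) cc * ?Py y - ?Pcv cc (R m k y) * qf k y\<bar>)
      \<le> (\<Sum>y\<in>S k. \<bar>?Pcy cc y - t (R m k y) cc * ?Py y\<bar>)" for cc
    proof -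
      have "(\<Sum>y\<in>S k. \<bar>t (R m k y) cc * ?Py y - ?Pcv cc (R m k y) * qf k y\<bar>)
        = (\<Sum>y\<in>S k. \<bar>t (R m k y) cc * ?Pv (R m k y) - ?Pcv cc (R m k y)\<bar> * qf k y)"
      proof (intro sum.cong refl)
        fix y assume y: "y \<in> S k"
        have "t (R m k y) cc * ?Py y - ?Pcv cc (R m k y) * qf k y
          = (t (R m k y) cc * ?Pv (R m k y) - ?Pcv cc (R m k y)) * qf k y"
          by (simp add: Py[OF y] algebra_simps)
        then show "\<bar>t (R m k y) cc * ?Py y - ?Pcv cc (R m k y) * qf k y\<bar>
          = \<bar>t (R m k y) cc * ?Pv (R m k y) - ?Pcv cc (R m k y)\<bar> * qf k y"
          using qf_nn[OF y] by (simp add: abs_mult)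
      qed
      also have "\<dots> = (\<Sum>v\<in>cells m k. \<bar>t v cc * ?Pv v - ?Pcv cc v\<bar>)"
        by (rule sum_fine[OF q(2) k, where H="\<lambda>v. \<bar>t v cc * ?Pv v - ?Pcv cc v\<bar>"])
      also have "\<dots> \<le> (\<Sum>v\<in>cells m k. \<Sum>y | y \<in> S k \<and> R m k y = v. \<bar>?Pcy cc y - t (R m k y) cc * ?Py y\<bar>)"
      proof (intro sum_mono)
        fix v
        have "t v cc * ?Pv v - ?Pcv cc v = (\<Sum>y | y \<in> S k \<and> R m k y = v. t (R m k y) cc * ?Py y - ?Pcy cc y)"
          unfolding Pv Pcv sum_distrib_left sum_subtractf by simp
        then show "\<bar>t v cc * ?Pv v - ?Pcv cc v\<bar>
            \<le> (\<Sum>y | y \<in> S k \<and> R m k y = v. \<bar>?Pcy cc y - t (R m k y) cc * ?Py y\<bar>)"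
          by (simp only: abs_minus_commute[of "E p _"] sum_abs)
      qed
      also have "\<dots> = (\<Sum>y\<in>S k. \<bar>?Pcy cc y - t (R m k y) cc * ?Py y\<bar>)"
        using fin_S by (intro sum.group) (auto simp: cells_def)
      finally show ?thesis .
    qed
    have step1: "(\<integral>\<omega>. (\<Sum>y\<in>S k. \<bar>kap y \<omega> - kap_ref (c \<omega>) y\<bar>) \<partial>M) \<le> \<epsilon>"
    proof -
      have "(\<integral>\<omega>. (\<Sum>y\<in>S k. \<bar>kap y \<omega> - kap_ref (c \<omega>) y\<bar>) \<partial>M) \<le> (\<integral>\<omega>. \<epsilon> \<partial>M)"
        using kap_ref bmc[of "\<lambda>c. kap_ref c _"] kap(1) unfolding c_def
        by (intro integral_mono bounded_meas_integrable bounded_meas_intros) (auto simp: c_def[symmetric] intro: bmc[of "\<lambda>c. kap_ref c _"])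
      then show ?thesis by (simp add: prob_space)
    qed
    have bmk: "bounded_meas M (\<lambda>\<omega>. \<Sum>y\<in>S k. \<bar>kap y \<omega> - kap_ref (c \<omega>) y\<bar>)"
      using kap(1) by (intro bounded_meas_intros bmc[of "\<lambda>c. kap_ref c _"]) auto
    have bmq: "bounded_meas M (\<lambda>\<omega>. \<Sum>y\<in>S k. \<bar>kap_ref (c \<omega>) y - q (c \<omega>) y\<bar>)"
      by (rule bmc[of "\<lambda>c. \<Sum>y\<in>S k. \<bar>kap_ref c y - q c y\<bar>"])
    have step2: "(\<integral>\<omega>. (\<Sum>y\<in>S k. \<bar>kap_ref (c \<omega>) y - q (c \<omega>) y\<bar>) \<partial>M)
       = (\<Sum>cc\<in>pa_cells k. \<Sum>y\<in>S k. \<bar>?P cc * kap_ref cc y - ?P cc * q cc y\<bar>)"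
    proof -
      have P_nn: "0 \<le> ?P cc" for cc unfolding Pc by simp
      have "(\<integral>\<omega>. (\<Sum>y\<in>S k. \<bar>kap_ref (c \<omega>) y - q (c \<omega>) y\<bar>) \<partial>M)
        = E p (\<lambda>x. \<Sum>y\<in>S k. \<bar>kap_ref (cp k x) y - q (cp k x) y\<bar>)"
      proof -
        have "E p (\<lambda>x. \<Sum>y\<in>S k. \<bar>kap_ref (cp k x) y - q (cp k x) y\<bar>)
          = (\<integral>\<omega>. (\<Sum>y'\<in>S k. kap y' \<omega> * (\<Sum>y\<in>S k. \<bar>kap_ref (c \<omega>) y - q (c \<omega>) y\<bar>)) \<partial>M)"
          using law2[of "\<lambda>w y'. \<Sum>y\<in>S k. \<bar>kap_ref (cp k w) y - q (cp k w) y\<bar>"] by (simp add: cp_restrict c_def)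
        also have "\<dots> = (\<integral>\<omega>. (\<Sum>y\<in>S k. \<bar>kap_ref (c \<omega>) y - q (c \<omega>) y\<bar>) \<partial>M)"
          using kap(3) by (intro Bochner_Integration.integral_cong) (auto simp: sum_distrib_right[symmetric])
        finally show ?thesis by simp
      qed
      also have "\<dots> = (\<Sum>cc\<in>pa_cells k. ?P cc * (\<Sum>y\<in>S k. \<bar>kap_ref cc y - q cc y\<bar>))"
        using cp_\<Omega> k by (intro E_expand) auto
      also have "\<dots> = (\<Sum>cc\<in>pa_cells k. \<Sum>y\<in>S k. \<bar>?P cc * kap_ref cc y - ?P cc * q cc y\<bar>)"
        using P_nn by (simp add: sum_distrib_left right_diff_distrib[symmetric] abs_mult)
      finally show ?thesis .
    qed
    \<comment> \<open>The joint law is the average of \<open>kap\<close> over the parent cell;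
      moving the absolute value inside that average reduces the claim to
      \<open>step1\<close>.\<close>
    have step3: "(\<Sum>cc\<in>pa_cells k. \<Sum>y\<in>S k. \<bar>?P cc * kap_ref cc y - ?Pcy cc y\<bar>) \<le> \<epsilon>"
    proof -
      have "(\<Sum>cc\<in>pa_cells k. \<Sum>y\<in>S k. \<bar>?P cc * kap_ref cc y - ?Pcy cc y\<bar>)
        \<le> (\<Sum>cc\<in>pa_cells k. \<Sum>y\<in>S k. \<integral>\<omega>. \<bar>kap y \<omega> - kap_ref cc y\<bar> * of_bool (c \<omega> = cc) \<partial>M)"
      proof (intro sum_mono)
        fix cc y assume y: "y \<in> S k"
        have "?P cc * kap_ref cc y - ?Pcy cc y = (\<integral>\<omega>. (kap_ref cc y - kap y \<omega>) * of_bool (c \<omega> = cc) \<partial>M)"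
          unfolding Pc Pcy[OF y] left_diff_distrib
          using y kap(1) bmc[of "\<lambda>c. of_bool (c = cc)"]
          by (subst Bochner_Integration.integral_diff) (auto intro!: bounded_meas_integrable bounded_meas_intros)
        also have "\<bar>\<dots>\<bar> \<le> (\<integral>\<omega>. \<bar>(kap_ref cc y - kap y \<omega>) * of_bool (c \<omega> = cc)\<bar> \<partial>M)"
          by (rule integral_abs_bound)
        also have "\<dots> = (\<integral>\<omega>. \<bar>kap y \<omega> - kap_ref cc y\<bar> * of_bool (c \<omega> = cc) \<partial>M)"
          by (intro Bochner_Integration.integral_cong) (auto simp: abs_mult)
        finally show "\<bar>?P cc * kap_ref cc y - ?Pcy cc y\<bar>
          \<le> (\<integral>\<omega>. \<bar>kap y \<omega> - kap_ref cc y\<bar> * of_bool (c \<omega> = cc) \<partial>M)" .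
      qed
      also have "\<dots> = (\<integral>\<omega>. (\<Sum>cc\<in>pa_cells k. \<Sum>y\<in>S k. \<bar>kap y \<omega> - kap_ref cc y\<bar> * of_bool (c \<omega> = cc)) \<partial>M)"
        using kap(1) by (subst Bochner_Integration.integral_sum | subst Bochner_Integration.integral_sum
          | intro bounded_meas_integrable bounded_meas_intros bmc[of "\<lambda>c. of_bool (c = _)"] sum.cong refl | assumption)+
      also have "\<dots> = (\<integral>\<omega>. (\<Sum>y\<in>S k. \<bar>kap y \<omega> - kap_ref (c \<omega>) y\<bar>) \<partial>M)"
      proof (intro Bochner_Integration.integral_cong refl)
        fix \<omega> assume \<omega>: "\<omega> \<in> space M"
        have "(\<Sum>cc\<in>pa_cells k. \<Sum>y\<in>S k. \<bar>kap y \<omega> - kap_ref cc y\<bar> * of_bool (c \<omega> = cc))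
          = (\<Sum>cc\<in>pa_cells k. if cc = c \<omega> then (\<Sum>y\<in>S k. \<bar>kap y \<omega> - kap_ref (c \<omega>) y\<bar>) else 0)"
          by (intro sum.cong refl) auto
        then show "(\<Sum>cc\<in>pa_cells k. \<Sum>y\<in>S k. \<bar>kap y \<omega> - kap_ref cc y\<bar> * of_bool (c \<omega> = cc))
          = (\<Sum>y\<in>S k. \<bar>kap y \<omega> - kap_ref (c \<omega>) y\<bar>)" using cW[OF \<omega>] by simp
      qed
      finally show ?thesis using step1 by linarith
    qed
    have "(\<integral>\<omega>. (\<Sum>y\<in>S k. \<bar>D y \<omega>\<bar>) \<partial>M)
      \<le> (\<integral>\<omega>. (\<Sum>y\<in>S k. \<bar>kap y \<omega> - kap_ref (c \<omega>) y\<bar>) + (\<Sum>y\<in>S k. \<bar>kap_ref (c \<omega>) y - q (c \<omega>) y\<bar>) \<partial>M)"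
    proof (intro integral_mono bounded_meas_integrable)
      show "bounded_meas M (\<lambda>\<omega>. \<Sum>y\<in>S k. \<bar>D y \<omega>\<bar>)" by (intro bounded_meas_intros bmD)
      show "bounded_meas M (\<lambda>\<omega>. (\<Sum>y\<in>S k. \<bar>kap y \<omega> - kap_ref (c \<omega>) y\<bar>) + (\<Sum>y\<in>S k. \<bar>kap_ref (c \<omega>) y - q (c \<omega>) y\<bar>))"
        by (intro bounded_meas_add bmk bmq)
    qed (auto simp: sum.distrib[symmetric] D_def intro!: sum_mono)
    also have "\<dots> = (\<integral>\<omega>. (\<Sum>y\<in>S k. \<bar>kap y \<omega> - kap_ref (c \<omega>) y\<bar>) \<partial>M)
       + (\<integral>\<omega>. (\<Sum>y\<in>S k. \<bar>kap_ref (c \<omega>) y - q (c \<omega>) y\<bar>) \<partial>M)"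
      by (intro Bochner_Integration.integral_add bounded_meas_integrable bmk bmq)
    also have "\<dots> \<le> \<epsilon> + (\<Sum>cc\<in>pa_cells k. \<Sum>y\<in>S k. \<bar>?P cc * kap_ref cc y - ?P cc * q cc y\<bar>)"
      using step1 step2 by simp
    also have "\<dots> \<le> \<epsilon> + (\<Sum>cc\<in>pa_cells k. \<Sum>y\<in>S k. \<bar>?P cc * kap_ref cc y - ?Pcy cc y\<bar>
        + (\<bar>?Pcy cc y - t (R m k y) cc * ?Py y\<bar> + \<bar>t (R m k y) cc * ?Py y - ?Pcv cc (R m k y) * qf k y\<bar>))"
    proof (intro add_left_mono sum_mono)
      fix cc y assume cc: "cc \<in> pa_cells k" and y: "y \<in> S k"
      have "?P cc * q cc y = ?Pcv cc (R m k y) * qf k y"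
        unfolding q_def using qv[OF cc cells_in[OF y]] by simp
      then show "\<bar>?P cc * kap_ref cc y - ?P cc * q cc y\<bar> \<le> \<bar>?P cc * kap_ref cc y - ?Pcy cc y\<bar>
        + (\<bar>?Pcy cc y - t (R m k y) cc * ?Py y\<bar> + \<bar>t (R m k y) cc * ?Py y - ?Pcv cc (R m k y) * qf k y\<bar>)"
        by linarith
    qed
    also have "\<dots> \<le> \<epsilon> + (\<epsilon> + (\<epsilon> + \<epsilon>))"
      unfolding sum.distrib
      using step3 th order_trans[OF sum_mono[OF fine] th] by (intro add_mono) auto
    finally show ?thesis by simp
  qed

  \<comment> \<open>By \<open>compat_step\<close> the true and the replaced kernel give the same
    joint law to the level-\<open>m\<close> cells of \<open>k\<close> and its parents.\<close>
  have zero: "(\<integral>\<omega>. (\<Sum>y\<in>S k. h (c \<omega>) (R m k y) * D y \<omega>) \<partial>M) = 0" for h :: "(nat \<Rightarrow> 'b) \<Rightarrow> 'b \<Rightarrow> real"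
  proof -
    have "(\<integral>\<omega>. (\<Sum>y\<in>S k. h (c \<omega>) (R m k y) * D y \<omega>) \<partial>M)
      = (\<integral>\<omega>. (\<Sum>y\<in>S k. kap y \<omega> * h (c \<omega>) (R m k y)) \<partial>M) - (\<integral>\<omega>. (\<Sum>y\<in>S k. q (c \<omega>) y * h (c \<omega>) (R m k y)) \<partial>M)"
    proof -
      have "(\<integral>\<omega>. (\<Sum>y\<in>S k. h (c \<omega>) (R m k y) * D y \<omega>) \<partial>M)
        = (\<integral>\<omega>. (\<Sum>y\<in>S k. kap y \<omega> * h (c \<omega>) (R m k y)) - (\<Sum>y\<in>S k. q (c \<omega>) y * h (c \<omega>) (R m k y)) \<partial>M)"
        by (simp add: D_def sum_subtractf[symmetric] algebra_simps)
      also have "\<dots> = (\<integral>\<omega>. (\<Sum>y\<in>S k. kap y \<omega> * h (c \<omega>) (R m k y)) \<partial>M) - (\<integral>\<omega>. (\<Sum>y\<in>S k. q (c \<omega>) y * h (c \<omega>) (R m k y)) \<partial>M)"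
        using kap(1) by (intro Bochner_Integration.integral_diff bounded_meas_integrable bounded_meas_intros
            bmc[of "\<lambda>c. h c _"] bmc[of "\<lambda>c. q c _"]) auto
      finally show ?thesis .
    qed
    also have "(\<integral>\<omega>. (\<Sum>y\<in>S k. kap y \<omega> * h (c \<omega>) (R m k y)) \<partial>M)
        = E p (\<lambda>x. h (cp k x) (R m k (x k)))"
      using law2[of "\<lambda>w y. h (cp k w) (R m k y)"] by (simp add: cp_restrict c_def)
    also have "\<dots> = E p (net_step S (ker qc qf) k (\<lambda>x. h (cp k x) (R m k (x k))))"
    proof (rule compat_step[OF q k, symmetric])
      fix x x' assume xx: "\<And>i. i \<in> insert k (pa G k) \<Longrightarrow> R m i (x i) = R m i (x' i)"
      then have "cp k x = cp k x'" by (auto simp: cp_def fun_eq_iff)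
      then show "h (cp k x) (R m k (x k)) = h (cp k x') (R m k (x' k))" using xx by simp
    qed
    also have "\<dots> = E p (\<lambda>x. \<Sum>y\<in>S k. q (cp k x) y * h (cp k x) (R m k y))"
      by (simp add: net_step_def[abs_def] ker_def q_def cp_upd k_notin_pa)
    also have "\<dots> = (\<integral>\<omega>. (\<Sum>y'\<in>S k. kap y' \<omega> * (\<Sum>y\<in>S k. q (c \<omega>) y * h (c \<omega>) (R m k y))) \<partial>M)"
      using law2[of "\<lambda>w y'. \<Sum>y\<in>S k. q (cp k w) y * h (cp k w) (R m k y)"] by (simp add: cp_restrict c_def)
    also have "\<dots> = (\<integral>\<omega>. (\<Sum>y\<in>S k. q (c \<omega>) y * h (c \<omega>) (R m k y)) \<partial>M)"
      using kap(3) by (intro Bochner_Integration.integral_cong) (auto simp: sum_distrib_right[symmetric])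
    finally show ?thesis by simp
  qed

  have f_g: "E p f = (\<integral>\<omega>. (\<Sum>y\<in>S k. \<Sum>u\<in>SU. kap y \<omega> * kpre u \<omega> * g u (W \<omega>) y) \<partial>M)"
  proof -
    have "E p f = E p (\<lambda>x. g (restrict x (pre G k)) (restrict x (pa G k)) (x k))"
      unfolding g_def
    proof (intro E_cong f(2))
      fix x assume x: "x \<in> \<Omega>"
      show "grid_pt S (Suc k) x" using \<Omega>_grid[OF x, of "Suc k"] k by auto
      then show "grid_pt S (Suc k) (\<lambda>i. if i = k then x k else if i \<in> pa G k then restrict x (pa G k) i else restrict x (pre G k) i)"
        by (auto simp: grid_pt_def pre_def)
    qed (auto simp: pre_def)
    then show ?thesis using law'[of g] by simp
  qed
  have sf_g: "E p (net_step S (ker qc qf) k f)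
      = (\<integral>\<omega>. (\<Sum>y\<in>S k. \<Sum>u\<in>SU. q (c \<omega>) y * kpre u \<omega> * g u (W \<omega>) y) \<partial>M)"
  proof -
    have "E p (net_step S (ker qc qf) k f)
      = E p (\<lambda>x. \<Sum>y\<in>S k. q (cp k (restrict x (pa G k))) y * g (restrict x (pre G k)) (restrict x (pa G k)) y)"
    proof (intro E_cong)
      fix x assume x: "x \<in> \<Omega>"
      have "f (x(k := y)) = g (restrict x (pre G k)) (restrict x (pa G k)) y" if y: "y \<in> S k" for y
        unfolding g_def
      proof (intro f(2))
        have gx: "grid_pt S k x" using \<Omega>_grid[OF x, of k] k by auto
        then show "grid_pt S (Suc k) (x(k := y))" using y by (rule grid_pt_upd)
        show "grid_pt S (Suc k) (\<lambda>i. if i = k then y else if i \<in> pa G k then restrict x (pa G k) i else restrict x (pre G k) i)"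
          using gx y by (auto simp: grid_pt_def pre_def)
      qed (auto simp: pre_def)
      then show "net_step S (ker qc qf) k f x
        = (\<Sum>y\<in>S k. q (cp k (restrict x (pa G k))) y * g (restrict x (pre G k)) (restrict x (pa G k)) y)"
        by (simp add: net_step_def ker_def q_def cp_restrict)
    qed
    also have "\<dots> = (\<integral>\<omega>. (\<Sum>y'\<in>S k. \<Sum>u\<in>SU. kap y' \<omega> * kpre u \<omega> * (\<Sum>y\<in>S k. q (c \<omega>) y * g u (W \<omega>) y)) \<partial>M)"
      using law'[of "\<lambda>u w y'. \<Sum>y\<in>S k. q (cp k w) y * g u w y"] by (simp add: c_def)
    also have "\<dots> = (\<integral>\<omega>. (\<Sum>y\<in>S k. \<Sum>u\<in>SU. q (c \<omega>) y * kpre u \<omega> * g u (W \<omega>) y) \<partial>M)"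
    proof (intro Bochner_Integration.integral_cong refl)
      fix \<omega> assume \<omega>: "\<omega> \<in> space M"
      have "(\<Sum>y'\<in>S k. \<Sum>u\<in>SU. kap y' \<omega> * kpre u \<omega> * (\<Sum>y\<in>S k. q (c \<omega>) y * g u (W \<omega>) y))
        = (\<Sum>y'\<in>S k. kap y' \<omega>) * (\<Sum>u\<in>SU. kpre u \<omega> * (\<Sum>y\<in>S k. q (c \<omega>) y * g u (W \<omega>) y))"
        by (simp add: sum_product mult.assoc)
      also have "\<dots> = (\<Sum>u\<in>SU. \<Sum>y\<in>S k. q (c \<omega>) y * kpre u \<omega> * g u (W \<omega>) y)"
        using kap(3)[OF \<omega>] by (simp add: sum_distrib_left mult_ac)
      also have "\<dots> = (\<Sum>y\<in>S k. \<Sum>u\<in>SU. q (c \<omega>) y * kpre u \<omega> * g u (W \<omega>) y)" by (rule sum.swap)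
      finally show "(\<Sum>y'\<in>S k. \<Sum>u\<in>SU. kap y' \<omega> * kpre u \<omega> * (\<Sum>y\<in>S k. q (c \<omega>) y * g u (W \<omega>) y))
        = (\<Sum>y\<in>S k. \<Sum>u\<in>SU. q (c \<omega>) y * kpre u \<omega> * g u (W \<omega>) y)" .
    qed
    finally show ?thesis .
  qed
  \<comment> \<open>\<open>T1\<close> moves the integrand to cell representatives, at cost
    \<open>\<delta>\<close>; \<open>T2\<close> freezes the law of the remaining predecessors, at
    cost \<open>\<epsilon>\<close>; what is left, \<open>T3\<close>, tests \<open>D\<close> against
    a function of the cells and vanishes by \<open>zero\<close>. Both costs multiply the mass of
    \<open>D\<close>, which makes the bias quadratic.\<close>
  define T1 where "T1 \<omega> = (\<Sum>y\<in>S k. \<Sum>u\<in>SU. D y \<omega> * kpre u \<omega> * (g u (W \<omega>) y - g u (c \<omega>) (R m k y)))" for \<omega>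
  define T2 where "T2 \<omega> = (\<Sum>y\<in>S k. \<Sum>u\<in>SU. D y \<omega> * (kpre u \<omega> - kpre_ref (c \<omega>) u) * g u (c \<omega>) (R m k y))" for \<omega>
  define T3 where "T3 \<omega> = (\<Sum>y\<in>S k. (\<Sum>u\<in>SU. kpre_ref (c \<omega>) u * g u (c \<omega>) (R m k y)) * D y \<omega>)" for \<omega>
  have bmg: "bounded_meas M (\<lambda>\<omega>. g u (W \<omega>) y)" "bounded_meas M (\<lambda>\<omega>. g u (c \<omega>) y)"
    "bounded_meas M (\<lambda>\<omega>. q (c \<omega>) y)" "bounded_meas M (\<lambda>\<omega>. kpre_ref (c \<omega>) u)" for u y
    using bmW[of "\<lambda>w. g u w y"] bmc[of "\<lambda>w. g u w y"] bmc[of "\<lambda>w. q w y"] bmc[of "\<lambda>w. kpre_ref w u"] by auto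
  have bmT: "bounded_meas M T1" "bounded_meas M T2" "bounded_meas M T3"
    unfolding T1_def[abs_def] T2_def[abs_def] T3_def[abs_def]
    by (intro bounded_meas_intros bmg bmD bmkpre; assumption)+
  have T12: "\<bar>T1 \<omega> + T2 \<omega>\<bar> \<le> (\<delta> + \<epsilon>) * (\<Sum>y\<in>S k. \<bar>D y \<omega>\<bar>)" if \<omega>: "\<omega> \<in> space M" for \<omega>
  proof -
    have "\<bar>T1 \<omega>\<bar> \<le> (\<Sum>y\<in>S k. \<Sum>u\<in>SU. \<bar>D y \<omega>\<bar> * kpre u \<omega> * \<delta>)"
      unfolding T1_def
    proof (intro order_trans[OF sum_abs] sum_mono)
      fix y u assume y: "y \<in> S k" and u: "u \<in> SU"
      have "\<bar>g u (W \<omega>) y - g u (c \<omega>) (R m k y)\<bar> \<le> \<delta>"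
        unfolding g_def
      proof (rule f(3)[OF glue[OF u WS[OF \<omega>] y] glue[OF u cells_SW[OF cW[OF \<omega>]] R_in[OF m_J y]]])
        fix i assume "i \<in> {1..k}"
        show "R m i (if i = k then y else if i \<in> pa G k then W \<omega> i else u i)
          = R m i (if i = k then R m k y else if i \<in> pa G k then c \<omega> i else u i)"
          using m_J by (auto simp: R_R c_def cp_def)
      qed
      then show "\<bar>D y \<omega> * kpre u \<omega> * (g u (W \<omega>) y - g u (c \<omega>) (R m k y))\<bar> \<le> \<bar>D y \<omega>\<bar> * kpre u \<omega> * \<delta>"
        using kpre(2)[OF \<omega>] u by (auto simp: abs_mult SU_def intro!: mult_left_mono mult_nonneg_nonneg)
    qed
    also have "\<dots> = (\<Sum>y\<in>S k. \<bar>D y \<omega>\<bar>) * (\<Sum>u\<in>SU. kpre u \<omega>) * \<delta>"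
      unfolding sum_product by (simp only: sum_distrib_right)
    finally have 1: "\<bar>T1 \<omega>\<bar> \<le> (\<Sum>y\<in>S k. \<bar>D y \<omega>\<bar>) * \<delta>" using kpre1[OF \<omega>] by simp
    have "\<bar>T2 \<omega>\<bar> \<le> (\<Sum>y\<in>S k. \<Sum>u\<in>SU. \<bar>D y \<omega>\<bar> * \<bar>kpre u \<omega> - kpre_ref (c \<omega>) u\<bar>)"
      unfolding T2_def
    proof (intro order_trans[OF sum_abs] sum_mono)
      fix y u assume y: "y \<in> S k" and u: "u \<in> SU"
      have "\<bar>g u (c \<omega>) (R m k y)\<bar> \<le> 1"
        unfolding g_def by (intro f(1) glue u cells_SW cW \<omega> R_in m_J y)
      then show "\<bar>D y \<omega> * (kpre u \<omega> - kpre_ref (c \<omega>) u) * g u (c \<omega>) (R m k y)\<bar> \<le> \<bar>D y \<omega>\<bar> * \<bar>kpre u \<omega> - kpre_ref (c \<omega>) u\<bar>"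
        unfolding abs_mult by (intro mult_left_le) auto
    qed
    also have "\<dots> = (\<Sum>y\<in>S k. \<bar>D y \<omega>\<bar>) * (\<Sum>u\<in>SU. \<bar>kpre u \<omega> - kpre_ref (c \<omega>) u\<bar>)"
      by (simp add: sum_product)
    also have "\<dots> \<le> (\<Sum>y\<in>S k. \<bar>D y \<omega>\<bar>) * \<epsilon>"
      using kpre_ref[OF \<omega>] by (intro mult_left_mono) (auto simp: SU_def c_def sum_nonneg)
    finally show ?thesis using 1 by (simp add: algebra_simps abs_le_iff)
  qed
  have "E p f - E p (net_step S (ker qc qf) k f) = (\<integral>\<omega>. (T1 \<omega> + T2 \<omega>) + T3 \<omega> \<partial>M)"
  proof -
    have "E p f - E p (net_step S (ker qc qf) k f)
      = (\<integral>\<omega>. (\<Sum>y\<in>S k. \<Sum>u\<in>SU. kap y \<omega> * kpre u \<omega> * g u (W \<omega>) y) - (\<Sum>y\<in>S k. \<Sum>u\<in>SU. q (c \<omega>) y * kpre u \<omega> * g u (W \<omega>) y) \<partial>M)"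
      unfolding f_g sf_g using kap(1)
      by (intro Bochner_Integration.integral_diff[symmetric] bounded_meas_integrable bounded_meas_intros bmg bmkpre) auto
    also have "\<dots> = (\<integral>\<omega>. (T1 \<omega> + T2 \<omega>) + T3 \<omega> \<partial>M)"
      unfolding T1_def T2_def T3_def D_def
      by (intro Bochner_Integration.integral_cong refl)
        (simp only: sum_distrib_right sum.distrib[symmetric] sum_subtractf[symmetric], simp add: algebra_simps)
    finally show ?thesis .
  qed
  also have "\<dots> = (\<integral>\<omega>. T1 \<omega> + T2 \<omega> \<partial>M)"
  proof (subst Bochner_Integration.integral_add)
    have "(\<integral>\<omega>. T3 \<omega> \<partial>M) = 0"
      using zero[of "\<lambda>cc v. \<Sum>u\<in>SU. kpre_ref cc u * g u cc v"] by (simp only: T3_def)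
    then show "(\<integral>\<omega>. T1 \<omega> + T2 \<omega> \<partial>M) + (\<integral>\<omega>. T3 \<omega> \<partial>M) = (\<integral>\<omega>. T1 \<omega> + T2 \<omega> \<partial>M)" by simp
  qed (intro bounded_meas_integrable bounded_meas_add bmT)+
  finally have eq: "E p f - E p (net_step S (ker qc qf) k f) = (\<integral>\<omega>. T1 \<omega> + T2 \<omega> \<partial>M)" .
  have "\<bar>\<integral>\<omega>. T1 \<omega> + T2 \<omega> \<partial>M\<bar> \<le> (\<integral>\<omega>. \<bar>T1 \<omega> + T2 \<omega>\<bar> \<partial>M)" by (rule integral_abs_bound)
  also have "\<dots> \<le> (\<integral>\<omega>. (\<delta> + \<epsilon>) * (\<Sum>y\<in>S k. \<bar>D y \<omega>\<bar>) \<partial>M)"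
    by (intro integral_mono bounded_meas_integrable T12 bounded_meas_intros bmT bmD)
  also have "\<dots> = (\<delta> + \<epsilon>) * (\<integral>\<omega>. (\<Sum>y\<in>S k. \<bar>D y \<omega>\<bar>) \<partial>M)" by simp
  also have "\<dots> \<le> (\<delta> + \<epsilon>) * (4 * \<epsilon>)" using A nn by (intro mult_left_mono) auto
  finally show ?thesis unfolding eq by (simp add: mult_ac)
qed

text \<open>Telescoping with \<open>p\<close> itself upstream: the nodes before \<open>k\<close>
  have their true joint law, so each increment is of the form treated in
  \<open>bias_step\<close>.\<close>

lemma net_bias:
  assumes q: "stoch qc qf" and p: "(\<Sum>x\<in>\<Omega>. p x) = 1"
    and F: "\<And>z z'. grid_pt S (Suc K) z \<Longrightarrow> grid_pt S (Suc K) z' \<Longrightarrow> (\<And>i. i \<in> {1..K} \<Longrightarrow> z i = z' i) \<Longrightarrow> F z = F z'"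
      "\<And>z. grid_pt S (Suc K) z \<Longrightarrow> \<bar>F z\<bar> \<le> 1"
    and b: "\<And>k. k \<in> {1..K} \<Longrightarrow> \<bar>E p (net S (ker qc qf) [Suc k..<Suc K] F)
        - E p (net_step S (ker qc qf) k (net S (ker qc qf) [Suc k..<Suc K] F))\<bar> \<le> b"
  shows "\<bar>E p F - net S (ker qc qf) [1..<Suc K] F x0\<bar> \<le> real K * b"
proof -
  let ?q = "ker qc qf"
  note st = ker_stochastic[OF q]
  define T where "T k = E p (net S ?q [k..<Suc K] F)" for k
  have step: "\<bar>T (Suc k) - T k\<bar> \<le> b" if k: "k \<in> {1..K}" for k
    unfolding T_def using b[OF k] k by (subst (2) net_upt_rec) auto
  \<comment> \<open>Once all nodes are redrawn the starting point is irrelevant; this is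
    \<open>net_lipschitz\<close> with equality as the relation and modulus zero.\<close>
  have const: "net S ?q [1..<Suc K] F x = net S ?q [1..<Suc K] F x0" for x
  proof -
    have "\<bar>net S ?q [1..<Suc K] F x - net S ?q [1..<Suc K] F x0\<bar> \<le> (1 + 0 * real (Suc K - 1)) * 0"
    proof (rule net_lipschitz[OF st, where A="\<lambda>i u v. u = v"])
      fix k and z z' :: "nat \<Rightarrow> 'b" assume k: "k \<in> {1..K}" and zz: "\<And>i. i \<in> {1..<k} \<Longrightarrow> z i = z' i"
      have "cp k z = cp k z'" using zz pa_less(3)[of k] by (auto simp: cp_def fun_eq_iff)
      then show "(\<Sum>y\<in>S k. \<bar>?q k z y - ?q k z' y\<bar>) \<le> 0 * 0" by (simp add: ker_def)
    next
      fix z z' :: "nat \<Rightarrow> 'b"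
      assume "grid_pt S (Suc K) z" "grid_pt S (Suc K) z'" "\<And>i. i \<in> {1..K} \<Longrightarrow> z i = z' i"
      then have "F z = F z'" by (rule F(1))
      then show "\<bar>F z - F z'\<bar> \<le> 0" by simp
    qed (use F(2) in \<open>auto simp: grid_pt_def\<close>)
    then show ?thesis by simp
  qed
  have T1: "T 1 = net S ?q [1..<Suc K] F x0"
  proof -
    have "T 1 = E p (\<lambda>_. net S ?q [1..<Suc K] F x0)"
      unfolding T_def by (rule E_cong) (rule const)
    then show ?thesis using p by (simp add: E_def sum_distrib_right[symmetric] del: upt_Suc)
  qed
  have eq: "T (Suc K) - T 1 = (\<Sum>k=1..K. T (Suc k) - T k)"
    by (simp add: sum_Suc_diff)
  have "\<bar>T (Suc K) - T 1\<bar> \<le> (\<Sum>k=1..K. \<bar>T (Suc k) - T k\<bar>)" unfolding eq by (rule sum_abs)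
  also have "\<dots> \<le> (\<Sum>k=1..K. b)" using step by (intro sum_mono) auto
  finally show ?thesis unfolding T1 by (simp add: T_def del: upt_Suc)
qed

end

section \<open>Dyadic rounding\<close>

definition dyad :: "(nat \<Rightarrow> nat) \<Rightarrow> nat \<Rightarrow> nat \<Rightarrow> (nat \<Rightarrow> real) \<Rightarrow> nat \<Rightarrow> real" where
  "dyad d j k y = (\<lambda>i\<in>{..<d k}. of_int \<lfloor>2^j * y i\<rfloor> / 2^j)"

text \<open>Rounding down fixes the endpoint 1, so it is a grid point of its own and each axis has
  \<open>2^j + 1\<close> points, estimated by \<open>2^(j + 1)\<close> in
  \<open>card_dgrid\<close>.\<close>

definition dgrid :: "(nat \<Rightarrow> nat) \<Rightarrow> nat \<Rightarrow> nat \<Rightarrow> (nat \<Rightarrow> real) set" where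
  "dgrid d j k = PiE {..<d k} (\<lambda>_. (\<lambda>a. real a / 2^j) ` {0..2^j})"

lemma finite_dgrid: "finite (dgrid d j k)"
  unfolding dgrid_def by (intro finite_PiE) auto

lemma dgrid_nonempty: "dgrid d j k \<noteq> {}"
  unfolding dgrid_def by (simp add: PiE_eq_empty_iff)

lemma card_dgrid: "card (dgrid d j k) \<le> 2 ^ ((j + 1) * d k)"
proof -
  have "card ((\<lambda>a. real a / 2^j) ` {0..2^j::nat}) \<le> card {0..2^j::nat}" by (rule card_image_le) simp
  also have "\<dots> = 2^j + 1" by simp
  also have "\<dots> \<le> (2::nat)^(j + 1)" by simp
  finally have "card ((\<lambda>a. real a / 2^j) ` {0..2^j::nat}) ^ d k \<le> (2^(j + 1)) ^ d k"
    by (rule power_mono) simp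
  then show ?thesis
    by (simp only: dgrid_def card_PiE[OF finite_lessThan] prod_constant card_lessThan power_mult)
qed

lemma dgrid_unit: "y \<in> dgrid d j k \<Longrightarrow> y \<in> PiE {..<d k} (\<lambda>_. {0..1})"
proof -
  have "(\<lambda>a. real a / 2^j) ` {0..2^j} \<subseteq> {0..1}" by (auto simp: field_simps)
  then show "y \<in> dgrid d j k \<Longrightarrow> ?thesis" unfolding dgrid_def by (auto simp: PiE_def Pi_def)
qed

lemma dyad_in_dgrid:
  assumes "y \<in> PiE {..<d k} (\<lambda>_. {0..1})"
  shows "dyad d j k y \<in> dgrid d j k"
  unfolding dyad_def dgrid_def
proof (intro restrict_PiE_iff[THEN iffD2] ballI)
  fix i assume "i \<in> {..<d k}"
  then have y: "0 \<le> y i" "y i \<le> 1" using assms by (auto simp: PiE_def Pi_def)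
  then have "0 \<le> \<lfloor>2^j * y i\<rfloor>" by simp
  moreover have "(2::real)^j * y i \<le> 2^j * 1" using y by (intro mult_left_mono) auto
  then have "\<lfloor>(2::real)^j * y i\<rfloor> \<le> \<lfloor>of_int (2^j) :: real\<rfloor>" by (intro floor_mono) simp
  then have "\<lfloor>(2::real)^j * y i\<rfloor> \<le> 2^j" by (simp only: floor_of_int)
  ultimately have "real (nat \<lfloor>2^j * y i\<rfloor>) = of_int \<lfloor>2^j * y i\<rfloor>" "nat \<lfloor>2^j * y i\<rfloor> \<in> {0..2^j}"
    by (auto simp: nat_le_iff)
  then show "of_int \<lfloor>2^j * y i\<rfloor> / 2^j \<in> (\<lambda>a. real a / 2^j) ` {0..2^j}"
    by (metis imageI)
qed

text \<open>With \<open>N = 2^(i - j)\<close> both sides are the integer quotient of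
  \<open>\<lfloor>2^i * y\<rfloor>\<close> by \<open>N\<close>: taking a floor before dividing by an
  integer does not change the floor of the quotient. This is the nesting of the dyadic
  cells.\<close>

lemma floor_dyadic:
  fixes y :: real
  assumes "j \<le> i"
  shows "\<lfloor>2^j * (of_int \<lfloor>2^i * y\<rfloor> / 2^i :: real)\<rfloor> = \<lfloor>2^j * y\<rfloor>"
proof -
  define N :: int where "N = 2^(i - j)"
  have N: "N > 0" by (simp add: N_def)
  have e: "(2::real)^i = 2^j * of_int N" using assms by (simp add: N_def power_add[symmetric])
  have "\<lfloor>2^j * (of_int \<lfloor>2^i * y\<rfloor> / 2^i :: real)\<rfloor> = \<lfloor>of_int \<lfloor>2^i * y\<rfloor> / (of_int N :: real)\<rfloor>"
    unfolding e by simp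
  also have "\<dots> = \<lfloor>2^i * y\<rfloor> div N" by (rule floor_divide_of_int_eq)
  also have "\<dots> = \<lfloor>(2^i * y) / of_int N\<rfloor>" using N by (simp add: floor_divide_real_eq_div)
  also have "(2^i * y) / of_int N = 2^j * y" using N unfolding e by simp
  finally show ?thesis .
qed

lemma dyad_dyad:
  assumes "j \<le> i"
  shows "dyad d j k (dyad d i k y) = dyad d j k y"
proof
  fix l
  show "dyad d j k (dyad d i k y) l = dyad d j k y l"
  proof (cases "l < d k")
    case True
    then have "dyad d i k y l = of_int \<lfloor>2^i * y l\<rfloor> / 2^i" by (simp add: dyad_def)
    then show ?thesis using True floor_dyadic[OF assms, of "y l"] by (simp add: dyad_def)
  qed (simp add: dyad_def)
qed

lemma dyad_dgrid: "y \<in> dgrid d j k \<Longrightarrow> dyad d j k y = y"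
proof
  fix l assume y: "y \<in> dgrid d j k"
  show "dyad d j k y l = y l"
  proof (cases "l < d k")
    case True
    then obtain a :: nat where "y l = real a / 2^j" using y by (auto simp: dgrid_def PiE_def Pi_def)
    then show ?thesis using True by (simp add: dyad_def)
  next
    case False
    then show ?thesis using y by (auto simp: dyad_def dgrid_def PiE_def extensional_def)
  qed
qed

lemma dgrid_mono: "j \<le> i \<Longrightarrow> dgrid d j k \<subseteq> dgrid d i k"
proof -
  assume ji: "j \<le> i"
  have "(\<lambda>a. real a / 2^j) ` {0..2^j} \<subseteq> (\<lambda>a. real a / 2^i) ` {0..2^i}"
  proof
    fix z assume "z \<in> (\<lambda>a. real a / 2^j) ` {0..2^j}"
    then obtain a where a: "a \<le> 2^j" "z = real a / 2^j" by auto
    have e: "(2::nat)^i = 2^j * 2^(i - j)" using ji by (simp add: power_add[symmetric])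
    have "z = real (a * 2^(i - j)) / 2^i"
    proof -
      have "(2::real)^i = 2^j * 2^(i - j)" using ji by (simp add: power_add[symmetric])
      then show ?thesis using a by (simp add: field_simps)
    qed
    moreover have "a * 2^(i - j) \<le> 2^i" unfolding e using a(1) by simp
    ultimately show "z \<in> (\<lambda>a. real a / 2^i) ` {0..2^i}"
      by (intro image_eqI[of _ _ "a * 2^(i - j)"]) auto
  qed
  then show ?thesis unfolding dgrid_def by (intro PiE_mono) auto
qed

lemma dyad_in_dgrid_fine: "y \<in> PiE {..<d k} (\<lambda>_. {0..1}) \<Longrightarrow> j \<le> i \<Longrightarrow> dyad d j k y \<in> dgrid d i k"
  using dyad_in_dgrid dgrid_mono by blast

lemma dyad_close:
  assumes "dyad d j k y = dyad d j k y'" "i < d k"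
  shows "\<bar>y i - y' i\<bar> \<le> (1/2)^j"
proof -
  have "dyad d j k y i = dyad d j k y' i" using assms(1) by simp
  then have "\<lfloor>2^j * y i\<rfloor> = \<lfloor>2^j * y' i\<rfloor>" using assms(2) by (simp add: dyad_def)
  then have "\<bar>2^j * y i - 2^j * y' i\<bar> \<le> 1" by linarith
  then have "2^j * \<bar>y i - y' i\<bar> \<le> 1" by (simp add: right_diff_distrib[symmetric] abs_mult)
  then show ?thesis by (simp add: field_simps power_divide)
qed

lemma sup_dist_le:
  assumes "finite I" "I \<noteq> {}" "\<And>k. k \<in> I \<Longrightarrow> 1 \<le> d k"
    and "\<And>k i. k \<in> I \<Longrightarrow> i < d k \<Longrightarrow> \<bar>x k i - y k i\<bar> \<le> b"
  shows "sup_dist d I x y \<le> b"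
proof -
  obtain k where k: "k \<in> I" using assms(2) by auto
  then have "(k, 0) \<in> (SIGMA k:I. {..<d k})" using assms(3)[OF k] by auto
  then have "(SIGMA k:I. {..<d k}) \<noteq> {}" by blast
  then show ?thesis unfolding sup_dist_def using assms by (subst Max_le_iff) auto
qed

lemma sup_dist_ge:
  assumes "finite I" "k \<in> I" "i < d k"
  shows "\<bar>x k i - y k i\<bar> \<le> sup_dist d I x y"
  unfolding sup_dist_def using assms by (intro Max_ge) (auto intro!: image_eqI[of _ _ "(k, i)"])

lemma sup_dist_triangle:
  assumes I: "finite I" "I \<noteq> {}" "\<And>k. k \<in> I \<Longrightarrow> 1 \<le> d k"
  shows "sup_dist d I x z \<le> sup_dist d I x y + sup_dist d I y z"
proof (rule sup_dist_le[OF I])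
  fix k i assume k: "k \<in> I" and i: "i < d k"
  have "\<bar>x k i - z k i\<bar> \<le> \<bar>x k i - y k i\<bar> + \<bar>y k i - z k i\<bar>" by simp
  also have "\<dots> \<le> sup_dist d I x y + sup_dist d I y z"
    using I(1) k i by (intro add_mono sup_dist_ge)
  finally show "\<bar>x k i - z k i\<bar> \<le> sup_dist d I x y + sup_dist d I y z" .
qed

lemma sup_dist_nonneg:
  assumes "finite I" "I \<noteq> {}" "\<And>k. k \<in> I \<Longrightarrow> 1 \<le> d k"
  shows "0 \<le> sup_dist d I x y"
proof -
  obtain k where "k \<in> I" using assms(2) by auto
  then show ?thesis using sup_dist_ge[OF assms(1), of k 0 d x y] assms(3)[of k] by fastforce
qed

lemma sup_dist_dyad_le:
  assumes "finite I" "I \<noteq> {}" "\<And>k. k \<in> I \<Longrightarrow> 1 \<le> d k"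
    and "\<And>k. k \<in> I \<Longrightarrow> dyad d j k (x k) = dyad d j k (y k)"
  shows "sup_dist d I x y \<le> (1/2)^j"
  using assms dyad_close by (intro sup_dist_le) blast+

lemma clique_net_dyad:
  assumes "sorted_dag K G" "\<forall>k\<in>{1..K}. fully_connected G (pa G k)" "m \<le> J"
  shows "clique_net K G (dgrid d J) (dyad d) m J"
proof
  show "dyad d j k y \<in> dgrid d J k" if "j \<le> J" "y \<in> dgrid d J k" for j k y
    using dyad_in_dgrid_fine dgrid_unit that by blast
qed (use assms dyad_dgrid dyad_dyad finite_dgrid dgrid_nonempty in auto)

section \<open>Measure-theoretic facts about the cube\<close>

lemma space_cube: "space (cube d I) = PiE I (\<lambda>k. PiE {..<d k} (\<lambda>_. {0..1}))"
  by (simp add: cube_def space_PiM)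

lemma measurable_restrict_cube:
  assumes "J \<subseteq> I"
  shows "(\<lambda>x. restrict x J) \<in> cube d I \<rightarrow>\<^sub>M cube d J"
  unfolding cube_def using assms by (rule measurable_restrict_subset)

lemma measurable_cube_coord:
  assumes "k \<in> I" "i < d k"
  shows "(\<lambda>x. x k i) \<in> borel_measurable (cube d I)"
proof -
  have 1: "(\<lambda>x. x k) \<in> cube d I \<rightarrow>\<^sub>M PiM {..<d k} (\<lambda>_. restrict_space borel {0..1::real})"
    unfolding cube_def using assms by (intro measurable_component_singleton)
  have 2: "(\<lambda>y. y i) \<in> PiM {..<d k} (\<lambda>_. restrict_space borel {0..1::real}) \<rightarrow>\<^sub>M restrict_space borel {0..1}"
    using assms by (intro measurable_component_singleton) auto
  have 3: "(\<lambda>z. z) \<in> restrict_space borel {0..1::real} \<rightarrow>\<^sub>M borel"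
    by (rule measurable_restrict_space1) simp
  show ?thesis using measurable_compose[OF measurable_compose[OF 1 2] 3] by simp
qed

lemma sets_dyad_cell:
  assumes "finite I"
  shows "{x \<in> space (cube d I). (\<lambda>k\<in>I. dyad d j k (x k)) = c} \<in> sets (cube d I)"
\<comment> \<open>Rounded points are extensional in both arguments. For any other \<open>c\<close>
  the cell is empty; for extensional \<open>c\<close> it is described by finitely many coordinate
  conditions.\<close>
proof (cases "\<forall>k\<in>I. c k \<in> extensional {..<d k}")
  case False
  then have "{x \<in> space (cube d I). (\<lambda>k\<in>I. dyad d j k (x k)) = c} = {}"
    by (auto simp: dyad_def)
  then show ?thesis by (simp only: sets.empty_sets)
next
  case True
  show ?thesis
  proof (cases "c \<in> extensional I")
    case False
    then have "{x \<in> space (cube d I). (\<lambda>k\<in>I. dyad d j k (x k)) = c} = {}" by auto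
    then show ?thesis by (simp only: sets.empty_sets)
  next
    case c: True
    have eq: "(\<lambda>k\<in>I. dyad d j k (x k)) = c \<longleftrightarrow> (\<forall>k\<in>I. \<forall>i\<in>{..<d k}. of_int \<lfloor>2^j * x k i\<rfloor> / 2^j = c k i)" for x
    proof
      assume "\<forall>k\<in>I. \<forall>i\<in>{..<d k}. of_int \<lfloor>2^j * x k i\<rfloor> / 2^j = c k i"
      then have "dyad d j k (x k) = c k" if "k \<in> I" for k
        using True that by (auto simp: dyad_def fun_eq_iff extensional_def)
      then show "(\<lambda>k\<in>I. dyad d j k (x k)) = c"
        using c by (auto simp: fun_eq_iff extensional_def)
    qed (auto simp: dyad_def)
    have "{x \<in> space (cube d I). \<forall>k\<in>I. \<forall>i\<in>{..<d k}. of_int \<lfloor>2^j * x k i\<rfloor> / 2^j = c k i} \<in> sets (cube d I)"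
    proof (intro sets.sets_Collect_finite_All assms finite_lessThan)
      fix k i assume "k \<in> I" "i \<in> {..<d k}"
      then have [measurable]: "(\<lambda>x. x k i) \<in> borel_measurable (cube d I)"
        by (intro measurable_cube_coord) auto
      show "{x \<in> space (cube d I). of_int \<lfloor>2^j * x k i\<rfloor> / 2^j = c k i} \<in> sets (cube d I)"
        by measurable
    qed
    then show ?thesis unfolding eq .
  qed
qed

lemma sets_singleton_cube:
  assumes "finite I" "x \<in> space (cube d I)"
  shows "{x} \<in> sets (cube d I)"
proof -
  have "{x} = PiE I (\<lambda>k. {x k})"
    using assms by (intro PiE_singleton[symmetric]) (simp add: space_cube PiE_def)
  moreover have "{x k} \<in> sets (PiM {..<d k} (\<lambda>_. restrict_space borel {0..1::real}))" if "k \<in> I" for k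
  proof -
    have xk: "x k \<in> PiE {..<d k} (\<lambda>_. {0..1})" using assms(2) that by (auto simp: space_cube)
    then have "{x k} = PiE {..<d k} (\<lambda>i. {x k i})"
      by (intro PiE_singleton[symmetric]) (simp only: PiE_def Int_iff)
    moreover have "{x k i} \<in> sets (restrict_space borel {0..1::real})" if "i \<in> {..<d k}" for i
      using xk that by (auto simp: sets_restrict_space PiE_def Pi_def image_iff intro!: bexI[of _ "{x k i}"])
    then have "PiE {..<d k} (\<lambda>i. {x k i}) \<in> sets (PiM {..<d k} (\<lambda>_. restrict_space borel {0..1::real}))"
      by (intro sets_PiM_I_finite) auto
    ultimately show ?thesis by simp
  qed
  ultimately show ?thesis unfolding cube_def using assms(1) by (simp add: sets_PiM_I_finite)
qed

text \<open>The test function is half the sign of the difference on each \<open>B s\<close>; the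
  bound 1/2 on test functions in \<open>tv_dist\<close> is the source of the factor 2.\<close>

lemma tv_dist_sum_le:
  assumes M: "prob_space M" and N: "prob_space N" "sets N = sets M"
    and T: "finite T" "\<And>s. s \<in> T \<Longrightarrow> B s \<in> sets M" "disjoint_family_on B T"
  shows "(\<Sum>s\<in>T. \<bar>measure M (B s) - measure N (B s)\<bar>) \<le> 2 * tv_dist M N"
proof -
  interpret M: prob_space M by fact
  interpret N: prob_space N by fact
  let ?F = "{f \<in> borel_measurable M. \<forall>x\<in>space M. \<bar>f x\<bar> \<le> 1/2} :: ('a \<Rightarrow> real) set"
  have spN: "space N = space M" using N(2) by (rule sets_eq_imp_space_eq)
  have int: "integrable M f" "integrable N f" "\<bar>integral\<^sup>L M f\<bar> \<le> 1/2" "\<bar>integral\<^sup>L N f\<bar> \<le> 1/2" if f: "f \<in> ?F" for f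
  proof -
    have fN: "f \<in> borel_measurable N" using f measurable_cong_sets[OF N(2) refl] by blast
    show iM: "integrable M f" using f by (intro M.integrable_const_bound[of _ "1/2"]) (auto intro!: AE_I2)
    show iN: "integrable N f" using f fN by (intro N.integrable_const_bound[of _ "1/2"]) (auto intro!: AE_I2 simp: spN)
    have "\<bar>integral\<^sup>L M f\<bar> \<le> (\<integral>x. \<bar>f x\<bar> \<partial>M)" by (rule integral_abs_bound)
    also have "\<dots> \<le> (\<integral>x. 1/2 \<partial>M)" using f iM by (intro integral_mono) auto
    finally show "\<bar>integral\<^sup>L M f\<bar> \<le> 1/2" by (simp add: M.prob_space)
    have "\<bar>integral\<^sup>L N f\<bar> \<le> (\<integral>x. \<bar>f x\<bar> \<partial>N)" by (rule integral_abs_bound)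
    also have "\<dots> \<le> (\<integral>x. 1/2 \<partial>N)" using f iN by (intro integral_mono) (auto simp: spN)
    finally show "\<bar>integral\<^sup>L N f\<bar> \<le> 1/2" by (simp add: N.prob_space)
  qed
  \<comment> \<open>The supremum in \<open>tv_dist\<close> is taken in the reals and bounds its
    members only if the family is bounded above.\<close>
  have bdd: "bdd_above ((\<lambda>f. integral\<^sup>L M f - integral\<^sup>L N f) ` ?F)"
  proof (rule bdd_aboveI2)
    fix f assume "f \<in> ?F"
    from int(3,4)[OF this] show "integral\<^sup>L M f - integral\<^sup>L N f \<le> 1" by linarith
  qed
  define f where "f x = (\<Sum>s\<in>T. sgn (measure M (B s) - measure N (B s)) / 2 * indicator (B s) x)" for x
  have "f \<in> ?F"
  proof (intro CollectI conjI ballI)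
    show "f \<in> borel_measurable M" unfolding f_def using T(2) by measurable
    fix x assume "x \<in> space M"
    have "\<bar>f x\<bar> \<le> (\<Sum>s\<in>T. 1/2 * indicator (B s) x)"
      unfolding f_def by (intro order_trans[OF sum_abs] sum_mono) (auto simp: abs_mult sgn_real_def indicator_def)
    also have "\<dots> = 1/2 * indicator (\<Union>s\<in>T. B s) x"
      by (simp add: indicator_UN_disjoint[OF T(1,3)] sum_distrib_left)
    also have "\<dots> \<le> 1/2" by (simp add: indicator_def)
    finally show "\<bar>f x\<bar> \<le> 1/2" .
  qed
  then have "integral\<^sup>L M f - integral\<^sup>L N f \<le> tv_dist M N"
    unfolding tv_dist_def by (intro cSUP_upper bdd)
  moreover have "integral\<^sup>L M f = (\<Sum>s\<in>T. sgn (measure M (B s) - measure N (B s)) / 2 * measure M (B s))"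
  proof -
    have "integrable M (\<lambda>x. sgn (measure M (B s) - measure N (B s)) / 2 * indicator (B s) x)" if "s \<in> T" for s
      using T(2)[OF that] by (intro integrable_mult_right integrable_real_indicator) (auto simp: M.emeasure_eq_measure)
    then have "integral\<^sup>L M f = (\<Sum>s\<in>T. \<integral>x. sgn (measure M (B s) - measure N (B s)) / 2 * indicator (B s) x \<partial>M)"
      unfolding f_def by (rule Bochner_Integration.integral_sum)
    then show ?thesis using T(2) by (simp add: sets.Int_space_eq2)
  qed
  moreover have "integral\<^sup>L N f = (\<Sum>s\<in>T. sgn (measure M (B s) - measure N (B s)) / 2 * measure N (B s))"
  proof -
    have "integrable N (\<lambda>x. sgn (measure M (B s) - measure N (B s)) / 2 * indicator (B s) x)" if "s \<in> T" for s
      using T(2)[OF that] N(2) by (intro integrable_mult_right integrable_real_indicator) (auto simp: N.emeasure_eq_measure)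
    then have "integral\<^sup>L N f = (\<Sum>s\<in>T. \<integral>x. sgn (measure M (B s) - measure N (B s)) / 2 * indicator (B s) x \<partial>N)"
      unfolding f_def by (rule Bochner_Integration.integral_sum)
    then show ?thesis using T(2) N(2) by (simp add: sets.Int_space_eq2)
  qed
  moreover have "(\<Sum>s\<in>T. sgn (measure M (B s) - measure N (B s)) / 2 * measure M (B s))
     - (\<Sum>s\<in>T. sgn (measure M (B s) - measure N (B s)) / 2 * measure N (B s))
     = (\<Sum>s\<in>T. \<bar>measure M (B s) - measure N (B s)\<bar> / 2)"
    unfolding sum_subtractf[symmetric]
    by (intro sum.cong refl) (simp add: abs_sgn algebra_simps add_divide_distrib diff_divide_distrib)
  ultimately show ?thesis by (simp add: sum_divide_distrib[symmetric])
qed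

lemma restrict_to_empty: "restrict x {} = (\<lambda>_. undefined)"
  by (simp add: restrict_def)

lemma tv_dist_self: "tv_dist M M \<le> 0"
proof -
  let ?F = "{f \<in> borel_measurable M. \<forall>x\<in>space M. \<bar>f x\<bar> \<le> 1/2} :: ('a \<Rightarrow> real) set"
  have "(\<lambda>_. 0) \<in> ?F" by auto
  then have "?F \<noteq> {}" by blast
  then show ?thesis unfolding tv_dist_def by (intro cSUP_least) auto
qed

text \<open>Puts nodes without parents and empty \<open>pre\<close> sets on the same footing as all
  others. Where the condition is void a constant kernel is a version: the marginal law for
  \<open>I = {}\<close>, the unit mass on the one-point space for \<open>J = {}\<close>.\<close>

lemma lipschitz_kernel:
  assumes \<mu>: "\<mu> \<in> space (prob_algebra (cube d {1..K}))"
    and I: "I \<subseteq> {1..K}" "J \<subseteq> {1..K}" "\<And>k. k \<in> I \<Longrightarrow> 1 \<le> d k"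
    and L: "0 \<le> L" "I \<noteq> {} \<Longrightarrow> J \<noteq> {} \<Longrightarrow> tv_lipschitz_cond d L \<mu> I J"
  obtains \<kappa> where "regular_cond_distr d \<mu> I J \<kappa>"
    "\<And>j x y. x \<in> space (cube d I) \<Longrightarrow> y \<in> space (cube d I) \<Longrightarrow>
      (\<And>k. k \<in> I \<Longrightarrow> dyad d j k (x k) = dyad d j k (y k)) \<Longrightarrow> tv_dist (\<kappa> x) (\<kappa> y) \<le> L * (1/2)^j"
proof -
  have fin: "finite I" using I(1) finite_subset by blast
  interpret prob_space \<mu> using \<mu> by (simp add: space_prob_algebra)
  have s\<mu>: "sets \<mu> = sets (cube d {1..K})" using \<mu> by (simp add: space_prob_algebra)
  have rI: "(\<lambda>x. restrict x I) \<in> \<mu> \<rightarrow>\<^sub>M cube d I" and rJ: "(\<lambda>x. restrict x J) \<in> \<mu> \<rightarrow>\<^sub>M cube d J"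
    unfolding measurable_cong_sets[OF s\<mu> refl] by (intro measurable_restrict_cube I)+
  have u: "(\<lambda>_. undefined) \<in> space (cube d {})" by (simp add: space_cube)
  consider "I \<noteq> {}" "J \<noteq> {}" | "I = {}" | "I \<noteq> {}" "J = {}" by blast
  then show ?thesis
  proof cases
    case 1
    then obtain \<kappa> where \<kappa>: "regular_cond_distr d \<mu> I J \<kappa>"
      "\<And>x y. x \<in> space (cube d I) \<Longrightarrow> y \<in> space (cube d I) \<Longrightarrow> tv_dist (\<kappa> x) (\<kappa> y) \<le> L * sup_dist d I x y"
      using L(2) by (auto simp: tv_lipschitz_cond_def)
    show ?thesis
    proof (rule that[OF \<kappa>(1)])
      fix j x y assume xy: "x \<in> space (cube d I)" "y \<in> space (cube d I)"
        and eq: "\<And>k. k \<in> I \<Longrightarrow> dyad d j k (x k) = dyad d j k (y k)"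
      have "sup_dist d I x y \<le> (1/2)^j"
        using sup_dist_dyad_le[OF fin 1(1) I(3) eq] by blast
      then show "tv_dist (\<kappa> x) (\<kappa> y) \<le> L * (1/2)^j"
        using \<kappa>(2)[OF xy] mult_left_mono[OF _ L(1)] by fastforce
    qed
  next
    case 2
    define \<nu> where "\<nu> = distr \<mu> (cube d J) (\<lambda>x. restrict x J)"
    have \<nu>: "\<nu> \<in> space (prob_algebra (cube d J))"
      unfolding \<nu>_def using rJ by (auto simp: space_prob_algebra prob_space_distr)
    have "regular_cond_distr d \<mu> I J (\<lambda>_. \<nu>)"
      unfolding regular_cond_distr_def
    proof (intro conjI ballI)
      show "(\<lambda>_. \<nu>) \<in> cube d I \<rightarrow>\<^sub>M prob_algebra (cube d J)" using \<nu> by simp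
      fix A B assume A: "A \<in> sets (cube d I)" and B: "B \<in> sets (cube d J)"
      have "A \<subseteq> {\<lambda>_. undefined}" using sets.sets_into_space[OF A] 2 by (simp add: space_cube)
      then consider "A = {}" | "A = {\<lambda>_. undefined}" by blast
      then have "emeasure \<mu> {x \<in> space \<mu>. restrict x I \<in> A \<and> restrict x J \<in> B}
        = emeasure \<nu> B * emeasure (distr \<mu> (cube d I) (\<lambda>x. restrict x I)) A"
      proof cases
        case 2
        have "emeasure (distr \<mu> (cube d I) (\<lambda>x. restrict x I)) A = 1"
          using A rI 2 \<open>I = {}\<close> by (simp add: emeasure_distr restrict_to_empty emeasure_space_1)
        moreover have "emeasure \<nu> B = emeasure \<mu> {x \<in> space \<mu>. restrict x I \<in> A \<and> restrict x J \<in> B}"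
          unfolding \<nu>_def using B rJ 2 \<open>I = {}\<close>
          by (auto simp: emeasure_distr restrict_to_empty intro!: arg_cong[where f="emeasure \<mu>"])
        ultimately show ?thesis by simp
      qed simp
      also have "\<dots> = (\<integral>\<^sup>+y\<in>A. emeasure \<nu> B \<partial>distr \<mu> (cube d I) (\<lambda>x. restrict x I))"
        using A by (simp add: nn_integral_cmult_indicator)
      finally show "emeasure \<mu> {x \<in> space \<mu>. restrict x I \<in> A \<and> restrict x J \<in> B}
        = (\<integral>\<^sup>+y\<in>A. emeasure \<nu> B \<partial>distr \<mu> (cube d I) (\<lambda>x. restrict x I))" .
    qed
    then show ?thesis
      using tv_dist_self[of \<nu>] L(1) by (intro that) (auto intro: order_trans)
  next
    case 3
    define \<nu> where "\<nu> = return (cube d {}) (\<lambda>_. undefined :: nat \<Rightarrow> real)"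
    have \<nu>: "\<nu> \<in> space (prob_algebra (cube d J))"
      unfolding \<nu>_def using u 3 by (auto simp: space_prob_algebra prob_space_return)
    have "regular_cond_distr d \<mu> I J (\<lambda>_. \<nu>)"
      unfolding regular_cond_distr_def
    proof (intro conjI ballI)
      show "(\<lambda>_. \<nu>) \<in> cube d I \<rightarrow>\<^sub>M prob_algebra (cube d J)" using \<nu> by simp
      fix A B assume A: "A \<in> sets (cube d I)" and B: "B \<in> sets (cube d J)"
      have "emeasure \<mu> {x \<in> space \<mu>. restrict x I \<in> A \<and> restrict x J \<in> B}
        = emeasure \<nu> B * emeasure (distr \<mu> (cube d I) (\<lambda>x. restrict x I)) A"
        using A B rI u 3
        by (auto simp: \<nu>_def emeasure_distr restrict_to_empty indicator_def intro!: arg_cong[where f="emeasure \<mu>"])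
      also have "\<dots> = (\<integral>\<^sup>+y\<in>A. emeasure \<nu> B \<partial>distr \<mu> (cube d I) (\<lambda>x. restrict x I))"
        using A by (simp add: nn_integral_cmult_indicator)
      finally show "emeasure \<mu> {x \<in> space \<mu>. restrict x I \<in> A \<and> restrict x J \<in> B}
        = (\<integral>\<^sup>+y\<in>A. emeasure \<nu> B \<partial>distr \<mu> (cube d I) (\<lambda>x. restrict x I))" .
    qed
    then show ?thesis
      using tv_dist_self[of \<nu>] L(1) by (intro that) (auto intro: order_trans)
  qed
qed

text \<open>Both sides integrate \<open>h\<close> against a measure on \<open>cube d I\<close>: the
  law of the \<open>I\<close>-coordinates on the event that the \<open>J\<close>-coordinates lie in
  \<open>B\<close>, and the law of the \<open>I\<close>-coordinates with density
  \<open>emeasure (\<kappa> y) B\<close>. The defining identity says that these measures agree on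
  all sets.\<close>

lemma rcd_integral:
  assumes \<mu>: "\<mu> \<in> space (prob_algebra (cube d {1..K}))" and IJ: "I \<subseteq> {1..K}" "J \<subseteq> {1..K}"
    and \<kappa>: "regular_cond_distr d \<mu> I J \<kappa>"
    and h: "h \<in> borel_measurable (cube d I)" and B: "B \<in> sets (cube d J)"
  shows "(\<integral>\<^sup>+x. h (restrict x I) * indicator B (restrict x J) \<partial>\<mu>)
    = (\<integral>\<^sup>+x. h (restrict x I) * emeasure (\<kappa> (restrict x I)) B \<partial>\<mu>)"
proof -
  have s\<mu>: "sets \<mu> = sets (cube d {1..K})" using \<mu> by (simp add: space_prob_algebra)
  have rI [measurable]: "(\<lambda>x. restrict x I) \<in> \<mu> \<rightarrow>\<^sub>M cube d I"
    and rJ [measurable]: "(\<lambda>x. restrict x J) \<in> \<mu> \<rightarrow>\<^sub>M cube d J"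
    unfolding measurable_cong_sets[OF s\<mu> refl] by (intro measurable_restrict_cube IJ)+
  have \<kappa>m: "\<kappa> \<in> cube d I \<rightarrow>\<^sub>M prob_algebra (cube d J)"
    and \<kappa>e: "\<And>A. A \<in> sets (cube d I) \<Longrightarrow>
      emeasure \<mu> {x \<in> space \<mu>. restrict x I \<in> A \<and> restrict x J \<in> B} =
      (\<integral>\<^sup>+y\<in>A. emeasure (\<kappa> y) B \<partial>distr \<mu> (cube d I) (\<lambda>x. restrict x I))"
    using \<kappa> B by (auto simp: regular_cond_distr_def)
  have \<kappa>B [measurable]: "(\<lambda>y. emeasure (\<kappa> y) B) \<in> borel_measurable (cube d I)"
    using measurable_emeasure_kernel[OF measurable_prob_algebraD[OF \<kappa>m] B] .
  have iB [measurable]: "(\<lambda>x. indicator B (restrict x J) :: ennreal) \<in> borel_measurable \<mu>"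
    by (rule measurable_compose[OF rJ borel_measurable_indicator[OF B]])
  note h [measurable]
  define N1 where "N1 = distr (density \<mu> (\<lambda>x. indicator B (restrict x J))) (cube d I) (\<lambda>x. restrict x I)"
  define N2 where "N2 = density (distr \<mu> (cube d I) (\<lambda>x. restrict x I)) (\<lambda>y. emeasure (\<kappa> y) B)"
  have "N1 = N2"
  proof (rule measure_eqI)
    show "sets N1 = sets N2" by (simp add: N1_def N2_def)
    fix A assume "A \<in> sets N1"
    then have A [measurable]: "A \<in> sets (cube d I)" by (simp add: N1_def)
    have pre: "(\<lambda>x. restrict x I) -` A \<inter> space \<mu> \<in> sets \<mu>" using rI A by (rule measurable_sets)
    have "emeasure N1 A = emeasure (density \<mu> (\<lambda>x. indicator B (restrict x J))) ((\<lambda>x. restrict x I) -` A \<inter> space \<mu>)"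
      unfolding N1_def using A by (subst emeasure_distr) auto
    also have "\<dots> = (\<integral>\<^sup>+x. indicator B (restrict x J) * indicator ((\<lambda>x. restrict x I) -` A \<inter> space \<mu>) x \<partial>\<mu>)"
      by (rule emeasure_density[OF iB pre])
    also have "\<dots> = (\<integral>\<^sup>+x. indicator {x \<in> space \<mu>. restrict x I \<in> A \<and> restrict x J \<in> B} x \<partial>\<mu>)"
      by (intro nn_integral_cong) (auto simp: indicator_def)
    also have "\<dots> = emeasure \<mu> {x \<in> space \<mu>. restrict x I \<in> A \<and> restrict x J \<in> B}"
    proof (rule nn_integral_indicator)
      have "{x \<in> space \<mu>. restrict x I \<in> A \<and> restrict x J \<in> B}
        = ((\<lambda>x. restrict x I) -` A \<inter> space \<mu>) \<inter> ((\<lambda>x. restrict x J) -` B \<inter> space \<mu>)" by auto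
      then show "{x \<in> space \<mu>. restrict x I \<in> A \<and> restrict x J \<in> B} \<in> sets \<mu>"
        using pre measurable_sets[OF rJ B] by simp
    qed
    also have "\<dots> = emeasure N2 A"
      unfolding N2_def \<kappa>e[OF A] by (subst emeasure_density) auto
    finally show "emeasure N1 A = emeasure N2 A" .
  qed
  then have "(\<integral>\<^sup>+y. h y \<partial>N1) = (\<integral>\<^sup>+y. h y \<partial>N2)" by simp
  moreover have "(\<integral>\<^sup>+y. h y \<partial>N1) = (\<integral>\<^sup>+x. h (restrict x I) * indicator B (restrict x J) \<partial>\<mu>)"
    unfolding N1_def by (subst nn_integral_distr, simp, simp, subst nn_integral_density) (auto simp: mult.commute)
  moreover have "(\<integral>\<^sup>+y. h y \<partial>N2) = (\<integral>\<^sup>+x. h (restrict x I) * emeasure (\<kappa> (restrict x I)) B \<partial>\<mu>)"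
    unfolding N2_def by (subst nn_integral_density, simp, simp, subst nn_integral_distr) (auto simp: mult.commute)
  ultimately show ?thesis by simp
qed

section \<open>Integrals against a product of kernels\<close>

context
  fixes K G d \<kappa>
  assumes dag: "sorted_dag K G"
    and \<kappa>: "\<And>k. k \<in> {1..K} \<Longrightarrow> \<kappa> k \<in> cube d (pa G k) \<rightarrow>\<^sub>M prob_algebra (cube d {k})"
begin

lemma pa_subset: "pa G k \<subseteq> {1..<k}"
  using dag unfolding sorted_dag_def pa_def by fastforce

lemma measurable_kernel_merge:
  assumes "k < K"
  shows "(\<lambda>x. \<kappa> (Suc k) (restrict x (pa G (Suc k)))) \<in> cube d {1..k} \<rightarrow>\<^sub>M prob_algebra (cube d {Suc k})"
    "(\<lambda>(x, y). merge {1..k} {Suc k} (x, y)) \<in> cube d {1..k} \<Otimes>\<^sub>M cube d {Suc k} \<rightarrow>\<^sub>M cube d {1..Suc k}"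
proof -
  have "pa G (Suc k) \<subseteq> {1..k}" using pa_subset[of "Suc k"] by auto
  then show "(\<lambda>x. \<kappa> (Suc k) (restrict x (pa G (Suc k)))) \<in> cube d {1..k} \<rightarrow>\<^sub>M prob_algebra (cube d {Suc k})"
    using assms by (intro measurable_compose[OF measurable_restrict_cube \<kappa>]) auto
  have "{1..k} \<union> {Suc k} = {1..Suc k}" by auto
  then show "(\<lambda>(x, y). merge {1..k} {Suc k} (x, y)) \<in> cube d {1..k} \<Otimes>\<^sub>M cube d {Suc k} \<rightarrow>\<^sub>M cube d {1..Suc k}"
    using measurable_merge[of "{1..k}" "{Suc k}" "\<lambda>k. PiM {..<d k} (\<lambda>_. restrict_space borel {0..1::real})"]
    by (simp only: cube_def case_prod_eta)
qed

lemma measurable_merge_return: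
  assumes "k < K"
  shows "(\<lambda>(x, y). return (cube d {1..Suc k}) (merge {1..k} {Suc k} (x, y)))
    \<in> cube d {1..k} \<Otimes>\<^sub>M cube d {Suc k} \<rightarrow>\<^sub>M prob_algebra (cube d {1..Suc k})"
  using measurable_compose[OF measurable_kernel_merge(2)[OF assms] measurable_return_prob_space]
  by (simp add: split_beta')

lemma measurable_kernel_step:
  assumes "k < K"
  shows "(\<lambda>x. \<kappa> (Suc k) (restrict x (pa G (Suc k))) \<bind> (\<lambda>y.
        return (cube d {1..Suc k}) (merge {1..k} {Suc k} (x, y)))) \<in> cube d {1..k} \<rightarrow>\<^sub>M prob_algebra (cube d {1..Suc k})"
  using measurable_kernel_merge(1)[OF assms] measurable_merge_return[OF assms]
  by (rule measurable_bind_prob_space2)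

lemma kernel_prod_prob: "k \<le> K \<Longrightarrow> kernel_prod d G \<kappa> k \<in> space (prob_algebra (cube d {1..k}))"
proof (induction k)
  case 0
  then show ?case by (auto simp: space_prob_algebra space_cube intro!: prob_space_return)
next
  case (Suc k)
  then show ?case
    using prob_space_bind'[OF Suc.IH measurable_kernel_step] sets_bind'[OF Suc.IH measurable_kernel_step]
    by (simp add: space_prob_algebra)
qed

lemma nn_integral_kernel_prod_Suc:
  assumes k: "k < K" and f: "f \<in> borel_measurable (cube d {1..Suc k})"
  shows "(\<integral>\<^sup>+z. f z \<partial>kernel_prod d G \<kappa> (Suc k))
    = (\<integral>\<^sup>+x. (\<integral>\<^sup>+y. f (merge {1..k} {Suc k} (x, y)) \<partial>\<kappa> (Suc k) (restrict x (pa G (Suc k)))) \<partial>kernel_prod d G \<kappa> k)"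
proof -
  have P: "kernel_prod d G \<kappa> k \<in> space (prob_algebra (cube d {1..k}))" using k by (intro kernel_prod_prob) simp
  then have sP: "sets (kernel_prod d G \<kappa> k) = sets (cube d {1..k})" by (simp add: space_prob_algebra)
  note ms = measurable_prob_algebraD[OF measurable_kernel_step[OF k]]
  have "(\<integral>\<^sup>+z. f z \<partial>kernel_prod d G \<kappa> (Suc k))
    = (\<integral>\<^sup>+x. (\<integral>\<^sup>+z. f z \<partial>(\<kappa> (Suc k) (restrict x (pa G (Suc k))) \<bind> (\<lambda>y.
        return (cube d {1..Suc k}) (merge {1..k} {Suc k} (x, y))))) \<partial>kernel_prod d G \<kappa> k)"
    unfolding kernel_prod.simps
    using f ms by (intro nn_integral_bind) (auto simp: measurable_cong_sets[OF sP refl])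
  also have "\<dots> = (\<integral>\<^sup>+x. (\<integral>\<^sup>+y. f (merge {1..k} {Suc k} (x, y)) \<partial>\<kappa> (Suc k) (restrict x (pa G (Suc k)))) \<partial>kernel_prod d G \<kappa> k)"
  proof (intro nn_integral_cong)
    fix x assume "x \<in> space (kernel_prod d G \<kappa> k)"
    then have x: "x \<in> space (cube d {1..k})" using sets_eq_imp_space_eq[OF sP] by simp
    let ?M = "\<kappa> (Suc k) (restrict x (pa G (Suc k)))"
    have sM: "sets ?M = sets (cube d {Suc k})"
      using measurable_space[OF measurable_kernel_merge(1)[OF k] x] by (simp add: space_prob_algebra)
    have mm: "(\<lambda>y. merge {1..k} {Suc k} (x, y)) \<in> cube d {Suc k} \<rightarrow>\<^sub>M cube d {1..Suc k}"
      using measurable_compose[OF measurable_Pair1'[OF x] measurable_kernel_merge(2)[OF k]] by simp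
    have "(\<lambda>y. return (cube d {1..Suc k}) (merge {1..k} {Suc k} (x, y))) \<in> cube d {Suc k} \<rightarrow>\<^sub>M subprob_algebra (cube d {1..Suc k})"
      by (rule measurable_compose[OF mm return_measurable])
    then have "(\<integral>\<^sup>+z. f z \<partial>(?M \<bind> (\<lambda>y. return (cube d {1..Suc k}) (merge {1..k} {Suc k} (x, y)))))
      = (\<integral>\<^sup>+y. \<integral>\<^sup>+z. f z \<partial>return (cube d {1..Suc k}) (merge {1..k} {Suc k} (x, y)) \<partial>?M)"
      using f by (intro nn_integral_bind) (auto simp: measurable_cong_sets[OF sM refl])
    also have "\<dots> = (\<integral>\<^sup>+y. f (merge {1..k} {Suc k} (x, y)) \<partial>?M)"
      using f measurable_space[OF mm] sets_eq_imp_space_eq[OF sM]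
      by (intro nn_integral_cong nn_integral_return) auto
    finally show "(\<integral>\<^sup>+z. f z \<partial>(?M \<bind> (\<lambda>y. return (cube d {1..Suc k}) (merge {1..k} {Suc k} (x, y)))))
      = (\<integral>\<^sup>+y. f (merge {1..k} {Suc k} (x, y)) \<partial>?M)" .
  qed
  finally show ?thesis .
qed

lemma nn_integral_kernel_prod_cond:
  assumes k: "k < K" and F: "F \<in> borel_measurable (cube d {1..k})" and B: "B \<in> sets (cube d {Suc k})"
  shows "(\<integral>\<^sup>+z. F (restrict z {1..k}) * indicator B (restrict z {Suc k}) \<partial>kernel_prod d G \<kappa> (Suc k))
    = (\<integral>\<^sup>+x. F x * emeasure (\<kappa> (Suc k) (restrict x (pa G (Suc k)))) B \<partial>kernel_prod d G \<kappa> k)"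
proof -
  have P: "kernel_prod d G \<kappa> k \<in> space (prob_algebra (cube d {1..k}))" using k by (intro kernel_prod_prob) simp
  then have sP: "sets (kernel_prod d G \<kappa> k) = sets (cube d {1..k})" by (simp add: space_prob_algebra)
  have [measurable]: "(\<lambda>z. restrict z {1..k}) \<in> cube d {1..Suc k} \<rightarrow>\<^sub>M cube d {1..k}"
    "(\<lambda>z. restrict z {Suc k}) \<in> cube d {1..Suc k} \<rightarrow>\<^sub>M cube d {Suc k}"
    by (auto intro!: measurable_restrict_cube)
  note F [measurable] B [measurable]
  show ?thesis
  proof (subst nn_integral_kernel_prod_Suc[OF k], measurable, intro nn_integral_cong)
    fix x assume "x \<in> space (kernel_prod d G \<kappa> k)"
    then have x: "x \<in> space (cube d {1..k})" using sets_eq_imp_space_eq[OF sP] by simp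
    let ?M = "\<kappa> (Suc k) (restrict x (pa G (Suc k)))"
    have sM: "sets ?M = sets (cube d {Suc k})"
      using measurable_space[OF measurable_kernel_merge(1)[OF k] x] by (simp add: space_prob_algebra)
    have xr: "restrict (merge {1..k} {Suc k} (x, y)) {1..k} = x" for y
      using x by (auto simp: space_cube merge_def fun_eq_iff PiE_def extensional_def)
    have yr: "restrict (merge {1..k} {Suc k} (x, y)) {Suc k} = y" if "y \<in> space ?M" for y
      using that sets_eq_imp_space_eq[OF sM] by (auto simp: space_cube merge_def fun_eq_iff PiE_def extensional_def)
    have "(\<integral>\<^sup>+y. F (restrict (merge {1..k} {Suc k} (x, y)) {1..k}) * indicator B (restrict (merge {1..k} {Suc k} (x, y)) {Suc k}) \<partial>?M)
      = (\<integral>\<^sup>+y. F x * indicator B y \<partial>?M)"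
      by (intro nn_integral_cong) (simp only: xr yr)
    also have "\<dots> = F x * emeasure ?M B" using B sM by (simp add: nn_integral_cmult_indicator)
    finally show "(\<integral>\<^sup>+y. F (restrict (merge {1..k} {Suc k} (x, y)) {1..k}) * indicator B (restrict (merge {1..k} {Suc k} (x, y)) {Suc k}) \<partial>?M)
      = F x * emeasure ?M B" .
  qed
qed

text \<open>The kernels of later nodes have mass one and drop out of the integral.\<close>

lemma nn_integral_kernel_prod_marginal:
  assumes "k \<le> n" "n \<le> K" "F \<in> borel_measurable (cube d {1..k})"
  shows "(\<integral>\<^sup>+z. F (restrict z {1..k}) \<partial>kernel_prod d G \<kappa> n) = (\<integral>\<^sup>+z. F z \<partial>kernel_prod d G \<kappa> k)"
  using assms(1,2)
proof (induction n rule: dec_induct)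
  case base
  have "sets (kernel_prod d G \<kappa> k) = sets (cube d {1..k})"
    using kernel_prod_prob[OF base] by (simp add: space_prob_algebra)
  then have "space (kernel_prod d G \<kappa> k) = space (cube d {1..k})" by (rule sets_eq_imp_space_eq)
  then show ?case by (intro nn_integral_cong) (auto simp: space_cube PiE_restrict)
next
  case (step n)
  have n: "n < K" using step.prems by simp
  have sn: "sets (kernel_prod d G \<kappa> n) = sets (cube d {1..n})"
    using kernel_prod_prob[of n] n by (simp add: space_prob_algebra)
  have Fm: "(\<lambda>x. F (restrict x {1..k})) \<in> borel_measurable (cube d {1..n})"
    using step.hyps by (intro measurable_compose[OF measurable_restrict_cube assms(3)]) auto
  have "(\<integral>\<^sup>+z. F (restrict z {1..k}) \<partial>kernel_prod d G \<kappa> (Suc n))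
    = (\<integral>\<^sup>+z. F (restrict (restrict z {1..n}) {1..k}) * indicator (space (cube d {Suc n})) (restrict z {Suc n}) \<partial>kernel_prod d G \<kappa> (Suc n))"
  proof (intro nn_integral_cong)
    fix z assume z: "z \<in> space (kernel_prod d G \<kappa> (Suc n))"
    have "sets (kernel_prod d G \<kappa> (Suc n)) = sets (cube d {1..Suc n})"
      using kernel_prod_prob[of "Suc n"] n by (simp add: space_prob_algebra del: kernel_prod.simps)
    then have "z \<in> space (cube d {1..Suc n})" using z sets_eq_imp_space_eq by blast
    then have "restrict z {Suc n} \<in> space (cube d {Suc n})" by (auto simp: space_cube)
    moreover have "restrict (restrict z {1..n}) {1..k} = restrict z {1..k}"
      using step.hyps by (auto simp: fun_eq_iff)
    ultimately show "F (restrict z {1..k}) = F (restrict (restrict z {1..n}) {1..k}) * indicator (space (cube d {Suc n})) (restrict z {Suc n})"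
      by simp
  qed
  also have "\<dots> = (\<integral>\<^sup>+x. F (restrict x {1..k}) * emeasure (\<kappa> (Suc n) (restrict x (pa G (Suc n)))) (space (cube d {Suc n})) \<partial>kernel_prod d G \<kappa> n)"
    by (rule nn_integral_kernel_prod_cond[OF n Fm]) simp
  also have "\<dots> = (\<integral>\<^sup>+x. F (restrict x {1..k}) \<partial>kernel_prod d G \<kappa> n)"
  proof (intro nn_integral_cong)
    fix x assume "x \<in> space (kernel_prod d G \<kappa> n)"
    then have "x \<in> space (cube d {1..n})" using sets_eq_imp_space_eq[OF sn] by simp
    then have "\<kappa> (Suc n) (restrict x (pa G (Suc n))) \<in> space (prob_algebra (cube d {Suc n}))"
      using measurable_space[OF measurable_kernel_merge(1)[OF n]] by simp
    from in_space_prob_algebra[OF this]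
    show "F (restrict x {1..k}) * emeasure (\<kappa> (Suc n) (restrict x (pa G (Suc n)))) (space (cube d {Suc n})) = F (restrict x {1..k})"
      by simp
  qed
  also have "\<dots> = (\<integral>\<^sup>+z. F z \<partial>kernel_prod d G \<kappa> k)" by (rule step.IH[OF less_imp_le[OF n]])
  finally show ?case .
qed

text \<open>The Markov property of the network: \<open>F\<close> may depend on all earlier nodes,
  yet the kernel of \<open>k\<close> only reads the parents. It is plain in the partial product in
  which \<open>k\<close> is the last node, and the marginal lemma carries both sides to the full
  product.\<close>

lemma nn_integral_kernel_prod_node:
  assumes k: "k \<in> {1..K}" and F: "F \<in> borel_measurable (cube d {1..<k})" and B: "B \<in> sets (cube d {k})"
  shows "(\<integral>\<^sup>+z. F (restrict z {1..<k}) * indicator B (restrict z {k}) \<partial>kernel_prod d G \<kappa> K)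
    = (\<integral>\<^sup>+z. F (restrict z {1..<k}) * emeasure (\<kappa> k (restrict z (pa G k))) B \<partial>kernel_prod d G \<kappa> K)"
proof -
  obtain n where n: "k = Suc n" "n < K" using k by (cases k) auto
  have e: "{1..<k} = {1..n}" using n by auto
  note F = F[unfolded e] and B = B[unfolded n(1)]
  have paS: "pa G (Suc n) \<subseteq> {1..n}" using pa_subset[of "Suc n"] by auto
  have r1: "(\<lambda>z. restrict z {1..n}) \<in> cube d {1..Suc n} \<rightarrow>\<^sub>M cube d {1..n}"
    and r2: "(\<lambda>z. restrict z {Suc n}) \<in> cube d {1..Suc n} \<rightarrow>\<^sub>M cube d {Suc n}"
    by (auto intro!: measurable_restrict_cube)
  note [measurable] = r1 r2 F B
  have m1: "(\<lambda>z. F (restrict z {1..n}) * indicator B (restrict z {Suc n})) \<in> borel_measurable (cube d {1..Suc n})"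
    by measurable
  have m2: "(\<lambda>x. F x * emeasure (\<kappa> (Suc n) (restrict x (pa G (Suc n)))) B) \<in> borel_measurable (cube d {1..n})"
    using measurable_emeasure_kernel[OF measurable_prob_algebraD[OF measurable_kernel_merge(1)[OF n(2)]] B]
    by measurable
  have c1: "restrict (restrict z {1..Suc n}) {1..n} = restrict z {1..n}"
    "restrict (restrict z {1..Suc n}) {Suc n} = restrict z {Suc n}"
    "restrict (restrict z {1..n}) (pa G (Suc n)) = restrict z (pa G (Suc n))" for z :: "nat \<Rightarrow> nat \<Rightarrow> real"
    using paS by (auto simp: fun_eq_iff)
  have "(\<integral>\<^sup>+z. F (restrict z {1..n}) * indicator B (restrict z {Suc n}) \<partial>kernel_prod d G \<kappa> K)
    = (\<integral>\<^sup>+z. F (restrict z {1..n}) * indicator B (restrict z {Suc n}) \<partial>kernel_prod d G \<kappa> (Suc n))"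
    using nn_integral_kernel_prod_marginal[OF _ order_refl m1] n(2) by (simp add: c1 del: kernel_prod.simps)
  also have "\<dots> = (\<integral>\<^sup>+x. F x * emeasure (\<kappa> (Suc n) (restrict x (pa G (Suc n)))) B \<partial>kernel_prod d G \<kappa> n)"
    by (rule nn_integral_kernel_prod_cond[OF n(2) F B])
  also have "\<dots> = (\<integral>\<^sup>+z. F (restrict z {1..n}) * emeasure (\<kappa> (Suc n) (restrict z (pa G (Suc n)))) B \<partial>kernel_prod d G \<kappa> K)"
    using nn_integral_kernel_prod_marginal[OF less_imp_le[OF n(2)] order_refl m2] by (simp only: c1)
  finally show ?thesis by (simp only: e n(1) atLeastLessThanSuc_atLeastAtMost)
qed

end

section \<open>Conditional probabilities of cells\<close>

context clique_net
begin

text \<open>The kernel \<open>q0\<close> for parent cells of probability zero is a parameter: the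
  population needs a default that respects the Lipschitz bound, the estimator just a stochastic
  one.\<close>

definition cond_coarse ::
  "((nat \<Rightarrow> 'b) \<Rightarrow> real) \<Rightarrow> (nat \<Rightarrow> (nat \<Rightarrow> 'b) \<Rightarrow> 'b \<Rightarrow> real) \<Rightarrow> nat \<Rightarrow> (nat \<Rightarrow> 'b) \<Rightarrow> 'b \<Rightarrow> real" where
  "cond_coarse p q0 k c v = (if E p (\<lambda>x. of_bool (cp k x = c)) = 0 then q0 k c v
     else E p (\<lambda>x. of_bool (cp k x = c \<and> R m k (x k) = v)) / E p (\<lambda>x. of_bool (cp k x = c)))"

text \<open>In a cell of probability zero all mass goes to the representative of the cell, which is
  a grid point of that cell.\<close>

definition cond_fine :: "((nat \<Rightarrow> 'b) \<Rightarrow> real) \<Rightarrow> nat \<Rightarrow> 'b \<Rightarrow> real" where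
  "cond_fine p k y = (if E p (\<lambda>x. of_bool (R m k (x k) = R m k y)) = 0 then of_bool (y = R m k y)
     else E p (\<lambda>x. of_bool (x k = y)) / E p (\<lambda>x. of_bool (R m k (x k) = R m k y)))"

lemma E_of_bool_zero:
  assumes "\<And>x. x \<in> \<Omega> \<Longrightarrow> 0 \<le> p x" "E p (\<lambda>x. of_bool (P x)) = 0" "\<And>x. Q x \<Longrightarrow> P x"
  shows "E p (\<lambda>x. of_bool (Q x)) = 0"
proof (rule antisym)
  have "E p (\<lambda>x. of_bool (Q x)) \<le> E p (\<lambda>x. of_bool (P x))"
    using assms by (intro E_mono) auto
  then show "E p (\<lambda>x. of_bool (Q x)) \<le> 0" using assms(2) by simp
  show "0 \<le> E p (\<lambda>x. of_bool (Q x))" using assms(1) by (intro E_nonneg) auto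
qed

lemma compat_cond:
  assumes "\<And>x. x \<in> \<Omega> \<Longrightarrow> 0 \<le> p x"
  shows "compat p (cond_coarse p q0) (cond_fine p)"
  unfolding compat_def
proof (intro ballI conjI)
  fix k c v
  show "E p (\<lambda>x. of_bool (cp k x = c \<and> R m k (x k) = v)) = E p (\<lambda>x. of_bool (cp k x = c)) * cond_coarse p q0 k c v"
    using assms E_of_bool_zero[of p "\<lambda>x. cp k x = c" "\<lambda>x. cp k x = c \<and> R m k (x k) = v"]
    by (auto simp: cond_coarse_def)
next
  fix k y
  show "E p (\<lambda>x. of_bool (x k = y)) = E p (\<lambda>x. of_bool (R m k (x k) = R m k y)) * cond_fine p k y"
    using assms E_of_bool_zero[of p "\<lambda>x. R m k (x k) = R m k y" "\<lambda>x. x k = y"]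
    by (auto simp: cond_fine_def)
qed

lemma stoch_cond:
  assumes p: "\<And>x. x \<in> \<Omega> \<Longrightarrow> 0 \<le> p x"
    and q0: "\<And>k c v. k \<in> {1..K} \<Longrightarrow> c \<in> pa_cells k \<Longrightarrow> v \<in> cells m k \<Longrightarrow> 0 \<le> q0 k c v"
      "\<And>k c. k \<in> {1..K} \<Longrightarrow> c \<in> pa_cells k \<Longrightarrow> (\<Sum>v\<in>cells m k. q0 k c v) = 1"
  shows "stoch (cond_coarse p q0) (cond_fine p)"
  unfolding stoch_def
proof (intro ballI conjI)
  have nn: "0 \<le> E p (\<lambda>x. of_bool (P x))" for P using p by (intro E_nonneg) auto
  fix k assume k: "k \<in> {1..K}"
  show "0 \<le> cond_fine p k y" for y by (simp add: cond_fine_def nn)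
  show "0 \<le> cond_coarse p q0 k c v" if "c \<in> pa_cells k" "v \<in> cells m k" for c v
    using q0 k that by (simp add: cond_coarse_def nn)
  show "(\<Sum>v\<in>cells m k. cond_coarse p q0 k c v) = 1" if c: "c \<in> pa_cells k" for c
  proof (cases "E p (\<lambda>x. of_bool (cp k x = c)) = 0")
    case True
    then show ?thesis using q0(2)[OF k c] by (simp add: cond_coarse_def)
  next
    case False
    have "E p (\<lambda>x. of_bool (cp k x = c)) = (\<Sum>v\<in>cells m k. E p (\<lambda>x. of_bool (cp k x = c \<and> R m k (x k) = v)))"
      using \<Omega>_in k cells_in by (intro E_marginal) auto
    then show ?thesis using False by (simp add: cond_coarse_def sum_divide_distrib[symmetric])
  qed
  show "(\<Sum>y | y \<in> S k \<and> R m k y = v. cond_fine p k y) = 1" if v: "v \<in> cells m k" for v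
  proof (cases "E p (\<lambda>x. of_bool (R m k (x k) = v)) = 0")
    case True
    have "(\<Sum>y | y \<in> S k \<and> R m k y = v. cond_fine p k y) = (\<Sum>y | y \<in> S k \<and> R m k y = v. if y = v then 1 else 0)"
      using True by (intro sum.cong) (auto simp: cond_fine_def)
    also have "\<dots> = 1" using fin_S v R_fix[OF m_J v] cells_S[OF m_J] by (auto simp: sum.delta)
    finally show ?thesis .
  next
    case False
    have "(\<Sum>y | y \<in> S k \<and> R m k y = v. E p (\<lambda>x. of_bool (x k = y)))
        = (\<Sum>y\<in>S k. if R m k y = v then E p (\<lambda>x. of_bool (x k = y)) else 0)"
      using fin_S by (intro sum.inter_filter)
    also have "\<dots> = (\<Sum>y\<in>S k. E p (\<lambda>x. of_bool (R m k (x k) = v \<and> x k = y)))"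
      by (intro sum.cong refl E_filter) auto
    also have "\<dots> = E p (\<lambda>x. of_bool (R m k (x k) = v))"
      using \<Omega>_in k fin_S by (intro E_marginal[symmetric]) auto
    finally have "(\<Sum>y | y \<in> S k \<and> R m k y = v. E p (\<lambda>x. of_bool (x k = y))) = E p (\<lambda>x. of_bool (R m k (x k) = v))" .
    moreover have "(\<Sum>y | y \<in> S k \<and> R m k y = v. cond_fine p k y)
       = (\<Sum>y | y \<in> S k \<and> R m k y = v. E p (\<lambda>x. of_bool (x k = y)) / E p (\<lambda>x. of_bool (R m k (x k) = v)))"
      using False by (intro sum.cong) (auto simp: cond_fine_def)
    ultimately show ?thesis using False by (simp add: sum_divide_distrib[symmetric])
  qed
qed

text \<open>The weights within a cell are common to both kernels and sum to 1, so the coarse factors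
  alone decide the distance.\<close>

lemma ker_diff_le:
  assumes q: "stoch qc qf" and k: "k \<in> {1..K}"
  shows "(\<Sum>y\<in>S k. \<bar>ker qc qf k z y - ker qc qf k z' y\<bar>) = (\<Sum>v\<in>cells m k. \<bar>qc k (cp k z) v - qc k (cp k z') v\<bar>)"
proof -
  have "\<bar>ker qc qf k z y - ker qc qf k z' y\<bar> = \<bar>qc k (cp k z) (R m k y) - qc k (cp k z') (R m k y)\<bar> * qf k y" if "y \<in> S k" for y
    using q k that by (simp add: ker_def stoch_def left_diff_distrib[symmetric] abs_mult)
  then show ?thesis using sum_fine[OF q k, of "\<lambda>v. \<bar>qc k (cp k z) v - qc k (cp k z') v\<bar>"] by simp
qed

end

section \<open>Lipschitz versions of conditional distributions\<close>

lemma sum_measure_partition: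
  assumes "prob_space N" "finite T" "\<And>z. z \<in> space N \<Longrightarrow> g z \<in> T"
    and "\<And>s. s \<in> T \<Longrightarrow> {z \<in> space N. g z = s} \<in> sets N"
  shows "(\<Sum>s\<in>T. measure N {z \<in> space N. g z = s}) = 1"
proof -
  interpret prob_space N by fact
  have "(\<Sum>s\<in>T. measure N {z \<in> space N. g z = s}) = measure N (\<Union>s\<in>T. {z \<in> space N. g z = s})"
    using assms by (intro finite_measure_finite_Union[symmetric]) (auto simp: disjoint_family_on_def)
  also have "(\<Union>s\<in>T. {z \<in> space N. g z = s}) = space N" using assms(3) by auto
  finally show ?thesis by (simp add: prob_space)
qed

text \<open>The Lipschitz condition is used only for points that share a dyadic cell, at any level
  \<open>j\<close>; in this form it also makes sense for empty \<open>I\<close>, where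
  \<open>sup_dist\<close> does not.\<close>

definition lip_kernel ::
  "(nat \<Rightarrow> nat) \<Rightarrow> (nat \<Rightarrow> nat \<Rightarrow> real) measure \<Rightarrow> real \<Rightarrow> nat set \<Rightarrow> nat set
    \<Rightarrow> ((nat \<Rightarrow> nat \<Rightarrow> real) \<Rightarrow> (nat \<Rightarrow> nat \<Rightarrow> real) measure) \<Rightarrow> bool" where
  "lip_kernel d \<mu> L I J \<kappa> \<longleftrightarrow> regular_cond_distr d \<mu> I J \<kappa> \<and>
     (\<forall>j. \<forall>x\<in>space (cube d I). \<forall>y\<in>space (cube d I).
        (\<forall>k\<in>I. dyad d j k (x k) = dyad d j k (y k)) \<longrightarrow> tv_dist (\<kappa> x) (\<kappa> y) \<le> L * (1/2)^j)"

lemma lip_kernel_space: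
  assumes "lip_kernel d \<mu> L I J \<kappa>" "x \<in> space (cube d I)"
  shows "prob_space (\<kappa> x)" "sets (\<kappa> x) = sets (cube d J)" "space (\<kappa> x) = space (cube d J)"
proof -
  have "\<kappa> x \<in> space (prob_algebra (cube d J))"
    using assms(1) measurable_space[OF _ assms(2)] unfolding lip_kernel_def regular_cond_distr_def by blast
  then show "prob_space (\<kappa> x)" and s: "sets (\<kappa> x) = sets (cube d J)" by (auto simp: space_prob_algebra)
  show "space (\<kappa> x) = space (cube d J)" using s by (rule sets_eq_imp_space_eq)
qed

lemma lip_kernel_sum_le:
  assumes \<kappa>: "lip_kernel d \<mu> L I J \<kappa>" and x: "x \<in> space (cube d I)" "y \<in> space (cube d I)"
    and eq: "\<And>k. k \<in> I \<Longrightarrow> dyad d j k (x k) = dyad d j k (y k)"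
    and T: "finite T" "\<And>s. s \<in> T \<Longrightarrow> {z \<in> space (cube d J). g z = s} \<in> sets (cube d J)"
  shows "(\<Sum>s\<in>T. \<bar>measure (\<kappa> x) {z \<in> space (cube d J). g z = s} - measure (\<kappa> y) {z \<in> space (cube d J). g z = s}\<bar>)
    \<le> 2 * L * (1/2)^j"
proof -
  have "(\<Sum>s\<in>T. \<bar>measure (\<kappa> x) {z \<in> space (cube d J). g z = s} - measure (\<kappa> y) {z \<in> space (cube d J). g z = s}\<bar>)
    \<le> 2 * tv_dist (\<kappa> x) (\<kappa> y)"
    using T lip_kernel_space[OF \<kappa>] x by (intro tv_dist_sum_le) (auto simp: disjoint_family_on_def)
  also have "tv_dist (\<kappa> x) (\<kappa> y) \<le> L * (1/2)^j"
    using \<kappa> x eq by (auto simp: lip_kernel_def)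
  finally show ?thesis by simp
qed

lemma rcd_measure:
  assumes \<mu>: "\<mu> \<in> space (prob_algebra (cube d {1..K}))" and IJ: "I \<subseteq> {1..K}" "J \<subseteq> {1..K}"
    and \<kappa>: "regular_cond_distr d \<mu> I J \<kappa>"
    and A: "A \<in> sets (cube d I)" and B: "B \<in> sets (cube d J)"
  shows "measure \<mu> {x \<in> space \<mu>. restrict x I \<in> A \<and> restrict x J \<in> B}
    = (\<integral>x. indicator A (restrict x I) * measure (\<kappa> (restrict x I)) B \<partial>\<mu>)"
    and "bounded_meas \<mu> (\<lambda>x. measure (\<kappa> (restrict x I)) B)"
    and "bounded_meas \<mu> (\<lambda>x. indicator A (restrict x I))"
proof -
  interpret prob_space \<mu> using \<mu> by (simp add: space_prob_algebra)
  have s\<mu>: "sets \<mu> = sets (cube d {1..K})" using \<mu> by (simp add: space_prob_algebra)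
  have rI: "(\<lambda>x. restrict x I) \<in> \<mu> \<rightarrow>\<^sub>M cube d I" and rJ: "(\<lambda>x. restrict x J) \<in> \<mu> \<rightarrow>\<^sub>M cube d J"
    unfolding measurable_cong_sets[OF s\<mu> refl] by (intro measurable_restrict_cube IJ)+
  have \<kappa>m: "\<kappa> \<in> cube d I \<rightarrow>\<^sub>M prob_algebra (cube d J)" using \<kappa> by (simp add: regular_cond_distr_def)
  have pk: "prob_space (\<kappa> (restrict x I))" if "x \<in> space \<mu>" for x
    using measurable_space[OF \<kappa>m measurable_space[OF rI that]] by (simp add: space_prob_algebra)
  show b1: "bounded_meas \<mu> (\<lambda>x. measure (\<kappa> (restrict x I)) B)"
    unfolding bounded_meas_def
  proof
    show "(\<lambda>x. measure (\<kappa> (restrict x I)) B) \<in> borel_measurable \<mu>"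
      using measurable_compose[OF rI measurable_compose[OF \<kappa>m measurable_measure_prob_algebra[OF B]]] .
    show "\<exists>b. \<forall>x\<in>space \<mu>. \<bar>measure (\<kappa> (restrict x I)) B\<bar> \<le> b"
      using prob_space.prob_le_1[OF pk] by (intro exI[of _ 1]) auto
  qed
  show b2: "bounded_meas \<mu> (\<lambda>x. indicator A (restrict x I))"
    unfolding bounded_meas_def
    using measurable_compose[OF rI borel_measurable_indicator[OF A]] by (auto intro!: exI[of _ 1] simp: indicator_def)
  have S: "{x \<in> space \<mu>. restrict x I \<in> A \<and> restrict x J \<in> B} \<in> sets \<mu>"
  proof -
    have "{x \<in> space \<mu>. restrict x I \<in> A \<and> restrict x J \<in> B}
      = ((\<lambda>x. restrict x I) -` A \<inter> space \<mu>) \<inter> ((\<lambda>x. restrict x J) -` B \<inter> space \<mu>)" by auto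
    then show ?thesis using measurable_sets[OF rI A] measurable_sets[OF rJ B] by simp
  qed
  have "ennreal (measure \<mu> {x \<in> space \<mu>. restrict x I \<in> A \<and> restrict x J \<in> B})
    = emeasure \<mu> {x \<in> space \<mu>. restrict x I \<in> A \<and> restrict x J \<in> B}" by (simp add: emeasure_eq_measure)
  also have "\<dots> = (\<integral>\<^sup>+x. indicator {x \<in> space \<mu>. restrict x I \<in> A \<and> restrict x J \<in> B} x \<partial>\<mu>)"
    using S by simp
  also have "\<dots> = (\<integral>\<^sup>+x. indicator A (restrict x I) * indicator B (restrict x J) \<partial>\<mu>)"
    by (intro nn_integral_cong) (auto simp: indicator_def)
  also have "\<dots> = (\<integral>\<^sup>+x. indicator A (restrict x I) * emeasure (\<kappa> (restrict x I)) B \<partial>\<mu>)"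
    by (rule rcd_integral[OF \<mu> IJ \<kappa> borel_measurable_indicator[OF A] B])
  also have "\<dots> = (\<integral>\<^sup>+x. ennreal (indicator A (restrict x I) * measure (\<kappa> (restrict x I)) B) \<partial>\<mu>)"
  proof (intro nn_integral_cong)
    fix x assume "x \<in> space \<mu>"
    then interpret N: prob_space "\<kappa> (restrict x I)" by (rule pk)
    show "indicator A (restrict x I) * emeasure (\<kappa> (restrict x I)) B
      = ennreal (indicator A (restrict x I) * measure (\<kappa> (restrict x I)) B)"
      by (auto simp: N.emeasure_eq_measure indicator_def)
  qed
  also have "\<dots> = ennreal (\<integral>x. indicator A (restrict x I) * measure (\<kappa> (restrict x I)) B \<partial>\<mu>)"
    by (intro nn_integral_eq_integral bounded_meas_integrable bounded_meas_mult b1 b2) auto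
  finally show "measure \<mu> {x \<in> space \<mu>. restrict x I \<in> A \<and> restrict x J \<in> B}
    = (\<integral>x. indicator A (restrict x I) * measure (\<kappa> (restrict x I)) B \<partial>\<mu>)"
    by (subst (asm) ennreal_inj) (auto intro!: Bochner_Integration.integral_nonneg)
qed

text \<open>On \<open>A\<close>, which lies in a single level-\<open>j\<close> cell, the kernel may
  be frozen at \<open>x0\<close>; the error is \<open>lip_kernel_sum_le\<close> integrated over
  \<open>A\<close>. This serves for a node given its parents as well as for the parents given the
  node.\<close>

lemma rcd_close:
  assumes \<mu>: "\<mu> \<in> space (prob_algebra (cube d {1..K}))" and IJ: "I \<subseteq> {1..K}" "J \<subseteq> {1..K}"
    and \<kappa>: "lip_kernel d \<mu> L I J \<kappa>"
    and A: "A \<in> sets (cube d I)" and x0: "x0 \<in> space (cube d I)"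
    and near: "\<And>x k. x \<in> A \<Longrightarrow> k \<in> I \<Longrightarrow> dyad d j k (x k) = dyad d j k (x0 k)"
    and T: "finite T" "\<And>s. s \<in> T \<Longrightarrow> {z \<in> space (cube d J). g z = s} \<in> sets (cube d J)"
  shows "(\<Sum>s\<in>T. \<bar>measure \<mu> {x \<in> space \<mu>. restrict x I \<in> A \<and> restrict x J \<in> {z \<in> space (cube d J). g z = s}}
      - measure (\<kappa> x0) {z \<in> space (cube d J). g z = s} * measure \<mu> {x \<in> space \<mu>. restrict x I \<in> A}\<bar>)
    \<le> 2 * L * (1/2)^j * measure \<mu> {x \<in> space \<mu>. restrict x I \<in> A}"
proof -
  interpret prob_space \<mu> using \<mu> by (simp add: space_prob_algebra)
  have s\<mu>: "sets \<mu> = sets (cube d {1..K})" using \<mu> by (simp add: space_prob_algebra)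
  have rI: "(\<lambda>x. restrict x I) \<in> \<mu> \<rightarrow>\<^sub>M cube d I"
    unfolding measurable_cong_sets[OF s\<mu> refl] by (intro measurable_restrict_cube IJ)
  have r: "regular_cond_distr d \<mu> I J \<kappa>" using \<kappa> by (simp add: lip_kernel_def)
  let ?B = "\<lambda>s. {z \<in> space (cube d J). g z = s}"
  have bA: "bounded_meas \<mu> (\<lambda>x. indicator A (restrict x I))"
    using rcd_measure(3)[OF \<mu> IJ r A sets.top] .
  have bB: "bounded_meas \<mu> (\<lambda>x. measure (\<kappa> (restrict x I)) (?B s))" if "s \<in> T" for s
    using rcd_measure(2)[OF \<mu> IJ r A T(2)[OF that]] .
  have mA: "measure \<mu> {x \<in> space \<mu>. restrict x I \<in> A} = (\<integral>x. indicator A (restrict x I) \<partial>\<mu>)"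
  proof -
    have "(\<integral>x. indicator A (restrict x I) \<partial>\<mu>) = (\<integral>x. indicator {x \<in> space \<mu>. restrict x I \<in> A} x \<partial>\<mu> :: real)"
      by (intro Bochner_Integration.integral_cong) (auto simp: indicator_def)
    also have "\<dots> = measure \<mu> {x \<in> space \<mu>. restrict x I \<in> A}"
    proof -
      have "{x \<in> space \<mu>. restrict x I \<in> A} = (\<lambda>x. restrict x I) -` A \<inter> space \<mu>" by auto
      then have "{x \<in> space \<mu>. restrict x I \<in> A} \<in> sets \<mu>" using measurable_sets[OF rI A] by simp
      then show ?thesis by (simp add: sets.Int_space_eq2)
    qed
    finally show ?thesis by simp
  qed
  have "(\<Sum>s\<in>T. \<bar>measure \<mu> {x \<in> space \<mu>. restrict x I \<in> A \<and> restrict x J \<in> ?B s}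
      - measure (\<kappa> x0) (?B s) * measure \<mu> {x \<in> space \<mu>. restrict x I \<in> A}\<bar>)
    \<le> (\<Sum>s\<in>T. \<integral>x. indicator A (restrict x I) * \<bar>measure (\<kappa> (restrict x I)) (?B s) - measure (\<kappa> x0) (?B s)\<bar> \<partial>\<mu>)"
  proof (intro sum_mono)
    fix s assume s: "s \<in> T"
    have "measure \<mu> {x \<in> space \<mu>. restrict x I \<in> A \<and> restrict x J \<in> ?B s}
      - measure (\<kappa> x0) (?B s) * measure \<mu> {x \<in> space \<mu>. restrict x I \<in> A}
      = (\<integral>x. indicator A (restrict x I) * measure (\<kappa> (restrict x I)) (?B s) \<partial>\<mu>)
        - (\<integral>x. measure (\<kappa> x0) (?B s) * indicator A (restrict x I) \<partial>\<mu>)"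
      unfolding rcd_measure(1)[OF \<mu> IJ r A T(2)[OF s]] mA by simp
    also have "\<dots> = (\<integral>x. indicator A (restrict x I) * measure (\<kappa> (restrict x I)) (?B s)
        - measure (\<kappa> x0) (?B s) * indicator A (restrict x I) \<partial>\<mu>)"
      by (intro Bochner_Integration.integral_diff[symmetric] bounded_meas_integrable bounded_meas_mult bA bB s bounded_meas_const)
    also have "\<dots> = (\<integral>x. indicator A (restrict x I) * (measure (\<kappa> (restrict x I)) (?B s) - measure (\<kappa> x0) (?B s)) \<partial>\<mu>)"
      by (simp add: algebra_simps)
    finally have eq: "measure \<mu> {x \<in> space \<mu>. restrict x I \<in> A \<and> restrict x J \<in> ?B s}
      - measure (\<kappa> x0) (?B s) * measure \<mu> {x \<in> space \<mu>. restrict x I \<in> A}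
      = (\<integral>x. indicator A (restrict x I) * (measure (\<kappa> (restrict x I)) (?B s) - measure (\<kappa> x0) (?B s)) \<partial>\<mu>)" .
    have "\<bar>\<integral>x. indicator A (restrict x I) * (measure (\<kappa> (restrict x I)) (?B s) - measure (\<kappa> x0) (?B s)) \<partial>\<mu>\<bar>
      \<le> (\<integral>x. \<bar>indicator A (restrict x I) * (measure (\<kappa> (restrict x I)) (?B s) - measure (\<kappa> x0) (?B s))\<bar> \<partial>\<mu>)"
      by (rule integral_abs_bound)
    also have "\<dots> = (\<integral>x. indicator A (restrict x I) * \<bar>measure (\<kappa> (restrict x I)) (?B s) - measure (\<kappa> x0) (?B s)\<bar> \<partial>\<mu>)"
      by (simp add: abs_mult)
    finally show "\<bar>measure \<mu> {x \<in> space \<mu>. restrict x I \<in> A \<and> restrict x J \<in> ?B s}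
      - measure (\<kappa> x0) (?B s) * measure \<mu> {x \<in> space \<mu>. restrict x I \<in> A}\<bar>
      \<le> (\<integral>x. indicator A (restrict x I) * \<bar>measure (\<kappa> (restrict x I)) (?B s) - measure (\<kappa> x0) (?B s)\<bar> \<partial>\<mu>)"
      unfolding eq .
  qed
  also have "\<dots> = (\<integral>x. (\<Sum>s\<in>T. indicator A (restrict x I) * \<bar>measure (\<kappa> (restrict x I)) (?B s) - measure (\<kappa> x0) (?B s)\<bar>) \<partial>\<mu>)"
    by (intro Bochner_Integration.integral_sum[symmetric] bounded_meas_integrable bounded_meas_intros bA bB)
  also have "\<dots> \<le> (\<integral>x. 2 * L * (1/2)^j * indicator A (restrict x I) \<partial>\<mu>)"
  proof (intro integral_mono bounded_meas_integrable)
    show "bounded_meas \<mu> (\<lambda>x. \<Sum>s\<in>T. indicator A (restrict x I) * \<bar>measure (\<kappa> (restrict x I)) (?B s) - measure (\<kappa> x0) (?B s)\<bar>)"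
      by (intro bounded_meas_intros bA bB)
    show "bounded_meas \<mu> (\<lambda>x. 2 * L * (1/2)^j * indicator A (restrict x I))"
      by (intro bounded_meas_mult bounded_meas_const bA)
    fix x assume x: "x \<in> space \<mu>"
    show "(\<Sum>s\<in>T. indicator A (restrict x I) * \<bar>measure (\<kappa> (restrict x I)) (?B s) - measure (\<kappa> x0) (?B s)\<bar>)
      \<le> 2 * L * (1/2)^j * indicator A (restrict x I)"
    proof (cases "restrict x I \<in> A")
      case True
      have "(\<Sum>s\<in>T. \<bar>measure (\<kappa> (restrict x I)) (?B s) - measure (\<kappa> x0) (?B s)\<bar>) \<le> 2 * L * (1/2)^j"
        by (intro lip_kernel_sum_le[OF \<kappa> measurable_space[OF rI x] x0] near[OF True] T)
      then show ?thesis using True by simp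
    qed simp
  qed
  also have "\<dots> = 2 * L * (1/2)^j * measure \<mu> {x \<in> space \<mu>. restrict x I \<in> A}" unfolding mA by simp
  finally show ?thesis .
qed

section \<open>The law of the rounded observation\<close>

text \<open>No measure is fixed here: the estimator is defined in this locale and so cannot depend
  on the unknown \<open>\<mu>\<close>.\<close>

locale dyad_net =
  fixes K :: nat and G :: "(nat \<times> nat) set" and d :: "nat \<Rightarrow> nat" and m J :: nat
  assumes sorted: "sorted_dag K G" and connected: "\<forall>k\<in>{1..K}. fully_connected G (pa G k)"
    and levels: "m \<le> J"

sublocale dyad_net \<subseteq> clique_net K G "dgrid d J" "dyad d" m J
  using clique_net_dyad sorted connected levels .

context dyad_net
begin

definition rnd :: "(nat \<Rightarrow> nat \<Rightarrow> real) \<Rightarrow> nat \<Rightarrow> nat \<Rightarrow> real" where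
  "rnd z = (\<lambda>k\<in>{1..K}. dyad d J k (z k))"

end

locale tv_net = dyad_net +
  fixes L :: real and \<mu> :: "(nat \<Rightarrow> nat \<Rightarrow> real) measure"
  assumes d1: "\<And>k. k \<in> {1..K} \<Longrightarrow> 1 \<le> d k" and L: "0 < L"
    and net: "\<mu> \<in> bayes_net K G d" and lip: "tv_lipschitz K G d L \<mu>"
begin

abbreviation "S \<equiv> dgrid d J"

lemma \<mu>P: "\<mu> \<in> space (prob_algebra (cube d {1..K}))"
  using net by (simp add: bayes_net_def)

sublocale \<mu>: prob_space \<mu>
  using \<mu>P by (simp add: space_prob_algebra)

lemma sets_\<mu>: "sets \<mu> = sets (cube d {1..K})"
  using \<mu>P by (simp add: space_prob_algebra)

lemma space_\<mu>: "space \<mu> = space (cube d {1..K})"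
  using sets_\<mu> by (rule sets_eq_imp_space_eq)

definition p :: "(nat \<Rightarrow> nat \<Rightarrow> real) \<Rightarrow> real" where
  "p x = measure \<mu> {z \<in> space \<mu>. rnd z = x}"

lemma rnd_in: "z \<in> space \<mu> \<Longrightarrow> rnd z \<in> \<Omega>"
  by (auto simp: \<Omega>_def rnd_def space_\<mu> space_cube intro!: dyad_in_dgrid)

lemma sets_rnd: "{z \<in> space \<mu>. rnd z = x} \<in> sets \<mu>"
  unfolding sets_\<mu> space_\<mu> rnd_def by (rule sets_dyad_cell) simp

lemma p_nonneg: "0 \<le> p x"
  by (simp add: p_def)

lemma measurable_rnd: "rnd \<in> \<mu> \<rightarrow>\<^sub>M count_space UNIV"
proof (rule measurableI)
  fix A :: "(nat \<Rightarrow> nat \<Rightarrow> real) set"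
  have "rnd -` A \<inter> space \<mu> = (\<Union>x\<in>A \<inter> \<Omega>. {z \<in> space \<mu>. rnd z = x})" using rnd_in by auto
  also have "\<dots> \<in> sets \<mu>" using fin_\<Omega> sets_rnd by (intro sets.finite_UN) auto
  finally show "rnd -` A \<inter> space \<mu> \<in> sets \<mu>" .
qed simp

lemma E_p: "E p F = (\<integral>z. F (rnd z) \<partial>\<mu>)"
proof -
  have "(\<integral>z. F (rnd z) \<partial>\<mu>) = (\<integral>z. (\<Sum>x\<in>\<Omega>. F x * indicator {z \<in> space \<mu>. rnd z = x} z) \<partial>\<mu>)"
  proof (intro Bochner_Integration.integral_cong refl)
    fix z assume z: "z \<in> space \<mu>"
    have "(\<Sum>x\<in>\<Omega>. F x * indicator {z \<in> space \<mu>. rnd z = x} z) = (\<Sum>x\<in>\<Omega>. if x = rnd z then F x else 0)"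
      using z by (intro sum.cong) (auto simp: indicator_def)
    then show "F (rnd z) = (\<Sum>x\<in>\<Omega>. F x * indicator {z \<in> space \<mu>. rnd z = x} z)"
      using fin_\<Omega> rnd_in[OF z] by simp
  qed
  also have "\<dots> = (\<Sum>x\<in>\<Omega>. \<integral>z. F x * indicator {z \<in> space \<mu>. rnd z = x} z \<partial>\<mu>)"
    using sets_rnd by (intro Bochner_Integration.integral_sum integrable_mult_right integrable_real_indicator)
      (auto simp: \<mu>.emeasure_eq_measure)
  also have "\<dots> = E p F"
    unfolding E_def p_def using sets_rnd by (intro sum.cong refl) (simp add: sets.Int_space_eq2 mult.commute)
  finally show ?thesis by simp
qed

lemma p_sum: "(\<Sum>x\<in>\<Omega>. p x) = 1"
  using E_p[of "\<lambda>_. 1"] by (simp add: E_def \<mu>.prob_space)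

lemma E_p_of_bool:
  "E p (\<lambda>x. of_bool (P x)) = measure \<mu> {z \<in> space \<mu>. P (rnd z)}"
proof -
  have "{z \<in> space \<mu>. P (rnd z)} = rnd -` {x. P x} \<inter> space \<mu>" by auto
  then have S: "{z \<in> space \<mu>. P (rnd z)} \<in> sets \<mu>" using measurable_sets[OF measurable_rnd, of "{x. P x}"] by simp
  have "E p (\<lambda>x. of_bool (P x)) = (\<integral>z. indicator {z \<in> space \<mu>. P (rnd z)} z \<partial>\<mu>)"
    unfolding E_p by (intro Bochner_Integration.integral_cong) (auto simp: indicator_def)
  then show ?thesis using S by (simp add: sets.Int_space_eq2)
qed

lemma kernels:
  assumes k: "k \<in> {1..K}"
  shows "\<exists>\<kappa>. lip_kernel d \<mu> L (pa G k) {k} \<kappa>" "\<exists>\<kappa>. lip_kernel d \<mu> L (pa G k) (pre G k) \<kappa>"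
    "\<exists>\<kappa>. lip_kernel d \<mu> L {k} (pa G k) \<kappa>"
proof -
  have sub: "pa G k \<subseteq> {1..K}" "pre G k \<subseteq> {1..K}" "{k} \<subseteq> {1..K}"
    using pa_less k by (auto simp: pre_def)
  \<comment> \<open>The Lipschitz condition is assumed from node 2 on, and node 1 has no
    parents.\<close>
  have k2: "k \<in> {2..K}" if "pa G k \<noteq> {}"
    using that pa_less(3)[of k] k by fastforce
  have ex: "\<exists>\<kappa>. lip_kernel d \<mu> L I J' \<kappa>" if "I \<subseteq> {1..K}" "J' \<subseteq> {1..K}"
    "I \<noteq> {} \<Longrightarrow> J' \<noteq> {} \<Longrightarrow> tv_lipschitz_cond d L \<mu> I J'" for I J'
  proof (rule lipschitz_kernel[OF \<mu>P that(1,2)])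
    show "1 \<le> d i" if "i \<in> I" for i using d1 that \<open>I \<subseteq> {1..K}\<close> by blast
    show "0 \<le> L" using L by simp
    show "tv_lipschitz_cond d L \<mu> I J'" if "I \<noteq> {}" "J' \<noteq> {}" using that \<open>I \<noteq> {} \<Longrightarrow> J' \<noteq> {} \<Longrightarrow> _\<close> by blast
  next
    fix \<kappa> assume "regular_cond_distr d \<mu> I J' \<kappa>"
      "\<And>j x y. x \<in> space (cube d I) \<Longrightarrow> y \<in> space (cube d I) \<Longrightarrow>
      (\<And>k. k \<in> I \<Longrightarrow> dyad d j k (x k) = dyad d j k (y k)) \<Longrightarrow> tv_dist (\<kappa> x) (\<kappa> y) \<le> L * (1/2)^j"
    then have "lip_kernel d \<mu> L I J' \<kappa>" unfolding lip_kernel_def by blast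
    then show ?thesis by blast
  qed
  show "\<exists>\<kappa>. lip_kernel d \<mu> L (pa G k) {k} \<kappa>"
    using lip k2 by (intro ex sub) (auto simp: tv_lipschitz_def)
  show "\<exists>\<kappa>. lip_kernel d \<mu> L (pa G k) (pre G k) \<kappa>"
    using lip k2 by (intro ex sub) (auto simp: tv_lipschitz_def)
  show "\<exists>\<kappa>. lip_kernel d \<mu> L {k} (pa G k) \<kappa>"
    using lip k2 by (intro ex sub) (auto simp: tv_lipschitz_def)
qed

definition "kpa k = (SOME \<kappa>. lip_kernel d \<mu> L (pa G k) {k} \<kappa>)"
definition "kpre k = (SOME \<kappa>. lip_kernel d \<mu> L (pa G k) (pre G k) \<kappa>)"
definition "kch k = (SOME \<kappa>. lip_kernel d \<mu> L {k} (pa G k) \<kappa>)"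

lemma kpa: "k \<in> {1..K} \<Longrightarrow> lip_kernel d \<mu> L (pa G k) {k} (kpa k)"
  and kpre: "k \<in> {1..K} \<Longrightarrow> lip_kernel d \<mu> L (pa G k) (pre G k) (kpre k)"
  and kch: "k \<in> {1..K} \<Longrightarrow> lip_kernel d \<mu> L {k} (pa G k) (kch k)"
  unfolding kpa_def kpre_def kch_def
  by (rule someI_ex[OF kernels(1)], assumption, rule someI_ex[OF kernels(2)], assumption,
      rule someI_ex[OF kernels(3)], assumption)

abbreviation node_cell :: "nat \<Rightarrow> nat \<Rightarrow> (nat \<Rightarrow> real) \<Rightarrow> (nat \<Rightarrow> nat \<Rightarrow> real) set" where
  "node_cell j k v \<equiv> {z \<in> space (cube d {k}). dyad d j k (z k) = v}"

abbreviation set_cell :: "nat \<Rightarrow> nat set \<Rightarrow> (nat \<Rightarrow> nat \<Rightarrow> real) \<Rightarrow> (nat \<Rightarrow> nat \<Rightarrow> real) set" where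
  "set_cell j I u \<equiv> {z \<in> space (cube d I). (\<lambda>i\<in>I. dyad d j i (z i)) = u}"

lemma sets_node_cell: "node_cell j k v \<in> sets (cube d {k})"
proof -
  have "(dyad d j k (z k) = v) = ((\<lambda>i\<in>{k}. dyad d j i (z i)) = (\<lambda>i\<in>{k}. v))" for z
  proof
    assume "(\<lambda>i\<in>{k}. dyad d j i (z i)) = (\<lambda>i\<in>{k}. v)"
    from fun_cong[OF this, of k] show "dyad d j k (z k) = v" by simp
  qed (auto simp: fun_eq_iff)
  then show ?thesis using sets_dyad_cell[of "{k}" d j "\<lambda>i\<in>{k}. v"] by simp
qed

lemma sets_set_cell: "finite I \<Longrightarrow> set_cell j I u \<in> sets (cube d I)"
  by (rule sets_dyad_cell)

lemma node_unit: "z \<in> space (cube d I) \<Longrightarrow> k \<in> I \<Longrightarrow> z k \<in> PiE {..<d k} (\<lambda>_. {0..1})"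
  by (auto simp: space_cube)

lemma dyad_in_S: "z \<in> space (cube d I) \<Longrightarrow> k \<in> I \<Longrightarrow> dyad d J k (z k) \<in> S k"
  by (rule dyad_in_dgrid) (rule node_unit)

lemma dyad_cells:
  assumes "z \<in> space (cube d I)" "k \<in> I" "j \<le> J"
  shows "dyad d j k (z k) \<in> cells j k"
  unfolding cells_def
proof (rule image_eqI)
  show "dyad d j k (z k) = dyad d j k (dyad d J k (z k))" using assms(3) by (simp add: dyad_dyad)
  show "dyad d J k (z k) \<in> S k" using assms(1,2) by (rule dyad_in_S)
qed

lemma pa_cells_space: "c \<in> pa_cells k \<Longrightarrow> c \<in> space (cube d (pa G k))"
proof (erule rev_subsetD)
  show "pa_cells k \<subseteq> space (cube d (pa G k))"
    unfolding pa_cells_def space_cube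
  proof (rule PiE_mono)
    fix i show "cells m i \<subseteq> PiE {..<d i} (\<lambda>_. {0..1})"
      using cells_S[OF m_J, of i] dgrid_unit[of _ d J i] by blast
  qed
qed

lemma rnd_at: "k \<in> {1..K} \<Longrightarrow> rnd z k = dyad d J k (z k)"
  by (simp add: rnd_def)

lemma restrict_space_\<mu>: "I \<subseteq> {1..K} \<Longrightarrow> z \<in> space \<mu> \<Longrightarrow> restrict z I \<in> space (cube d I)"
  by (auto simp: space_\<mu> space_cube)

lemma cp_rnd: "k \<in> {1..K} \<Longrightarrow> cp k (rnd z) = (\<lambda>i\<in>pa G k. dyad d m i (z i))"
  using pa_less(2) m_J by (auto simp: cp_def rnd_def dyad_dyad fun_eq_iff)

text \<open>On cells of probability zero the population kernel is taken from the Lipschitz version, as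
  the Lipschitz bound of the kernels is needed on the whole grid.\<close>

definition "q0 k c v = measure (kpa k c) (node_cell m k v)"

lemma q0_stoch:
  assumes "k \<in> {1..K}" "c \<in> pa_cells k"
  shows "0 \<le> q0 k c v" "(\<Sum>v\<in>cells m k. q0 k c v) = 1"
proof -
  note sp = lip_kernel_space[OF kpa[OF assms(1)] pa_cells_space[OF assms(2)]]
  show "0 \<le> q0 k c v" by (simp add: q0_def)
  have "(\<Sum>v\<in>cells m k. measure (kpa k c) {z \<in> space (kpa k c). dyad d m k (z k) = v}) = 1"
    using sp sets_node_cell m_J by (intro sum_measure_partition) (auto intro!: dyad_cells)
  then show "(\<Sum>v\<in>cells m k. q0 k c v) = 1" unfolding q0_def sp(3) .
qed

lemma q_compat: "compat p (cond_coarse p q0) (cond_fine p)"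
  and q_stoch: "stoch (cond_coarse p q0) (cond_fine p)"
  using q0_stoch by (auto intro!: compat_cond stoch_cond p_nonneg)

text \<open>The representative \<open>c\<close> of a parent cell is itself a possible value of the
  parents, so \<open>rcd_close\<close> applies with \<open>x0 = c\<close>; dividing by the
  probability of the cell gives a bound that is uniform over the cells.\<close>

lemma cond_coarse_close:
  assumes k: "k \<in> {1..K}" and c: "c \<in> pa_cells k"
  shows "(\<Sum>v\<in>cells m k. \<bar>cond_coarse p q0 k c v - q0 k c v\<bar>) \<le> 2 * L * (1/2)^m"
proof -
  let ?P = "E p (\<lambda>x. of_bool (cp k x = c))"
  let ?Q = "\<lambda>v. E p (\<lambda>x. of_bool (cp k x = c \<and> dyad d m k (x k) = v))"
  have sub: "pa G k \<subseteq> {1..K}" "{k} \<subseteq> {1..K}" using pa_less(2) k by auto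
  have A: "set_cell m (pa G k) c \<in> sets (cube d (pa G k))" using fin_pa by (rule sets_set_cell)
  have cS: "c i \<in> cells m i" if "i \<in> pa G k" for i using c that by (auto simp: pa_cells_def)
  have P: "?P = measure \<mu> {z \<in> space \<mu>. restrict z (pa G k) \<in> set_cell m (pa G k) c}"
    unfolding E_p_of_bool using restrict_space_\<mu>[OF sub(1)]
    by (intro arg_cong[where f="measure \<mu>"]) (auto simp: cp_rnd[OF k] cong: restrict_cong)
  have Q: "?Q v = measure \<mu> {z \<in> space \<mu>. restrict z (pa G k) \<in> set_cell m (pa G k) c \<and> restrict z {k} \<in> node_cell m k v}" for v
    unfolding E_p_of_bool using restrict_space_\<mu>[OF sub(1)] restrict_space_\<mu>[OF sub(2)] k m_J
    by (intro arg_cong[where f="measure \<mu>"]) (auto simp: cp_rnd[OF k] rnd_at[OF k] dyad_dyad cong: restrict_cong)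
  have close: "(\<Sum>v\<in>cells m k. \<bar>?Q v - q0 k c v * ?P\<bar>) \<le> 2 * L * (1/2)^m * ?P"
    unfolding P Q q0_def
  proof (rule rcd_close[OF \<mu>P sub kpa[OF k] A pa_cells_space[OF c]])
    fix x i assume x: "x \<in> set_cell m (pa G k) c" and i: "i \<in> pa G k"
    then have "c i = dyad d m i (x i)" by auto
    then show "dyad d m i (x i) = dyad d m i (c i)" by (simp add: dyad_dyad)
  qed (auto intro: sets_node_cell)
  show ?thesis
  proof (cases "?P = 0")
    case True
    then show ?thesis using L by (simp add: cond_coarse_def)
  next
    case False
    then have Pp: "?P > 0" using E_nonneg[of p "\<lambda>x. of_bool (cp k x = c)"] p_nonneg by force
    have "\<bar>cond_coarse p q0 k c v - q0 k c v\<bar> = \<bar>?Q v - q0 k c v * ?P\<bar> / ?P" for v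
    proof -
      have "cond_coarse p q0 k c v - q0 k c v = (?Q v - q0 k c v * ?P) / ?P"
        using False by (simp add: cond_coarse_def field_simps)
      then show ?thesis using Pp by simp
    qed
    then have "(\<Sum>v\<in>cells m k. \<bar>cond_coarse p q0 k c v - q0 k c v\<bar>) = (\<Sum>v\<in>cells m k. \<bar>?Q v - q0 k c v * ?P\<bar>) / ?P"
      by (simp add: sum_divide_distrib)
    also have "\<dots> \<le> (2 * L * (1/2)^m * ?P) / ?P"
      using close Pp by (intro divide_right_mono) auto
    finally show ?thesis using Pp by simp
  qed
qed

abbreviation "qk \<equiv> ker (cond_coarse p q0) (cond_fine p)"

text \<open>For \<open>m \<le> j\<close> equal level-\<open>j\<close> cells force equal parent cells
  and hence equal kernels. For \<open>j < m\<close> both kernels are compared with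
  \<open>q0\<close>, and the two values of \<open>q0\<close> with each other, at a cost of at most
  \<open>2 * L * (1/2)^j\<close> each; this is the 6.\<close>

lemma ker_lip:
  assumes j: "j \<le> J" and k: "k \<in> {1..K}" and z: "grid_pt S k z" "grid_pt S k z'"
    and eq: "\<And>i. i \<in> {1..<k} \<Longrightarrow> dyad d j i (z i) = dyad d j i (z' i)"
  shows "(\<Sum>y\<in>S k. \<bar>qk k z y - qk k z' y\<bar>) \<le> 6 * L * (1/2)^j"
proof (cases "m \<le> j")
  case True
  have "dyad d m i (z i) = dyad d m i (z' i)" if "i \<in> pa G k" for i
    using arg_cong[OF eq[of i], of "dyad d m i"] that pa_less(3)[of k] True by (auto simp: dyad_dyad)
  then have "cp k z = cp k z'" by (auto simp: cp_def fun_eq_iff)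
  then show ?thesis using L by (simp add: ker_def)
next
  case False
  note c = cp_cells[OF z(1)] and c' = cp_cells[OF z(2)]
  have "(\<Sum>v\<in>cells m k. \<bar>q0 k (cp k z) v - q0 k (cp k z') v\<bar>) \<le> 2 * L * (1/2)^j"
    unfolding q0_def
  proof (rule lip_kernel_sum_le[OF kpa[OF k] pa_cells_space[OF c] pa_cells_space[OF c']])
    fix i assume i: "i \<in> pa G k"
    then show "dyad d j i (cp k z i) = dyad d j i (cp k z' i)"
      using eq[of i] pa_less(3)[of k] False by (auto simp: cp_def dyad_dyad)
  qed (auto intro: sets_node_cell)
  moreover have "(\<Sum>y\<in>S k. \<bar>qk k z y - qk k z' y\<bar>)
    \<le> (\<Sum>v\<in>cells m k. \<bar>cond_coarse p q0 k (cp k z) v - q0 k (cp k z) v\<bar>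
      + (\<bar>q0 k (cp k z) v - q0 k (cp k z') v\<bar> + \<bar>cond_coarse p q0 k (cp k z') v - q0 k (cp k z') v\<bar>))"
    unfolding ker_diff_le[OF q_stoch k] by (intro sum_mono) linarith
  moreover have "\<dots> = (\<Sum>v\<in>cells m k. \<bar>cond_coarse p q0 k (cp k z) v - q0 k (cp k z) v\<bar>)
     + ((\<Sum>v\<in>cells m k. \<bar>q0 k (cp k z) v - q0 k (cp k z') v\<bar>)
     + (\<Sum>v\<in>cells m k. \<bar>cond_coarse p q0 k (cp k z') v - q0 k (cp k z') v\<bar>))"
    by (simp add: sum.distrib)
  moreover note cond_coarse_close[OF k c] cond_coarse_close[OF k c']
  moreover have "2 * L * (1/2)^m \<le> 2 * L * (1/2)^j"
    using False L by (intro mult_left_mono power_decreasing) auto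
  ultimately show ?thesis by linarith
qed

end

section \<open>The bias for a measure of the class\<close>

context tv_net
begin

lemma sub_nodes:
  assumes "k \<in> {1..K}"
  shows "pa G k \<subseteq> {1..K}" "pre G k \<subseteq> {1..K}" "{k} \<subseteq> {1..K}" "pa G k \<subseteq> {1..<k}" "pre G k \<subseteq> {1..<k}" "finite (pre G k)"
  using pa_less(2,3) assms by (auto simp: pre_def)

text \<open>Conditional distributions are exchanged with indicators one at a time, so that no almost sure
  uniqueness is needed to pass from the kernels of the network to their Lipschitz versions.\<close>

lemma law_cell:
  assumes k: "k \<in> {1..K}" and U: "U \<in> sets (cube d (pre G k))" and A: "A \<in> sets (cube d (pa G k))"
    and B: "B \<in> sets (cube d {k})"
  shows "measure \<mu> {z \<in> space \<mu>. restrict z (pre G k) \<in> U \<and> restrict z (pa G k) \<in> A \<and> restrict z {k} \<in> B}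
    = (\<integral>z. indicator A (restrict z (pa G k)) * measure (kpre k (restrict z (pa G k))) U
        * measure (kpa k (restrict z (pa G k))) B \<partial>\<mu>)"
proof -
  note sub = sub_nodes[OF k]
  obtain \<kappa>0 where \<kappa>0: "\<And>k. k \<in> {1..K} \<Longrightarrow> regular_cond_distr d \<mu> (pa G k) {k} (\<kappa>0 k)"
    and \<mu>_prod: "\<mu> = kernel_prod d G \<kappa>0 K"
    using net unfolding bayes_net_def by blast
  have \<kappa>0m: "\<kappa>0 k \<in> cube d (pa G k) \<rightarrow>\<^sub>M prob_algebra (cube d {k})" if "k \<in> {1..K}" for k
    using \<kappa>0[OF that] by (simp add: regular_cond_distr_def)
  have rpa: "regular_cond_distr d \<mu> (pa G k) {k} (kpa k)" and rpre: "regular_cond_distr d \<mu> (pa G k) (pre G k) (kpre k)"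
    using kpa[OF k] kpre[OF k] by (auto simp: lip_kernel_def)
  have em: "(\<lambda>c. emeasure (\<kappa> c) X) \<in> borel_measurable (cube d (pa G k))"
    if "regular_cond_distr d \<mu> (pa G k) I \<kappa>" "X \<in> sets (cube d I)" for \<kappa> I X
    using that measurable_emeasure_kernel[OF measurable_prob_algebraD, of \<kappa> "cube d (pa G k)" "cube d I" X]
    by (simp add: regular_cond_distr_def)
  have rr: "(\<lambda>z. restrict z I) \<in> \<mu> \<rightarrow>\<^sub>M cube d I" if "I \<subseteq> {1..K}" for I
    unfolding measurable_cong_sets[OF sets_\<mu> refl] using that by (rule measurable_restrict_cube)
  let ?S = "{z \<in> space \<mu>. restrict z (pre G k) \<in> U \<and> restrict z (pa G k) \<in> A \<and> restrict z {k} \<in> B}"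
  have S: "?S \<in> sets \<mu>"
  proof -
    have "?S = ((\<lambda>z. restrict z (pre G k)) -` U \<inter> space \<mu>) \<inter> ((\<lambda>z. restrict z (pa G k)) -` A \<inter> space \<mu>)
      \<inter> ((\<lambda>z. restrict z {k}) -` B \<inter> space \<mu>)" by auto
    then show ?thesis
      using measurable_sets[OF rr[OF sub(2)] U] measurable_sets[OF rr[OF sub(1)] A] measurable_sets[OF rr[OF sub(3)] B]
      by (simp only: sets.Int)
  qed
  define F :: "(nat \<Rightarrow> nat \<Rightarrow> real) \<Rightarrow> ennreal" where
    "F x = indicator U (restrict x (pre G k)) * indicator A (restrict x (pa G k))" for x
  have Fm: "F \<in> borel_measurable (cube d {1..<k})"
    unfolding F_def
    by (intro borel_measurable_times_ennreal
        measurable_compose[OF measurable_restrict_cube[OF sub(5)] borel_measurable_indicator[OF U]]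
        measurable_compose[OF measurable_restrict_cube[OF sub(4)] borel_measurable_indicator[OF A]])
  have Fr: "F (restrict z {1..<k}) = indicator U (restrict z (pre G k)) * indicator A (restrict z (pa G k))" for z
  proof -
    have "{1..<k} \<inter> pre G k = pre G k" "{1..<k} \<inter> pa G k = pa G k" using sub by auto
    then show ?thesis by (simp only: F_def restrict_restrict)
  qed
  have "emeasure \<mu> ?S = (\<integral>\<^sup>+z. indicator ?S z \<partial>\<mu>)" using S by simp
  also have "\<dots> = (\<integral>\<^sup>+z. F (restrict z {1..<k}) * indicator B (restrict z {k}) \<partial>\<mu>)"
    unfolding Fr by (intro nn_integral_cong) (auto simp: indicator_def)
  \<comment> \<open>The one use of the product form of \<open>\<mu>\<close>: given all predecessors,
    \<open>x k\<close> follows the network kernel at the parents. The steps below only use that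
    \<open>\<kappa>0 k\<close>, \<open>kpre k\<close> and \<open>kpa k\<close> are versions of
    conditional distributions given the parents.\<close>
  also have "\<dots> = (\<integral>\<^sup>+z. F (restrict z {1..<k}) * emeasure (\<kappa>0 k (restrict z (pa G k))) B \<partial>\<mu>)"
    using nn_integral_kernel_prod_node[OF dag \<kappa>0m k Fm B] unfolding \<mu>_prod[symmetric] .
  also have "\<dots> = (\<integral>\<^sup>+z. (indicator A (restrict z (pa G k)) * emeasure (\<kappa>0 k (restrict z (pa G k))) B)
      * indicator U (restrict z (pre G k)) \<partial>\<mu>)"
    unfolding Fr by (intro nn_integral_cong) (simp add: mult_ac)
  also have "\<dots> = (\<integral>\<^sup>+z. (indicator A (restrict z (pa G k)) * emeasure (\<kappa>0 k (restrict z (pa G k))) B)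
      * emeasure (kpre k (restrict z (pa G k))) U \<partial>\<mu>)"
    by (rule rcd_integral[OF \<mu>P sub(1,2) rpre _ U, where h="\<lambda>c. indicator A c * emeasure (\<kappa>0 k c) B"])
      (intro borel_measurable_times_ennreal borel_measurable_indicator A em[OF \<kappa>0[OF k] B])
  also have "\<dots> = (\<integral>\<^sup>+z. (indicator A (restrict z (pa G k)) * emeasure (kpre k (restrict z (pa G k))) U)
      * emeasure (\<kappa>0 k (restrict z (pa G k))) B \<partial>\<mu>)"
    by (intro nn_integral_cong) (simp add: mult_ac)
  also have "\<dots> = (\<integral>\<^sup>+z. (indicator A (restrict z (pa G k)) * emeasure (kpre k (restrict z (pa G k))) U)
      * indicator B (restrict z {k}) \<partial>\<mu>)"
    by (rule rcd_integral[OF \<mu>P sub(1,3) \<kappa>0[OF k] _ B, where h="\<lambda>c. indicator A c * emeasure (kpre k c) U", symmetric])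
      (intro borel_measurable_times_ennreal borel_measurable_indicator A em[OF rpre U])
  also have "\<dots> = (\<integral>\<^sup>+z. (indicator A (restrict z (pa G k)) * emeasure (kpre k (restrict z (pa G k))) U)
      * emeasure (kpa k (restrict z (pa G k))) B \<partial>\<mu>)"
    by (rule rcd_integral[OF \<mu>P sub(1,3) rpa _ B, where h="\<lambda>c. indicator A c * emeasure (kpre k c) U"])
      (intro borel_measurable_times_ennreal borel_measurable_indicator A em[OF rpre U])
  also have "\<dots> = (\<integral>\<^sup>+z. ennreal (indicator A (restrict z (pa G k)) * measure (kpre k (restrict z (pa G k))) U
        * measure (kpa k (restrict z (pa G k))) B) \<partial>\<mu>)"
  proof (intro nn_integral_cong)
    fix z assume z: "z \<in> space \<mu>"
    note rz = restrict_space_\<mu>[OF sub(1) z]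
    interpret N1: prob_space "kpre k (restrict z (pa G k))" by (rule lip_kernel_space[OF kpre[OF k] rz])
    interpret N2: prob_space "kpa k (restrict z (pa G k))" by (rule lip_kernel_space[OF kpa[OF k] rz])
    show "indicator A (restrict z (pa G k)) * emeasure (kpre k (restrict z (pa G k))) U
      * emeasure (kpa k (restrict z (pa G k))) B
      = ennreal (indicator A (restrict z (pa G k)) * measure (kpre k (restrict z (pa G k))) U
        * measure (kpa k (restrict z (pa G k))) B)"
      by (auto simp: N1.emeasure_eq_measure N2.emeasure_eq_measure ennreal_mult indicator_def)
  qed
  also have "\<dots> = ennreal (\<integral>z. indicator A (restrict z (pa G k)) * measure (kpre k (restrict z (pa G k))) U
        * measure (kpa k (restrict z (pa G k))) B \<partial>\<mu>)"
    by (intro nn_integral_eq_integral \<mu>.bounded_meas_integrable bounded_meas_mult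
        rcd_measure(2)[OF \<mu>P sub(1,2) rpre A U] rcd_measure(2)[OF \<mu>P sub(1,3) rpa A B]
        rcd_measure(3)[OF \<mu>P sub(1,3) rpa A B]) auto
  finally show ?thesis
    unfolding \<mu>.emeasure_eq_measure
    by (subst (asm) ennreal_inj) (auto intro!: Bochner_Integration.integral_nonneg)
qed

text \<open>\<open>law_cell\<close> summed over grid points, in the shape that
  \<open>bias_step\<close> asks for: given the exact parents, the rounded node and the other rounded
  predecessors are independent. The probability space is \<open>\<mu>\<close> itself, so that the
  kernels see unrounded parents.\<close>

lemma law:
  assumes k: "k \<in> {1..K}"
  shows "E p (\<lambda>x. H (restrict x (pre G k)) (restrict x (pa G k)) (x k))
    = (\<integral>z. (\<Sum>y\<in>S k. \<Sum>u\<in>PiE (pre G k) S. measure (kpa k (restrict z (pa G k))) (node_cell J k y)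
        * measure (kpre k (restrict z (pa G k))) (set_cell J (pre G k) u)
        * H u (\<lambda>i\<in>pa G k. dyad d J i (z i)) y) \<partial>\<mu>)"
proof -
  note sub = sub_nodes[OF k]
  define SU where "SU = PiE (pre G k) S"
  define SW where "SW = PiE (pa G k) S"
  define a where "a y z = measure (kpa k (restrict z (pa G k))) (node_cell J k y)" for y z
  define b where "b u z = measure (kpre k (restrict z (pa G k))) (set_cell J (pre G k) u)" for u z
  define W where "W z = (\<lambda>i\<in>pa G k. dyad d J i (z i))" for z
  have fin: "finite SU" "finite SW" "finite (S k)"
    unfolding SU_def SW_def using fin_S fin_pa sub(6) by (auto intro!: finite_PiE)
  have cell: "E p (\<lambda>x. of_bool ((restrict x (pre G k), restrict x (pa G k), x k) = (u, w, y)))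
    = (\<integral>z. indicator (set_cell J (pa G k) w) (restrict z (pa G k)) * b u z * a y z \<partial>\<mu>)" for u w y
  proof -
    have "E p (\<lambda>x. of_bool ((restrict x (pre G k), restrict x (pa G k), x k) = (u, w, y)))
      = measure \<mu> {z \<in> space \<mu>. restrict z (pre G k) \<in> set_cell J (pre G k) u \<and>
        restrict z (pa G k) \<in> set_cell J (pa G k) w \<and> restrict z {k} \<in> node_cell J k y}"
      unfolding E_p_of_bool
    proof (intro arg_cong[where f="measure \<mu>"] Collect_cong conj_cong refl)
      fix z assume z: "z \<in> space \<mu>"
      have "restrict (rnd z) (pre G k) = (\<lambda>i\<in>pre G k. dyad d J i (restrict z (pre G k) i))"
        "restrict (rnd z) (pa G k) = (\<lambda>i\<in>pa G k. dyad d J i (restrict z (pa G k) i))"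
        "rnd z k = dyad d J k (restrict z {k} k)"
        using sub k by (auto simp: rnd_def fun_eq_iff)
      then show "((restrict (rnd z) (pre G k), restrict (rnd z) (pa G k), rnd z k) = (u, w, y)) \<longleftrightarrow>
        restrict z (pre G k) \<in> set_cell J (pre G k) u \<and>
        restrict z (pa G k) \<in> set_cell J (pa G k) w \<and> restrict z {k} \<in> node_cell J k y"
        using restrict_space_\<mu>[OF _ z] sub(1-3) by simp
    qed
    then show ?thesis
      unfolding a_def b_def
      using law_cell[OF k sets_set_cell[OF sub(6)] sets_set_cell[OF fin_pa] sets_node_cell] by simp
  qed
  have bm: "bounded_meas \<mu> (b u)" "bounded_meas \<mu> (a y)"
    "bounded_meas \<mu> (\<lambda>z. indicator (set_cell J (pa G k) w) (restrict z (pa G k)))" for u y w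
    unfolding a_def[abs_def] b_def[abs_def]
    using kpa[OF k] kpre[OF k] sub(6) fin_pa
    by (auto simp: lip_kernel_def intro: sets_set_cell sets_node_cell
        rcd_measure(2,3)[OF \<mu>P sub(1,2), of "kpre k" "set_cell J (pa G k) w"]
        rcd_measure(2,3)[OF \<mu>P sub(1,3), of "kpa k" "set_cell J (pa G k) w"])
  define X where "X t z = (case t of (u, w, y) \<Rightarrow>
     indicator (set_cell J (pa G k) w) (restrict z (pa G k)) * b u z * a y z * H u w y)" for t z
  have "E p (\<lambda>x. H (restrict x (pre G k)) (restrict x (pa G k)) (x k))
    = E p (\<lambda>x. case (restrict x (pre G k), restrict x (pa G k), x k) of (u, w, y) \<Rightarrow> H u w y)" by simp
  also have "\<dots> = (\<Sum>t\<in>SU \<times> SW \<times> S k. E p (\<lambda>x. of_bool ((restrict x (pre G k), restrict x (pa G k), x k) = t))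
      * (case t of (u, w, y) \<Rightarrow> H u w y))"
    using fin sub k \<Omega>_in by (intro E_expand) (auto simp: SU_def SW_def)
  also have "\<dots> = (\<Sum>t\<in>SU \<times> SW \<times> S k. \<integral>z. X t z \<partial>\<mu>)"
    by (intro sum.cong refl) (auto simp: cell X_def simp del: prod.inject)
  also have "\<dots> = (\<integral>z. (\<Sum>t\<in>SU \<times> SW \<times> S k. X t z) \<partial>\<mu>)"
  proof (intro Bochner_Integration.integral_sum[symmetric] \<mu>.bounded_meas_integrable)
    fix t show "bounded_meas \<mu> (X t)"
      unfolding X_def by (cases t) (auto intro!: bounded_meas_mult bm bounded_meas_const)
  qed
  also have "\<dots> = (\<integral>z. (\<Sum>y\<in>S k. \<Sum>u\<in>SU. a y z * b u z * H u (W z) y) \<partial>\<mu>)"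
  proof (intro Bochner_Integration.integral_cong refl)
    fix z assume z: "z \<in> space \<mu>"
    have WS: "W z \<in> SW" using z sub(1) unfolding W_def SW_def space_\<mu>
      by (intro restrict_PiE_iff[THEN iffD2] ballI dyad_in_S[of z "{1..K}"]) auto
    have iW: "indicator (set_cell J (pa G k) w) (restrict z (pa G k)) = (of_bool (w = W z) :: real)" for w
      using restrict_space_\<mu>[OF sub(1) z] by (auto simp: indicator_def W_def cong: restrict_cong)
    have "(\<Sum>t\<in>SU \<times> SW \<times> S k. X t z) = (\<Sum>u\<in>SU. \<Sum>w\<in>SW. \<Sum>y\<in>S k. X (u, w, y) z)"
      by (simp add: sum.cartesian_product split_beta')
    also have "\<dots> = (\<Sum>u\<in>SU. \<Sum>w\<in>SW. if w = W z then (\<Sum>y\<in>S k. a y z * b u z * H u (W z) y) else 0)"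
      by (intro sum.cong refl) (auto simp: X_def iW mult_ac)
    also have "\<dots> = (\<Sum>u\<in>SU. \<Sum>y\<in>S k. a y z * b u z * H u (W z) y)" using fin WS by simp
    also have "\<dots> = (\<Sum>y\<in>S k. \<Sum>u\<in>SU. a y z * b u z * H u (W z) y)" by (rule sum.swap)
    finally show "(\<Sum>t\<in>SU \<times> SW \<times> S k. X t z) = (\<Sum>y\<in>S k. \<Sum>u\<in>SU. a y z * b u z * H u (W z) y)" .
  qed
  finally show ?thesis unfolding a_def b_def SU_def W_def .
qed

text \<open>The law of the parents given \<open>x k\<close> is frozen at the representative of the
  level-\<open>m\<close> cell of \<open>y\<close>, so that the reference depends on \<open>y\<close>
  only through that cell.\<close>

lemma third:
  assumes k: "k \<in> {1..K}" and y: "y \<in> S k"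
  shows "(\<Sum>c\<in>pa_cells k. \<bar>E p (\<lambda>x. of_bool (cp k x = c \<and> x k = y))
        - measure (kch k (\<lambda>i\<in>{k}. dyad d m k y)) (set_cell m (pa G k) c) * E p (\<lambda>x. of_bool (x k = y))\<bar>)
    \<le> 2 * L * (1/2)^m * E p (\<lambda>x. of_bool (x k = y))"
proof -
  note sub = sub_nodes[OF k]
  have P: "E p (\<lambda>x. of_bool (x k = y)) = measure \<mu> {z \<in> space \<mu>. restrict z {k} \<in> node_cell J k y}"
    unfolding E_p_of_bool using restrict_space_\<mu>[OF sub(3)] k
    by (intro arg_cong[where f="measure \<mu>"]) (auto simp: rnd_def)
  have Q: "E p (\<lambda>x. of_bool (cp k x = c \<and> x k = y))
    = measure \<mu> {z \<in> space \<mu>. restrict z {k} \<in> node_cell J k y \<and> restrict z (pa G k) \<in> set_cell m (pa G k) c}" for c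
    unfolding E_p_of_bool using restrict_space_\<mu>[OF sub(3)] restrict_space_\<mu>[OF sub(1)] k
    by (intro arg_cong[where f="measure \<mu>"]) (auto simp: cp_rnd[OF k] rnd_at[OF k] cong: restrict_cong)
  show ?thesis
    unfolding P Q
  proof (rule rcd_close[OF \<mu>P sub(3,1) kch[OF k] sets_node_cell])
    show "(\<lambda>i\<in>{k}. dyad d m k y) \<in> space (cube d {k})"
      using R_in[OF m_J y] dgrid_unit by (auto simp: space_cube)
    fix x i assume x: "x \<in> node_cell J k y" and i: "i \<in> {k}"
    then have "y = dyad d J k (x k)" by simp
    then show "dyad d m i (x i) = dyad d m i ((\<lambda>i\<in>{k}. dyad d m k y) i)" using i m_J by (simp add: dyad_dyad)
  qed (auto intro: sets_set_cell fin_pa)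
qed

text \<open>\<open>bias_step\<close> with \<open>\<epsilon> = 2 * L * (1/2)^m\<close> from the
  Lipschitz kernels and \<open>\<delta> = (1 + 6 * L * real K) * (1/2)^m\<close> from
  \<open>net_lipschitz\<close> and \<open>ker_lip\<close>, added up over the nodes by
  \<open>net_bias\<close>.\<close>

lemma bias:
  assumes F: "\<And>z. grid_pt S (Suc K) z \<Longrightarrow> \<bar>F z\<bar> \<le> 1"
      "\<And>j z z'. j \<le> J \<Longrightarrow> grid_pt S (Suc K) z \<Longrightarrow> grid_pt S (Suc K) z'
        \<Longrightarrow> (\<And>i. i \<in> {1..K} \<Longrightarrow> dyad d j i (z i) = dyad d j i (z' i)) \<Longrightarrow> \<bar>F z - F z'\<bar> \<le> (1/2)^j"
      "\<And>z z'. grid_pt S (Suc K) z \<Longrightarrow> grid_pt S (Suc K) z' \<Longrightarrow> (\<And>i. i \<in> {1..K} \<Longrightarrow> z i = z' i) \<Longrightarrow> F z = F z'"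
  shows "\<bar>E p F - net S qk [1..<Suc K] F x0\<bar>
    \<le> real K * (4 * (2 * L * (1/2)^m) * ((1 + 6 * L * real K) * (1/2)^m + 2 * L * (1/2)^m))"
proof (rule net_bias[OF q_stoch p_sum F(3,1)])
  fix k assume k: "k \<in> {1..K}"
  note sub = sub_nodes[OF k] and st = ker_stochastic[OF q_stoch]
  have prep: "prob_space (kpa k (restrict z (pa G k)))" "prob_space (kpre k (restrict z (pa G k)))"
    "space (kpa k (restrict z (pa G k))) = space (cube d {k})" "sets (kpa k (restrict z (pa G k))) = sets (cube d {k})"
    "space (kpre k (restrict z (pa G k))) = space (cube d (pre G k))" "sets (kpre k (restrict z (pa G k))) = sets (cube d (pre G k))"
    if "z \<in> space \<mu>" for z
    using lip_kernel_space[OF kpa[OF k] restrict_space_\<mu>[OF sub(1) that]]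
      lip_kernel_space[OF kpre[OF k] restrict_space_\<mu>[OF sub(1) that]] by auto
  have cpW: "cp k (\<lambda>i\<in>pa G k. dyad d J i (z i)) = (\<lambda>i\<in>pa G k. dyad d m i (z i))" for z
    using m_J by (auto simp: cp_def dyad_dyad fun_eq_iff)
  have cpW_space: "(\<lambda>i\<in>pa G k. dyad d m i (z i)) \<in> space (cube d (pa G k))" if "z \<in> space \<mu>" for z
    using dyad_cells[of z "{1..K}" _ m] that sub(1) m_J
    by (intro pa_cells_space) (auto simp: pa_cells_def space_\<mu>)
  show "\<bar>E p (net S qk [Suc k..<Suc K] F) - E p (net_step S qk k (net S qk [Suc k..<Suc K] F))\<bar>
    \<le> 4 * (2 * L * (1/2)^m) * ((1 + 6 * L * real K) * (1/2)^m + 2 * L * (1/2)^m)"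
  proof (rule bias_step[OF \<mu>.prob_space_axioms k q_compat q_stoch _ _ _ _ _ _ _ _ law[OF k],
        where kap_ref="\<lambda>c y. measure (kpa k c) (node_cell J k y)"
          and kpre_ref="\<lambda>c u. measure (kpre k c) (set_cell J (pre G k) u)"
          and t="\<lambda>v c. measure (kch k (\<lambda>i\<in>{k}. v)) (set_cell m (pa G k) c)"])
    show "(\<lambda>z. \<lambda>i\<in>pa G k. dyad d J i (z i)) \<in> \<mu> \<rightarrow>\<^sub>M count_space UNIV"
    proof -
      have "(\<lambda>z. restrict (rnd z) (pa G k)) \<in> \<mu> \<rightarrow>\<^sub>M count_space UNIV"
        by (rule measurable_compose[OF measurable_rnd]) simp
      moreover have "restrict (rnd z) (pa G k) = (\<lambda>i\<in>pa G k. dyad d J i (z i))" for z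
        using sub(1) by (auto simp: rnd_def fun_eq_iff)
      ultimately show ?thesis by simp
    qed
    show "(\<lambda>i\<in>pa G k. dyad d J i (z i)) \<in> PiE (pa G k) S" if "z \<in> space \<mu>" for z
      using that sub(1) unfolding space_\<mu>
      by (intro restrict_PiE_iff[THEN iffD2] ballI dyad_in_S[of z "{1..K}"]) auto
    show "bounded_meas \<mu> (\<lambda>z. measure (kpa k (restrict z (pa G k))) (node_cell J k y))" for y
      using rcd_measure(2)[OF \<mu>P sub(1,3) _ sets.top sets_node_cell] kpa[OF k] by (simp add: lip_kernel_def)
    show "bounded_meas \<mu> (\<lambda>z. measure (kpre k (restrict z (pa G k))) (set_cell J (pre G k) u))" for u
      using rcd_measure(2)[OF \<mu>P sub(1,2) _ sets.top sets_set_cell[OF sub(6)]] kpre[OF k] by (simp add: lip_kernel_def)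
    show "(\<Sum>y\<in>S k. measure (kpa k (restrict z (pa G k))) (node_cell J k y)) = 1" if "z \<in> space \<mu>" for z
    proof -
      have "(\<Sum>y\<in>S k. measure (kpa k (restrict z (pa G k))) {x \<in> space (kpa k (restrict z (pa G k))). dyad d J k (x k) = y}) = 1"
        using prep[OF that] fin_S sets_node_cell
        by (intro sum_measure_partition) (auto intro: dyad_in_S)
      then show ?thesis unfolding prep(3)[OF that] .
    qed
    show "(\<Sum>u\<in>PiE (pre G k) S. measure (kpre k (restrict z (pa G k))) (set_cell J (pre G k) u)) = 1" if "z \<in> space \<mu>" for z
    proof -
      have "(\<Sum>u\<in>PiE (pre G k) S. measure (kpre k (restrict z (pa G k)))
        {x \<in> space (kpre k (restrict z (pa G k))). (\<lambda>i\<in>pre G k. dyad d J i (x i)) = u}) = 1"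
        using prep[OF that] fin_S sets_set_cell[OF sub(6)] sub(6)
        by (intro sum_measure_partition) (auto intro: dyad_in_S intro!: finite_PiE)
      then show ?thesis unfolding prep(5)[OF that] .
    qed
    show "(\<Sum>y\<in>S k. \<bar>measure (kpa k (restrict z (pa G k))) (node_cell J k y)
        - measure (kpa k (cp k (\<lambda>i\<in>pa G k. dyad d J i (z i)))) (node_cell J k y)\<bar>) \<le> 2 * L * (1/2)^m" if "z \<in> space \<mu>" for z
      unfolding cpW
      using fin_S sets_node_cell
      by (intro lip_kernel_sum_le[OF kpa[OF k] restrict_space_\<mu>[OF sub(1) that] cpW_space[OF that]]) (auto simp: dyad_dyad)
    show "(\<Sum>u\<in>PiE (pre G k) S. \<bar>measure (kpre k (restrict z (pa G k))) (set_cell J (pre G k) u)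
        - measure (kpre k (cp k (\<lambda>i\<in>pa G k. dyad d J i (z i)))) (set_cell J (pre G k) u)\<bar>) \<le> 2 * L * (1/2)^m" if "z \<in> space \<mu>" for z
      unfolding cpW
      using fin_S sub(6) sets_set_cell[OF sub(6)]
      by (intro lip_kernel_sum_le[OF kpre[OF k] restrict_space_\<mu>[OF sub(1) that] cpW_space[OF that]])
        (auto simp: dyad_dyad intro!: finite_PiE)
    show "(\<Sum>c\<in>pa_cells k. \<bar>E p (\<lambda>x. of_bool (cp k x = c \<and> x k = y))
        - measure (kch k (\<lambda>i\<in>{k}. dyad d m k y)) (set_cell m (pa G k) c) * E p (\<lambda>x. of_bool (x k = y))\<bar>)
      \<le> 2 * L * (1/2)^m * E p (\<lambda>x. of_bool (x k = y))" if "y \<in> S k" for y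
      by (rule third[OF k that])
    show "\<bar>net S qk [Suc k..<Suc K] F x\<bar> \<le> 1" if "grid_pt S (Suc k) x" for x
      using that k F(1) by (intro net_abs_le[OF st]) auto
    show "net S qk [Suc k..<Suc K] F x = net S qk [Suc k..<Suc K] F x'"
      if "grid_pt S (Suc k) x" "grid_pt S (Suc k) x'" "\<And>i. i \<in> {1..k} \<Longrightarrow> x i = x' i" for x x'
    proof -
      have "\<bar>net S qk [Suc k..<Suc K] F x - net S qk [Suc k..<Suc K] F x'\<bar> \<le> (1 + 0 * real (Suc K - Suc k)) * 0"
      proof (rule net_lipschitz[OF st, where A="\<lambda>i u v. u = v"])
        fix k and z z' :: "nat \<Rightarrow> nat \<Rightarrow> real" assume k: "k \<in> {1..K}" and zz: "\<And>i. i \<in> {1..<k} \<Longrightarrow> z i = z' i"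
        have "z i = z' i" if "i \<in> pa G k" for i using zz[of i] that pa_less(3)[of k] by auto
        then have "cp k z = cp k z'" by (simp add: cp_def cong: restrict_cong)
        then show "(\<Sum>y\<in>S k. \<bar>qk k z y - qk k z' y\<bar>) \<le> 0 * 0" by (simp add: ker_def)
      next
        fix z z' :: "nat \<Rightarrow> nat \<Rightarrow> real"
        assume "grid_pt S (Suc K) z" "grid_pt S (Suc K) z'" "\<And>i. i \<in> {1..K} \<Longrightarrow> z i = z' i"
        then have "F z = F z'" by (rule F(3))
        then show "\<bar>F z - F z'\<bar> \<le> 0" by simp
      qed (use F(1) k that in auto)
      then show ?thesis by simp
    qed
    show "\<bar>net S qk [Suc k..<Suc K] F x - net S qk [Suc k..<Suc K] F x'\<bar> \<le> (1 + 6 * L * real K) * (1/2)^m"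
      if "grid_pt S (Suc k) x" "grid_pt S (Suc k) x'" "\<And>i. i \<in> {1..k} \<Longrightarrow> dyad d m i (x i) = dyad d m i (x' i)" for x x'
    proof -
      have "\<bar>net S qk [Suc k..<Suc K] F x - net S qk [Suc k..<Suc K] F x'\<bar> \<le> (1 + 6 * L * real (Suc K - Suc k)) * (1/2)^m"
        by (rule net_lipschitz[OF st, where A="\<lambda>i u v. dyad d m i u = dyad d m i v"])
          (use F(1) F(2)[OF m_J] ker_lip[OF m_J] L k that in auto)
      also have "\<dots> \<le> (1 + 6 * L * real K) * (1/2)^m"
        using L by (intro mult_right_mono add_left_mono mult_left_mono) auto
      finally show ?thesis .
    qed
  qed (use L in auto)
qed auto

end

section \<open>Empirical means\<close>

text \<open>Nonnegativity of the variance of \<open>\<bar>Z x\<bar>\<close>.\<close>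

lemma (in prob_space) integral_abs_le_sqrt:
  fixes Z :: "'a \<Rightarrow> real"
  assumes "bounded_meas M Z"
  shows "(\<integral>x. \<bar>Z x\<bar> \<partial>M) \<le> sqrt (\<integral>x. (Z x)^2 \<partial>M)"
proof -
  define c where "c = (\<integral>x. \<bar>Z x\<bar> \<partial>M)"
  have int: "integrable M (\<lambda>x. \<bar>Z x\<bar>)" "integrable M (\<lambda>x. (Z x)^2)"
    unfolding power2_eq_square by (intro bounded_meas_integrable bounded_meas_intros assms)+
  have "0 \<le> (\<integral>x. (\<bar>Z x\<bar> - c)^2 \<partial>M)" by (intro integral_nonneg_AE AE_I2) auto
  also have "(\<integral>x. (\<bar>Z x\<bar> - c)^2 \<partial>M) = (\<integral>x. (Z x)^2 - 2 * c * \<bar>Z x\<bar> + c^2 \<partial>M)"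
    by (intro Bochner_Integration.integral_cong) (auto simp: power2_eq_square algebra_simps)
  also have "\<dots> = (\<integral>x. (Z x)^2 \<partial>M) - c^2"
    using int by (simp add: prob_space c_def[symmetric] power2_eq_square)
  finally have "c^2 \<le> (\<integral>x. (Z x)^2 \<partial>M)" by simp
  then show ?thesis unfolding c_def[symmetric] by (rule real_le_rsqrt)
qed

lemma bounded_meas_component:
  assumes "bounded_meas M f" "i \<in> I"
  shows "bounded_meas (PiM I (\<lambda>_. M)) (\<lambda>s. f (s i))"
proof -
  obtain B where "\<forall>x\<in>space M. \<bar>f x\<bar> \<le> B" using assms(1) by (auto simp: bounded_meas_def)
  moreover have "(\<lambda>s. f (s i)) \<in> borel_measurable (PiM I (\<lambda>_. M))"
    using assms by (intro measurable_compose[OF measurable_component_singleton]) (auto simp: bounded_meas_def)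
  ultimately show ?thesis using assms(2) by (auto simp: bounded_meas_def space_PiM)
qed

text \<open>As \<open>f\<close> has values in \<open>[0, 1]\<close>, its variance is at most its
  mean. Keeping the mean under the root, instead of a universal constant, lets the bounds for the
  cells of a partition be summed by \<open>sum_sqrt_le\<close>.\<close>

lemma empirical_mean_deviation:
  fixes f :: "'a \<Rightarrow> real" and n :: nat
  assumes M: "prob_space M" and n: "n \<ge> 1"
    and f: "f \<in> borel_measurable M" "\<And>x. x \<in> space M \<Longrightarrow> 0 \<le> f x" "\<And>x. x \<in> space M \<Longrightarrow> f x \<le> 1"
  shows "(\<integral>s. \<bar>(\<Sum>i<n. f (s i)) / n - (\<integral>x. f x \<partial>M)\<bar> \<partial>PiM {..<n} (\<lambda>_. M)) \<le> sqrt ((\<integral>x. f x \<partial>M) / n)"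
proof -
  interpret M: prob_space M by fact
  interpret P: product_prob_space "\<lambda>_. M" "{..<n}" ..
  let ?N = "PiM {..<n} (\<lambda>_. M)"
  have bf: "bounded_meas M f" using f by (auto simp: bounded_meas_def intro!: exI[of _ 1])
  define a where "a = (\<integral>x. f x \<partial>M)"
  define g where "g x = f x - a" for x
  have bg: "bounded_meas M g" unfolding g_def[abs_def] by (intro bounded_meas_intros bf)
  have g0: "(\<integral>x. g x \<partial>M) = 0"
    unfolding g_def using M.bounded_meas_integrable[OF bf] by (simp add: a_def M.prob_space)
  have g2: "(\<integral>x. g x * g x \<partial>M) \<le> a"
  proof -
    have "(\<integral>x. g x * g x \<partial>M) = (\<integral>x. f x * f x - 2 * a * f x + a * a \<partial>M)"
      by (intro Bochner_Integration.integral_cong) (auto simp: g_def algebra_simps)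
    also have "\<dots> = (\<integral>x. f x * f x \<partial>M) - a * a"
      using M.bounded_meas_integrable[OF bf] M.bounded_meas_integrable[OF bounded_meas_mult[OF bf bf]]
      by (simp add: a_def[symmetric] M.prob_space)
    also have "\<dots> \<le> (\<integral>x. f x * f x \<partial>M)" by simp
    also have "\<dots> \<le> (\<integral>x. f x \<partial>M)"
      using f(2,3) by (intro integral_mono M.bounded_meas_integrable bounded_meas_mult bf) (auto intro: mult_left_le)
    finally show ?thesis by (simp add: a_def)
  qed
  have pair: "(\<integral>s. g (s i) * g (s j) \<partial>?N) = (if i = j then (\<integral>x. g x * g x \<partial>M) else 0)" if ij: "i < n" "j < n" for i j
  proof -
    \<comment> \<open>The product \<open>g (s i) * g (s j)\<close> is spread over all coordinates,
      with factor 1 elsewhere, so that the integral of a product of coordinate functions applies to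
      \<open>i = j\<close> and \<open>i \<noteq> j\<close> alike.\<close>
    define h where "h l x = (if l = i then g x else 1) * (if l = j then g x else 1)" for l x
    have bh: "bounded_meas M (h l)" for l
      unfolding h_def[abs_def] using bg
      by (cases "l = i"; cases "l = j") (auto intro!: bounded_meas_mult bounded_meas_const)
    have "(\<Prod>l<n. h l (s l)) = g (s i) * g (s j)" for s
    proof -
      have "(\<Prod>l<n. h l (s l)) = (\<Prod>l<n. if l = i then g (s i) else 1) * (\<Prod>l<n. if l = j then g (s j) else 1)"
        unfolding h_def prod.distrib by (intro arg_cong2[where f=times] prod.cong) auto
      then show ?thesis using ij by simp
    qed
    then have "(\<integral>s. g (s i) * g (s j) \<partial>?N) = (\<integral>s. (\<Prod>l\<in>{..<n}. h l (s l)) \<partial>?N)" by simp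
    also have "\<dots> = (\<Prod>l\<in>{..<n}. \<integral>x. h l x \<partial>M)"
      by (rule P.product_integral_prod) (auto intro: M.bounded_meas_integrable bh)
    also have "\<dots> = (if i = j then (\<integral>x. g x * g x \<partial>M) else 0)"
    proof (cases "i = j")
      case True
      have "(\<Prod>l\<in>{..<n}. \<integral>x. h l x \<partial>M) = (\<Prod>l\<in>{..<n}. if l = i then (\<integral>x. g x * g x \<partial>M) else 1)"
        using True by (intro prod.cong refl) (auto simp: h_def M.prob_space)
      then show ?thesis using True ij by simp
    next
      case False
      have "(\<integral>x. h i x \<partial>M) = 0" using False g0 by (simp add: h_def)
      then show ?thesis using False ij by (auto intro!: prod_zero)
    qed
    finally show ?thesis .
  qed
  define Z where "Z s = (\<Sum>i<n. f (s i)) / n - a" for s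
  have Z_eq: "Z s = (1 / n) * (\<Sum>i<n. g (s i))" for s
    using n by (simp add: Z_def g_def sum_subtractf diff_divide_distrib)
  have bgi: "bounded_meas ?N (\<lambda>s. g (s i))" if "i < n" for i
    using that by (intro bounded_meas_component[OF bg]) auto
  have bZ: "bounded_meas ?N Z"
    unfolding Z_eq[abs_def] by (intro bounded_meas_intros bgi) auto
  have "(\<integral>s. (Z s)^2 \<partial>?N) = (\<integral>s. (\<Sum>i<n. \<Sum>j<n. (1 / n)^2 * (g (s i) * g (s j))) \<partial>?N)"
    unfolding Z_eq by (simp add: power2_eq_square sum_product sum_distrib_left mult_ac)
  also have "\<dots> = (\<Sum>i<n. \<Sum>j<n. (1 / n)^2 * (\<integral>s. g (s i) * g (s j) \<partial>?N))"
  proof -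
    have bij: "bounded_meas ?N (\<lambda>s. (1 / n)^2 * (g (s i) * g (s j)))" if "i < n" "j < n" for i j
      by (intro bounded_meas_intros bgi that)
    have "(\<integral>s. (\<Sum>i<n. \<Sum>j<n. (1 / n)^2 * (g (s i) * g (s j))) \<partial>?N)
      = (\<Sum>i<n. \<integral>s. (\<Sum>j<n. (1 / n)^2 * (g (s i) * g (s j))) \<partial>?N)"
      by (rule Bochner_Integration.integral_sum, rule P.bounded_meas_integrable, rule bounded_meas_sum, rule bij) auto
    also have "\<dots> = (\<Sum>i<n. \<Sum>j<n. \<integral>s. (1 / n)^2 * (g (s i) * g (s j)) \<partial>?N)"
      by (intro sum.cong refl Bochner_Integration.integral_sum P.bounded_meas_integrable bij) auto
    finally show ?thesis by simp
  qed
  also have "\<dots> = (\<Sum>i<n. \<Sum>j<n. if j = i then (1 / n)^2 * (\<integral>x. g x * g x \<partial>M) else 0)"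
    by (intro sum.cong refl) (auto simp: pair)
  also have "\<dots> = (\<integral>x. g x * g x \<partial>M) / n"
    using n by (simp add: power2_eq_square field_simps)
  also have "\<dots> \<le> a / n" using g2 by (intro divide_right_mono) auto
  finally have "(\<integral>s. (Z s)^2 \<partial>?N) \<le> a / n" .
  with P.integral_abs_le_sqrt[OF bZ] show ?thesis
    unfolding Z_def a_def by (meson order_trans real_sqrt_le_mono)
qed

text \<open>Cauchy-Schwarz against the constant 1; the result depends on the number of cells and not
  on their probabilities.\<close>

lemma sum_sqrt_le:
  assumes "finite C" "\<And>c. c \<in> C \<Longrightarrow> 0 \<le> a c" "(\<Sum>c\<in>C. a c) \<le> 1" "0 < r"
  shows "(\<Sum>c\<in>C. sqrt (a c / r)) \<le> sqrt (real (card C) / r)"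
proof -
  have "(\<Sum>c\<in>C. sqrt (a c))^2 \<le> (\<Sum>c\<in>C. 1^2) * (\<Sum>c\<in>C. (sqrt (a c))^2)"
    using Cauchy_Schwarz_ineq_sum[of "\<lambda>_. 1" "\<lambda>c. sqrt (a c)" C] by simp
  also have "\<dots> = real (card C) * (\<Sum>c\<in>C. a c)" using assms(2) by simp
  also have "\<dots> \<le> real (card C) * 1" using assms(3) by (intro mult_left_mono) auto
  finally have "(\<Sum>c\<in>C. sqrt (a c)) \<le> sqrt (real (card C))" by (simp add: real_le_rsqrt)
  then have "(\<Sum>c\<in>C. sqrt (a c)) / sqrt r \<le> sqrt (real (card C)) / sqrt r"
    using assms(4) by (intro divide_right_mono) auto
  then show ?thesis by (simp add: real_sqrt_divide sum_divide_distrib)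
qed

section \<open>The estimator\<close>

context dyad_net
begin

definition emp :: "nat \<Rightarrow> (nat \<Rightarrow> nat \<Rightarrow> nat \<Rightarrow> real) \<Rightarrow> (nat \<Rightarrow> nat \<Rightarrow> real) \<Rightarrow> real" where
  "emp n s x = (\<Sum>i<n. of_bool (rnd (s i) = x)) / n"

text \<open>\<open>q1\<close> only matters where no observation falls into the cell of the parents.\<close>

definition q1 :: "nat \<Rightarrow> (nat \<Rightarrow> nat \<Rightarrow> real) \<Rightarrow> (nat \<Rightarrow> real) \<Rightarrow> real" where
  "q1 k c v = of_bool (v = dyad d m k (SOME y. y \<in> dgrid d J k))"

definition est_ker :: "nat \<Rightarrow> (nat \<Rightarrow> nat \<Rightarrow> nat \<Rightarrow> real) \<Rightarrow> nat \<Rightarrow> (nat \<Rightarrow> nat \<Rightarrow> real) \<Rightarrow> (nat \<Rightarrow> real) \<Rightarrow> real" where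
  "est_ker n s = ker (cond_coarse (emp n s) q1) (cond_fine (emp n s))"

text \<open>Started at the everywhere undefined point, the network reaches only extensional points,
  that is, elements of \<open>\<Omega>\<close>.\<close>

definition est_weight :: "nat \<Rightarrow> (nat \<Rightarrow> nat \<Rightarrow> nat \<Rightarrow> real) \<Rightarrow> (nat \<Rightarrow> nat \<Rightarrow> real) \<Rightarrow> real" where
  "est_weight n s x = net (dgrid d J) (est_ker n s) [1..<Suc K] (\<lambda>z. of_bool (z = x)) (\<lambda>_. undefined)"

definition est :: "nat \<Rightarrow> (nat \<Rightarrow> nat \<Rightarrow> nat \<Rightarrow> real) \<Rightarrow> (nat \<Rightarrow> nat \<Rightarrow> real) measure" where
  "est n s = discrete_measure (cube d {1..K}) \<Omega> (est_weight n s)"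

lemma emp_nonneg: "0 \<le> emp n s x"
  by (simp add: emp_def sum_nonneg)

lemma emp_compat: "compat (emp n s) (cond_coarse (emp n s) q1) (cond_fine (emp n s))"
  by (intro compat_cond emp_nonneg)

lemma emp_stoch: "stoch (cond_coarse (emp n s) q1) (cond_fine (emp n s))"
proof (intro stoch_cond emp_nonneg)
  fix k c
  have "(SOME y. y \<in> dgrid d J k) \<in> dgrid d J k" using ne_S by (simp add: some_in_eq)
  then have "dyad d m k (SOME y. y \<in> dgrid d J k) \<in> cells m k" by (rule cells_in)
  then show "(\<Sum>v\<in>cells m k. q1 k c v) = 1" by (simp add: q1_def of_bool_def)
qed (simp add: q1_def)

lemma est_stochastic: "stochastic K (dgrid d J) (est_ker n s)"
  unfolding est_ker_def by (rule ker_stochastic[OF emp_stoch])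

lemma E_emp:
  assumes n: "n \<ge> 1" and s: "\<And>i. i < n \<Longrightarrow> rnd (s i) \<in> \<Omega>"
  shows "E (emp n s) F = (\<Sum>i<n. F (rnd (s i))) / n"
proof -
  have "E (emp n s) F = (\<Sum>x\<in>\<Omega>. \<Sum>i<n. of_bool (rnd (s i) = x) * F x) / n"
    by (simp add: E_def emp_def sum_divide_distrib sum_distrib_right)
  also have "(\<Sum>x\<in>\<Omega>. \<Sum>i<n. of_bool (rnd (s i) = x) * F x) = (\<Sum>i<n. \<Sum>x\<in>\<Omega>. of_bool (rnd (s i) = x) * F x)"
    by (rule sum.swap)
  also have "\<dots> = (\<Sum>i<n. \<Sum>x\<in>\<Omega>. if x = rnd (s i) then F x else 0)"
    by (intro sum.cong refl) auto
  also have "\<dots> = (\<Sum>i<n. F (rnd (s i)))" using fin_\<Omega> s by simp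
  finally show ?thesis .
qed

lemma emp_sum:
  assumes "n \<ge> 1" "\<And>i. i < n \<Longrightarrow> rnd (s i) \<in> \<Omega>"
  shows "(\<Sum>x\<in>\<Omega>. emp n s x) = 1"
  using E_emp[of n s "\<lambda>_. 1"] assms by (simp add: E_def)

lemma grid_ext_\<Omega>:
  assumes "grid_pt (dgrid d J) (Suc K) z" "\<And>i. i \<notin> {1..<Suc K} \<Longrightarrow> z i = undefined"
  shows "z \<in> \<Omega>"
  using assms by (auto simp: \<Omega>_def grid_pt_def PiE_def extensional_def)

text \<open>Linearity of \<open>net\<close>, with \<open>f\<close> expanded in indicators. It turns
  means under the estimator into network integrals, to which \<open>net_deviation\<close>
  applies.\<close>

lemma est_weight_sum: "(\<Sum>x\<in>\<Omega>. est_weight n s x * f x) = net (dgrid d J) (est_ker n s) [1..<Suc K] f (\<lambda>_. undefined)"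
proof -
  have "(\<Sum>x\<in>\<Omega>. est_weight n s x * f x)
    = net (dgrid d J) (est_ker n s) [1..<Suc K] (\<lambda>z. \<Sum>x\<in>\<Omega>. f x * of_bool (z = x)) (\<lambda>_. undefined)"
    unfolding net_sum net_cmult est_weight_def by (simp add: mult.commute)
  also have "\<dots> = net (dgrid d J) (est_ker n s) [1..<Suc K] f (\<lambda>_. undefined)"
  proof (rule net_cong[OF est_stochastic])
    fix z assume "grid_pt (dgrid d J) (Suc K) z" "\<And>i. i \<notin> {1..<Suc K} \<Longrightarrow> z i = (undefined :: nat \<Rightarrow> real)"
    then have z: "z \<in> \<Omega>" by (rule grid_ext_\<Omega>)
    have "(\<Sum>x\<in>\<Omega>. f x * of_bool (z = x)) = (\<Sum>x\<in>\<Omega>. if x = z then f x else 0)"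
      by (intro sum.cong) auto
    then show "(\<Sum>x\<in>\<Omega>. f x * of_bool (z = x)) = f z" using fin_\<Omega> z by simp
  qed (auto simp: grid_pt_def)
  finally show ?thesis .
qed

lemma est_weight_total: "(\<Sum>x\<in>\<Omega>. est_weight n s x) = 1"
proof -
  have "net (dgrid d J) (est_ker n s) [1..<Suc K] (\<lambda>_. 1) (\<lambda>_. undefined) = 1"
    by (rule net_const[OF est_stochastic]) (auto simp: grid_pt_def)
  then show ?thesis using est_weight_sum[of n s "\<lambda>_. 1"] by simp
qed

lemma est_weight_nonneg: "0 \<le> est_weight n s x"
proof -
  have "net (dgrid d J) (est_ker n s) [1..<Suc K] (\<lambda>_. 0) (\<lambda>_. undefined) \<le> est_weight n s x"
    unfolding est_weight_def by (rule net_mono[OF est_stochastic]) (auto simp: grid_pt_def)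
  then show ?thesis by (simp only: net_zero)
qed

lemma \<Omega>_space: "\<Omega> \<subseteq> space (cube d {1..K})"
  unfolding \<Omega>_def space_cube by (intro PiE_mono subsetI dgrid_unit)

lemma est_prob: "prob_space (est n s)"
proof
  have "emeasure (est n s) (space (est n s)) = (\<Sum>x\<in>\<Omega>. ennreal (est_weight n s x))"
    unfolding est_def using \<Omega>_space fin_\<Omega>
    by (subst emeasure_discrete_measure) (auto simp: indicator_def subset_iff intro!: sum.cong)
  also have "\<dots> = 1" using est_weight_nonneg est_weight_total by (simp add: sum_ennreal)
  finally show "emeasure (est n s) (space (est n s)) = 1" .
qed

lemma measurable_net:
  assumes "\<And>k x y. k \<in> set l \<Longrightarrow> (\<lambda>s. q s k x y) \<in> borel_measurable N"
  shows "(\<lambda>s. net S' (q s) l F x) \<in> borel_measurable N"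
  using assms
proof (induction l arbitrary: x)
  case (Cons k l)
  have "(\<lambda>s. net S' (q s) l F x) \<in> borel_measurable N" for x
    by (intro Cons.IH Cons.prems) simp
  then show ?case
    using Cons.prems unfolding net_Cons net_step_def
    by (intro borel_measurable_sum borel_measurable_times) auto
qed simp

lemma measurable_emp: "(\<lambda>s. emp n s x) \<in> borel_measurable (PiM {..<n} (\<lambda>_. cube d {1..K}))"
proof -
  have "(\<lambda>s. of_bool (rnd (s i) = x) :: real) \<in> borel_measurable (PiM {..<n} (\<lambda>_. cube d {1..K}))" if "i < n" for i
  proof -
    have S: "{z \<in> space (cube d {1..K}). rnd z = x} \<in> sets (cube d {1..K})"
      unfolding rnd_def by (rule sets_dyad_cell) simp
    have "(\<lambda>s. s i) \<in> PiM {..<n} (\<lambda>_. cube d {1..K}) \<rightarrow>\<^sub>M cube d {1..K}"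
      using that by (intro measurable_component_singleton) auto
    from measurable_compose[OF this borel_measurable_indicator[OF S]]
    have meas: "(\<lambda>s. indicator {z \<in> space (cube d {1..K}). rnd z = x} (s i) :: real)
      \<in> borel_measurable (PiM {..<n} (\<lambda>_. cube d {1..K}))" .
    have eq: "indicator {z \<in> space (cube d {1..K}). rnd z = x} (s i) = (of_bool (rnd (s i) = x) :: real)"
      if "s \<in> space (PiM {..<n} (\<lambda>_. cube d {1..K}))" for s
      using that \<open>i < n\<close> by (auto simp: space_PiM indicator_def)
    from meas show ?thesis
      by (subst (asm) measurable_cong[where g="\<lambda>s. of_bool (rnd (s i) = x)"]) (rule eq)
  qed
  then show ?thesis unfolding emp_def by (intro borel_measurable_divide borel_measurable_sum) auto
qed

lemma measurable_E_emp: "(\<lambda>s. E (emp n s) F) \<in> borel_measurable (PiM {..<n} (\<lambda>_. cube d {1..K}))"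
  unfolding E_def by (intro borel_measurable_sum borel_measurable_times measurable_emp) auto

text \<open>A network integral is a finite expression in its kernel entries, and these are quotients
  of empirical frequencies with a case distinction on a zero denominator.\<close>

lemma measurable_est_weight: "(\<lambda>s. est_weight n s x) \<in> borel_measurable (PiM {..<n} (\<lambda>_. cube d {1..K}))"
  unfolding est_weight_def est_ker_def
proof (rule measurable_net)
  fix k x y
  note [measurable] = measurable_E_emp
  show "(\<lambda>s. ker (cond_coarse (emp n s) q1) (cond_fine (emp n s)) k x y) \<in> borel_measurable (PiM {..<n} (\<lambda>_. cube d {1..K}))"
    unfolding ker_def cond_coarse_def cond_fine_def by measurable
qed

lemma measurable_est: "est n \<in> PiM {..<n} (\<lambda>_. cube d {1..K}) \<rightarrow>\<^sub>M prob_algebra (cube d {1..K})"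
proof (rule measurable_prob_algebraI[OF est_prob])
  show "est n \<in> PiM {..<n} (\<lambda>_. cube d {1..K}) \<rightarrow>\<^sub>M subprob_algebra (cube d {1..K})"
  proof (rule measurable_subprob_algebra)
    show "subprob_space (est n s)" for s using est_prob by (rule prob_space_imp_subprob_space)
    show "sets (est n s) = sets (cube d {1..K})" for s by (simp add: est_def)
    show "(\<lambda>s. emeasure (est n s) A) \<in> borel_measurable (PiM {..<n} (\<lambda>_. cube d {1..K}))"
      if A: "A \<in> sets (cube d {1..K})" for A
      unfolding est_def emeasure_discrete_measure[OF fin_\<Omega> \<Omega>_space A]
      by (intro borel_measurable_sum borel_measurable_times_ennreal measurable_compose[OF measurable_est_weight measurable_ennreal]) auto
  qed
qed

lemma card_cells: "j \<le> J \<Longrightarrow> card (cells j k) \<le> 2 ^ ((j + 1) * d k)"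
proof -
  assume j: "j \<le> J"
  have "cells j k \<subseteq> dgrid d j k" using dyad_in_dgrid dgrid_unit by (auto simp: cells_def)
  then have "card (cells j k) \<le> card (dgrid d j k)" by (intro card_mono finite_dgrid)
  then show ?thesis using card_dgrid order_trans by blast
qed

lemma card_pa_cells: "card (pa_cells k) \<le> 2 ^ ((m + 1) * (\<Sum>i\<in>pa G k. d i))"
proof -
  have "card (pa_cells k) = (\<Prod>i\<in>pa G k. card (cells m i))"
    unfolding pa_cells_def using fin_pa by (rule card_PiE)
  also have "\<dots> \<le> (\<Prod>i\<in>pa G k. 2 ^ ((m + 1) * d i))"
    using card_cells[OF m_J] by (intro prod_mono) auto
  also have "\<dots> = 2 ^ ((m + 1) * (\<Sum>i\<in>pa G k. d i))"
    by (simp add: power_sum sum_distrib_left)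
  finally show ?thesis .
qed

end

lemma discrete_measure_cong: "sets M = sets N \<Longrightarrow> discrete_measure M S w = discrete_measure N S w"
  unfolding discrete_measure_def by (intro distr_cong) auto

section \<open>The risk of the estimator\<close>

context tv_net
begin

abbreviation sample :: "nat \<Rightarrow> (nat \<Rightarrow> nat \<Rightarrow> nat \<Rightarrow> real) measure" where
  "sample n \<equiv> PiM {..<n} (\<lambda>_. \<mu>)"

definition bias_const :: real where
  "bias_const = real K * (4 * (2 * L * (1/2)^m) * ((1 + 6 * L * real K) * (1/2)^m + 2 * L * (1/2)^m))"

definition dev_sum :: "nat \<Rightarrow> (nat \<Rightarrow> nat \<Rightarrow> nat \<Rightarrow> real) \<Rightarrow> real" where
  "dev_sum n s = (\<Sum>k=1..K. \<Sum>j\<le>J. (1 + 6 * L * real K) * (2 * (1/2)^j) *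
          (2 * dev_joint p (emp n s) k (min j m) + 2 * dev_marg p (emp n s) k j))"

text \<open>The three terms are rounding, bias and deviation. Duality reduces the claim to a bound
  for a single Lipschitz function, and neither \<open>bias_const\<close> nor \<open>dev_sum\<close>
  depends on that function.\<close>

lemma wasserstein_est_le:
  assumes K: "1 \<le> K" and n: "n \<ge> 1" and s: "\<And>i. i < n \<Longrightarrow> s i \<in> space \<mu>"
  shows "wasserstein (sup_dist d {1..K}) \<mu> (est n s) \<le> ennreal ((1/2)^J + (bias_const + dev_sum n s))"
proof -
  have I: "finite {1..K}" "{1..K} \<noteq> {}" "\<And>k. k \<in> {1..K} \<Longrightarrow> 1 \<le> d k" using K d1 by auto
  let ?\<rho> = "sup_dist d {1..K}"
  have rho_nn: "0 \<le> ?\<rho> x y" for x y by (rule sup_dist_nonneg) (use I in auto)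
  have rho_tri: "?\<rho> x z \<le> ?\<rho> x y + ?\<rho> y z" for x y z by (rule sup_dist_triangle) (use I in auto)
  have rho_le: "?\<rho> x y \<le> r" if "\<And>k i. k \<in> {1..K} \<Longrightarrow> i < d k \<Longrightarrow> \<bar>x k i - y k i\<bar> \<le> r" for x y r
    by (rule sup_dist_le) (use I that in auto)
  have rho_dyad: "?\<rho> x y \<le> (1/2)^j" if "\<And>k. k \<in> {1..K} \<Longrightarrow> dyad d j k (x k) = dyad d j k (y k)" for x y j
    by (rule sup_dist_dyad_le) (use I that in auto)
  have ne: "\<Omega> \<noteq> {}" using ne_S by (simp add: \<Omega>_def PiE_eq_empty_iff)
  have \<Omega>sp: "x \<in> space \<mu>" if "x \<in> \<Omega>" for x using \<Omega>_space that by (auto simp: space_\<mu>)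
  have rho1: "?\<rho> x y \<le> 1" if "x \<in> \<Omega>" "y \<in> \<Omega>" for x y
  proof (rule rho_le)
    fix k i assume ki: "k \<in> {1..K}" "i < d k"
    have "x k i \<in> {0..1}" "y k i \<in> {0..1}"
      using \<Omega>_space that ki unfolding space_cube by (auto simp: subset_iff PiE_iff)
    then show "\<bar>x k i - y k i\<bar> \<le> 1" by auto
  qed
  have "wasserstein ?\<rho> \<mu> (discrete_measure \<mu> \<Omega> (est_weight n s)) \<le> ennreal ((1/2)^J + (bias_const + dev_sum n s))"
  proof (rule wasserstein_discrete_le[OF \<mu>.prob_space_axioms fin_\<Omega> ne _ _ rnd_in sets_rnd est_weight_nonneg est_weight_total])
    show "\<Omega> \<subseteq> space \<mu>" using \<Omega>sp by auto
    show "{x} \<in> sets \<mu>" if "x \<in> \<Omega>" for x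
      using \<Omega>sp[OF that] sets_singleton_cube[where I="{1..K}" and x=x and d=d] by (simp add: sets_\<mu> space_\<mu>)
    show "?\<rho> x x = 0" if "x \<in> \<Omega>" for x
      using rho_le[of x x 0] rho_nn[of x x] by simp
    show "?\<rho> x z \<le> ?\<rho> x y + ?\<rho> y z" for x y z by (rule rho_tri)
    show "?\<rho> x y \<le> (1/2)^J + ?\<rho> (rnd x) y" if "x \<in> space \<mu>" for x y
    proof -
      have "?\<rho> x (rnd x) \<le> (1/2)^J"
        by (rule rho_dyad) (simp add: rnd_at dyad_dyad)
      then show ?thesis using rho_tri[of x y "rnd x"] by linarith
    qed
    show "0 \<le> ?\<rho> x y" for x y by (rule rho_nn)
    fix f assume f: "\<And>x y. x \<in> \<Omega> \<Longrightarrow> y \<in> \<Omega> \<Longrightarrow> f x - f y \<le> ?\<rho> x y"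
    obtain xs where xs: "xs \<in> \<Omega>" using ne by auto
    \<comment> \<open>Subtracting the constant makes \<open>F\<close> bounded by 1, the diameter of
      the cube, and changes both means by the same amount; the restriction extends \<open>f\<close>
      to total functions.\<close>
    define F where "F z = f (restrict z {1..K}) - f xs" for z
    have rz: "restrict z {1..K} \<in> \<Omega>" if "grid_pt S (Suc K) z" for z
      using that by (auto simp: \<Omega>_def grid_pt_def)
    have sym: "?\<rho> x y = ?\<rho> y x" for x y by (simp add: sup_dist_def abs_minus_commute)
    have fabs: "\<bar>f x - f y\<bar> \<le> ?\<rho> x y" if "x \<in> \<Omega>" "y \<in> \<Omega>" for x y
      using f[OF that] f[OF that(2,1)] sym[of x y] by (simp add: abs_le_iff)
    have F1: "\<bar>F z\<bar> \<le> 1" if "grid_pt S (Suc K) z" for z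
      unfolding F_def using fabs[OF rz[OF that] xs] rho1[OF rz[OF that] xs] by linarith
    have F2: "\<bar>F z - F z'\<bar> \<le> (1/2)^j" if "grid_pt S (Suc K) z" "grid_pt S (Suc K) z'"
      "\<And>i. i \<in> {1..K} \<Longrightarrow> dyad d j i (z i) = dyad d j i (z' i)" for j z z'
    proof -
      have "\<bar>F z - F z'\<bar> \<le> ?\<rho> (restrict z {1..K}) (restrict z' {1..K})"
        unfolding F_def using fabs[OF rz[OF that(1)] rz[OF that(2)]] by simp
      also have "\<dots> \<le> (1/2)^j" by (rule rho_dyad) (use that(3) in auto)
      finally show ?thesis .
    qed
    have F3: "F z = F z'" if "\<And>i. i \<in> {1..K} \<Longrightarrow> z i = z' i" for z z'
    proof -
      have "restrict z {1..K} = restrict z' {1..K}" using that by (intro restrict_ext) auto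
      then show ?thesis by (simp add: F_def)
    qed
    have s': "\<And>i. i < n \<Longrightarrow> rnd (s i) \<in> \<Omega>" using s rnd_in by blast
    have b: "\<bar>E p F - net S qk [1..<Suc K] F (\<lambda>_. undefined)\<bar> \<le> bias_const"
      unfolding bias_const_def by (rule bias) (use F1 F2 F3 in blast)+
    have v: "\<bar>net S (ker (cond_coarse (emp n s) q1) (cond_fine (emp n s))) [1..<Suc K] F (\<lambda>_. undefined)
        - net S qk [1..<Suc K] F (\<lambda>_. undefined)\<bar> \<le> dev_sum n s"
      unfolding dev_sum_def
      by (rule net_deviation[OF q_compat q_stoch emp_compat emp_stoch emp_nonneg emp_sum[OF n s'] F1 F2 ker_lip]) (use L in auto)
    have EF: "E p F = (\<Sum>x\<in>\<Omega>. measure \<mu> {z \<in> space \<mu>. rnd z = x} * f x) - f xs"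
    proof -
      have "E p F = (\<Sum>x\<in>\<Omega>. p x * (f x - f xs))"
        unfolding E_def F_def by (intro sum.cong refl) (auto simp: \<Omega>_def PiE_restrict)
      also have "\<dots> = (\<Sum>x\<in>\<Omega>. p x * f x) - (\<Sum>x\<in>\<Omega>. p x) * f xs"
        by (simp add: right_diff_distrib sum_subtractf sum_distrib_right)
      finally show ?thesis unfolding p_sum by (simp add: p_def)
    qed
    have WF: "net S (ker (cond_coarse (emp n s) q1) (cond_fine (emp n s))) [1..<Suc K] F (\<lambda>_. undefined)
      = (\<Sum>x\<in>\<Omega>. est_weight n s x * f x) - f xs"
    proof -
      have "net S (ker (cond_coarse (emp n s) q1) (cond_fine (emp n s))) [1..<Suc K] F (\<lambda>_. undefined)
        = (\<Sum>x\<in>\<Omega>. est_weight n s x * F x)"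
        unfolding est_weight_sum est_ker_def ..
      also have "\<dots> = (\<Sum>x\<in>\<Omega>. est_weight n s x * (f x - f xs))"
        unfolding F_def by (intro sum.cong refl) (auto simp: \<Omega>_def PiE_restrict)
      also have "\<dots> = (\<Sum>x\<in>\<Omega>. est_weight n s x * f x) - (\<Sum>x\<in>\<Omega>. est_weight n s x) * f xs"
        by (simp add: right_diff_distrib sum_subtractf sum_distrib_right)
      finally show ?thesis by (simp add: est_weight_total)
    qed
    show "(\<Sum>x\<in>\<Omega>. measure \<mu> {z \<in> space \<mu>. rnd z = x} * f x) - (\<Sum>x\<in>\<Omega>. est_weight n s x * f x) \<le> bias_const + dev_sum n s"
      using b v unfolding EF WF by linarith
  qed auto
  then show ?thesis unfolding est_def discrete_measure_cong[OF sets_\<mu>] .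
qed

lemma emp_dev_bounded:
  assumes n: "n \<ge> 1"
  shows "bounded_meas (sample n) (\<lambda>s. E (emp n s) (\<lambda>x. of_bool (P x)) - E p (\<lambda>x. of_bool (P x)))"
    and "(\<integral>s. \<bar>E (emp n s) (\<lambda>x. of_bool (P x)) - E p (\<lambda>x. of_bool (P x))\<bar> \<partial>sample n)
      \<le> sqrt (E p (\<lambda>x. of_bool (P x)) / n)"
proof -
  have fm: "(\<lambda>z. of_bool (P (rnd z)) :: real) \<in> borel_measurable \<mu>"
    by (rule measurable_compose[OF measurable_rnd]) simp
  then have bf: "bounded_meas \<mu> (\<lambda>z. of_bool (P (rnd z)))"
    by (auto simp: bounded_meas_def intro!: exI[of _ 1])
  have Ee: "E (emp n s) (\<lambda>x. of_bool (P x)) = (\<Sum>i<n. of_bool (P (rnd (s i)))) / n" if "s \<in> space (sample n)" for s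
    using that rnd_in by (intro E_emp n) (auto simp: space_PiM)
  have b: "bounded_meas (sample n) (\<lambda>s. (\<Sum>i<n. of_bool (P (rnd (s i)))) / n - E p (\<lambda>x. of_bool (P x)))"
    unfolding divide_inverse
    by (intro bounded_meas_intros bounded_meas_component[OF bf]) auto
  then show "bounded_meas (sample n) (\<lambda>s. E (emp n s) (\<lambda>x. of_bool (P x)) - E p (\<lambda>x. of_bool (P x)))"
    using Ee by (simp add: bounded_meas_def cong: measurable_cong)
  have "(\<integral>s. \<bar>E (emp n s) (\<lambda>x. of_bool (P x)) - E p (\<lambda>x. of_bool (P x))\<bar> \<partial>sample n)
     = (\<integral>s. \<bar>(\<Sum>i<n. of_bool (P (rnd (s i)))) / n - (\<integral>z. of_bool (P (rnd z)) \<partial>\<mu>)\<bar> \<partial>sample n)"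
    by (intro Bochner_Integration.integral_cong refl) (simp add: Ee E_p)
  also have "\<dots> \<le> sqrt ((\<integral>z. of_bool (P (rnd z)) \<partial>\<mu>) / n)"
    by (rule empirical_mean_deviation[OF \<mu>.prob_space_axioms n fm]) auto
  finally show "(\<integral>s. \<bar>E (emp n s) (\<lambda>x. of_bool (P x)) - E p (\<lambda>x. of_bool (P x))\<bar> \<partial>sample n)
      \<le> sqrt (E p (\<lambda>x. of_bool (P x)) / n)" by (simp add: E_p)
qed

text \<open>The events \<open>g x = c\<close> are disjoint, so their probabilities add up to at most
  1 and \<open>sum_sqrt_le\<close> combines the bounds for the single events; the result is uniform
  in \<open>\<mu>\<close>.\<close>

lemma emp_dev_partition:
  assumes n: "n \<ge> 1" and C: "finite C"
  shows "bounded_meas (sample n) (\<lambda>s. \<Sum>c\<in>C. \<bar>E (emp n s) (\<lambda>x. of_bool (g x = c)) - E p (\<lambda>x. of_bool (g x = c))\<bar>)"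
    and "(\<integral>s. (\<Sum>c\<in>C. \<bar>E (emp n s) (\<lambda>x. of_bool (g x = c)) - E p (\<lambda>x. of_bool (g x = c))\<bar>) \<partial>sample n)
      \<le> sqrt (real (card C) / n)"
proof -
  interpret PS: product_prob_space "\<lambda>_. \<mu>" "{..<n}" ..
  have b: "bounded_meas (sample n) (\<lambda>s. \<bar>E (emp n s) (\<lambda>x. of_bool (g x = c)) - E p (\<lambda>x. of_bool (g x = c))\<bar>)" for c
    by (intro bounded_meas_abs emp_dev_bounded[OF n])
  show "bounded_meas (sample n) (\<lambda>s. \<Sum>c\<in>C. \<bar>E (emp n s) (\<lambda>x. of_bool (g x = c)) - E p (\<lambda>x. of_bool (g x = c))\<bar>)"
    by (intro bounded_meas_sum b)
  have nn: "0 \<le> E p (\<lambda>x. of_bool (P x))" for P using p_nonneg by (intro E_nonneg) auto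
  have "(\<integral>s. (\<Sum>c\<in>C. \<bar>E (emp n s) (\<lambda>x. of_bool (g x = c)) - E p (\<lambda>x. of_bool (g x = c))\<bar>) \<partial>sample n)
    = (\<Sum>c\<in>C. \<integral>s. \<bar>E (emp n s) (\<lambda>x. of_bool (g x = c)) - E p (\<lambda>x. of_bool (g x = c))\<bar> \<partial>sample n)"
    by (intro Bochner_Integration.integral_sum PS.bounded_meas_integrable b)
  also have "\<dots> \<le> (\<Sum>c\<in>C. sqrt (E p (\<lambda>x. of_bool (g x = c)) / n))"
    by (intro sum_mono emp_dev_bounded[OF n])
  also have "\<dots> \<le> sqrt (real (card C) / n)"
  proof (rule sum_sqrt_le[OF C nn])
    have "(\<Sum>c\<in>C. E p (\<lambda>x. of_bool (g x = c))) = E p (\<lambda>x. \<Sum>c\<in>C. of_bool (g x = c))" by (simp add: E_sum)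
    also have "\<dots> \<le> E p (\<lambda>_. 1)"
    proof (rule E_mono)
      fix x
      have "(\<Sum>c\<in>C. of_bool (g x = c) :: real) = (\<Sum>c\<in>C. if c = g x then 1 else 0)" by (intro sum.cong) auto
      then show "(\<Sum>c\<in>C. of_bool (g x = c) :: real) \<le> 1" using C by simp
    qed (rule p_nonneg)
    also have "\<dots> = 1" using p_sum by (simp add: E_def)
    finally show "(\<Sum>c\<in>C. E p (\<lambda>x. of_bool (g x = c))) \<le> 1" .
  qed (use n in auto)
  finally show "(\<integral>s. (\<Sum>c\<in>C. \<bar>E (emp n s) (\<lambda>x. of_bool (g x = c)) - E p (\<lambda>x. of_bool (g x = c))\<bar>) \<partial>sample n)
      \<le> sqrt (real (card C) / n)" .
qed

lemma dev_marg_le: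
  assumes n: "n \<ge> 1" and j: "j \<le> J"
  shows "bounded_meas (sample n) (\<lambda>s. dev_marg p (emp n s) k j)"
    and "(\<integral>s. dev_marg p (emp n s) k j \<partial>sample n) \<le> sqrt (2 ^ ((j + 1) * d k) / n)"
proof -
  show "bounded_meas (sample n) (\<lambda>s. dev_marg p (emp n s) k j)"
    unfolding dev_marg_def by (intro emp_dev_partition[OF n]) simp
  have "(\<integral>s. dev_marg p (emp n s) k j \<partial>sample n) \<le> sqrt (real (card (cells j k)) / n)"
    unfolding dev_marg_def by (intro emp_dev_partition[OF n]) simp
  also have "real (card (cells j k)) \<le> real (2 ^ ((j + 1) * d k))"
    using card_cells[OF j] by (simp only: of_nat_le_iff)
  then have "sqrt (real (card (cells j k)) / n) \<le> sqrt (2 ^ ((j + 1) * d k) / n)"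
    by (intro real_sqrt_le_mono divide_right_mono) auto
  finally show "(\<integral>s. dev_marg p (emp n s) k j \<partial>sample n) \<le> sqrt (2 ^ ((j + 1) * d k) / n)" .
qed

lemma dev_joint_le:
  assumes n: "n \<ge> 1" and j: "j \<le> J"
  shows "bounded_meas (sample n) (\<lambda>s. dev_joint p (emp n s) k j)"
    and "(\<integral>s. dev_joint p (emp n s) k j \<partial>sample n)
      \<le> sqrt (2 ^ ((m + 1) * (\<Sum>i\<in>pa G k. d i) + (j + 1) * d k) / n)"
proof -
  have eq: "dev_joint p (emp n s) k j = (\<Sum>c\<in>pa_cells k \<times> cells j k.
    \<bar>E (emp n s) (\<lambda>x. of_bool ((cp k x, dyad d j k (x k)) = c)) - E p (\<lambda>x. of_bool ((cp k x, dyad d j k (x k)) = c))\<bar>)" for s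
    unfolding dev_joint_def sum.cartesian_product by (intro sum.cong) auto
  show "bounded_meas (sample n) (\<lambda>s. dev_joint p (emp n s) k j)"
    unfolding eq by (intro emp_dev_partition[OF n]) simp
  have "(\<integral>s. dev_joint p (emp n s) k j \<partial>sample n) \<le> sqrt (real (card (pa_cells k \<times> cells j k)) / n)"
    unfolding eq by (intro emp_dev_partition[OF n]) simp
  also have "card (pa_cells k \<times> cells j k) \<le> 2 ^ ((m + 1) * (\<Sum>i\<in>pa G k. d i)) * 2 ^ ((j + 1) * d k)"
    unfolding card_cartesian_product using card_pa_cells card_cells[OF j] by (intro mult_mono) auto
  then have "real (card (pa_cells k \<times> cells j k)) \<le> real (2 ^ ((m + 1) * (\<Sum>i\<in>pa G k. d i) + (j + 1) * d k))"
    by (simp only: of_nat_le_iff power_add)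
  then have "sqrt (real (card (pa_cells k \<times> cells j k)) / n)
    \<le> sqrt (2 ^ ((m + 1) * (\<Sum>i\<in>pa G k. d i) + (j + 1) * d k) / n)"
    by (intro real_sqrt_le_mono divide_right_mono) auto
  finally show "(\<integral>s. dev_joint p (emp n s) k j \<partial>sample n)
      \<le> sqrt (2 ^ ((m + 1) * (\<Sum>i\<in>pa G k. d i) + (j + 1) * d k) / n)" .
qed

lemma risk_le:
  assumes K: "1 \<le> K" and n: "n \<ge> 1"
  shows "(\<integral>\<^sup>+s. wasserstein (sup_dist d {1..K}) \<mu> (est n s) \<partial>sample n)
    \<le> ennreal ((1/2)^J + bias_const + (\<Sum>k=1..K. \<Sum>j\<le>J. (1 + 6 * L * real K) * (2 * (1/2)^j) *
          (2 * sqrt (2 ^ ((m + 1) * (\<Sum>i\<in>pa G k. d i) + (min j m + 1) * d k) / n) + 2 * sqrt (2 ^ ((j + 1) * d k) / n))))"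
proof -
  interpret PS: product_prob_space "\<lambda>_. \<mu>" "{..<n}" ..
  let ?a = "1 + 6 * L * real K"
  have bt: "bounded_meas (sample n) (\<lambda>s. ?a * (2 * (1/2)^j) *
          (2 * dev_joint p (emp n s) k (min j m) + 2 * dev_marg p (emp n s) k j))" if "j \<in> {..J}" for k j
    using that by (intro bounded_meas_intros dev_joint_le[OF n] dev_marg_le[OF n]) auto
  have bd: "bounded_meas (sample n) (dev_sum n)"
    unfolding dev_sum_def[abs_def] by (intro bounded_meas_sum bt)
  have bt_le: "(\<integral>s. ?a * (2 * (1/2)^j) * (2 * dev_joint p (emp n s) k (min j m) + 2 * dev_marg p (emp n s) k j) \<partial>sample n)
    \<le> ?a * (2 * (1/2)^j) * (2 * sqrt (2 ^ ((m + 1) * (\<Sum>i\<in>pa G k. d i) + (min j m + 1) * d k) / n)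
      + 2 * sqrt (2 ^ ((j + 1) * d k) / n))" if j: "j \<le> J" for k j
  proof -
    have "(\<integral>s. ?a * (2 * (1/2)^j) * (2 * dev_joint p (emp n s) k (min j m) + 2 * dev_marg p (emp n s) k j) \<partial>sample n)
      = ?a * (2 * (1/2)^j) * (2 * (\<integral>s. dev_joint p (emp n s) k (min j m) \<partial>sample n) + 2 * (\<integral>s. dev_marg p (emp n s) k j \<partial>sample n))"
      using PS.bounded_meas_integrable[OF dev_joint_le(1)[OF n, of "min j m" k]]
        PS.bounded_meas_integrable[OF dev_marg_le(1)[OF n j, of k]] j by simp
    also have "\<dots> \<le> ?a * (2 * (1/2)^j) * (2 * sqrt (2 ^ ((m + 1) * (\<Sum>i\<in>pa G k. d i) + (min j m + 1) * d k) / n)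
      + 2 * sqrt (2 ^ ((j + 1) * d k) / n))"
      using dev_joint_le(2)[OF n, of "min j m" k] dev_marg_le(2)[OF n j, of k] j L
      by (intro mult_left_mono add_mono) auto
    finally show ?thesis .
  qed
  \<comment> \<open>\<open>nn_integral\<close> is monotone without measurability, so nothing has to
    be known about how the Wasserstein distance depends on the sample.\<close>
  have "(\<integral>\<^sup>+s. wasserstein (sup_dist d {1..K}) \<mu> (est n s) \<partial>sample n)
    \<le> (\<integral>\<^sup>+s. ennreal ((1/2)^J + (bias_const + dev_sum n s)) \<partial>sample n)"
    by (intro nn_integral_mono wasserstein_est_le K n) (auto simp: space_PiM)
  also have "\<dots> = ennreal (\<integral>s. (1/2)^J + (bias_const + dev_sum n s) \<partial>sample n)"
  proof (intro nn_integral_eq_integral PS.bounded_meas_integrable bounded_meas_add bounded_meas_const bd AE_I2)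
    fix s
    have "0 \<le> dev_sum n s"
      unfolding dev_sum_def using L dev_marg_nonneg
      by (intro sum_nonneg mult_nonneg_nonneg add_nonneg_nonneg) (auto simp: dev_joint_def intro!: sum_nonneg)
    moreover have "0 \<le> bias_const" unfolding bias_const_def using L by simp
    ultimately show "0 \<le> (1/2)^J + (bias_const + dev_sum n s)" by simp
  qed
  also have "(\<integral>s. (1/2)^J + (bias_const + dev_sum n s) \<partial>sample n) = (1/2)^J + bias_const + (\<integral>s. dev_sum n s \<partial>sample n)"
    using PS.bounded_meas_integrable[OF bd] prob_space.prob_space[OF prob_space_PiM[OF \<mu>.prob_space_axioms], of "{..<n}"]
    by simp
  also have "(\<integral>s. dev_sum n s \<partial>sample n) = (\<Sum>k=1..K. \<Sum>j\<le>J. \<integral>s. ?a * (2 * (1/2)^j) *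
          (2 * dev_joint p (emp n s) k (min j m) + 2 * dev_marg p (emp n s) k j) \<partial>sample n)"
    unfolding dev_sum_def
    by (subst Bochner_Integration.integral_sum, rule PS.bounded_meas_integrable, intro bounded_meas_sum bt, assumption)
      (intro sum.cong refl Bochner_Integration.integral_sum PS.bounded_meas_integrable bt)
  also have "ennreal ((1/2)^J + bias_const + \<dots>) \<le> ennreal ((1/2)^J + bias_const + (\<Sum>k=1..K. \<Sum>j\<le>J. ?a * (2 * (1/2)^j) *
          (2 * sqrt (2 ^ ((m + 1) * (\<Sum>i\<in>pa G k. d i) + (min j m + 1) * d k) / n) + 2 * sqrt (2 ^ ((j + 1) * d k) / n))))"
    using bt_le by (intro ennreal_leI add_left_mono sum_mono) auto
  finally show ?thesis .
qed

end

section \<open>Choice of the levels\<close>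

lemma ex_dyadic_level:
  fixes b n :: nat
  assumes "b \<ge> 1" "n \<ge> 1"
  obtains m where "2 ^ (m * b) \<le> n" "n < 2 ^ ((m + 1) * b)"
proof -
  define P where "P m \<longleftrightarrow> n < 2 ^ (m * b)" for m
  have "P n"
  proof -
    have "n < 2 ^ n" by (rule less_exp)
    also have "(2::nat) ^ n \<le> 2 ^ (n * b)" using assms by (intro power_increasing) auto
    finally show ?thesis by (simp add: P_def)
  qed
  then have L: "P (LEAST m. P m)" by (rule LeastI)
  moreover have "\<not> P 0" using assms by (simp add: P_def)
  ultimately have "(LEAST m. P m) \<noteq> 0" by metis
  then obtain m where m: "(LEAST m. P m) = Suc m" by (cases "LEAST m. P m") auto
  then have "\<not> P m" using not_less_Least[of m P] by simp
  then show ?thesis using L m by (intro that[of m]) (auto simp: P_def)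
qed

text \<open>Rounding the ideal level down to an integer costs the factor 2.\<close>

lemma dyadic_level_powr:
  fixes b n m :: nat
  assumes "b \<ge> 1" "n \<ge> 1" "n < 2 ^ ((m + 1) * b)"
  shows "(1/2::real) ^ m \<le> 2 * real n powr (- (1 / real b))"
proof -
  have "real n < 2 ^ ((m + 1) * b)" using assms(3) by (simp only: of_nat_less_iff[symmetric, where 'a=real] of_nat_power of_nat_numeral)
  then have "real n powr (1 / real b) \<le> (2 ^ ((m + 1) * b)) powr (1 / real b)"
    by (intro powr_mono2) auto
  also have "(2 ^ ((m + 1) * b) :: real) = (2::real) powr (real ((m + 1) * b))"
    by (rule powr_realpow[symmetric]) simp
  also have "\<dots> powr (1 / real b) = 2 powr (real (m + 1))"
  proof -
    have "real ((m + 1) * b) * (1 / real b) = real (m + 1)" using assms(1) by (simp only: of_nat_mult) simp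
    then show ?thesis by (simp only: powr_powr)
  qed
  also have "\<dots> = 2 ^ (m + 1)" by (rule powr_realpow) simp
  finally have 1: "real n powr (1 / real b) \<le> 2 ^ (m + 1)" .
  have pos: "real n powr (1 / real b) > 0" using assms(2) by simp
  have "(1/2::real)^m = 2 / 2 ^ (m + 1)" by (simp add: power_one_over)
  also have "\<dots> \<le> 2 / real n powr (1 / real b)" using 1 pos by (intro divide_left_mono) auto
  also have "\<dots> = 2 * real n powr (- (1 / real b))" by (simp only: powr_minus divide_inverse)
  finally show ?thesis .
qed

text \<open>After squaring, level \<open>j\<close> contributes the exponent
  \<open>j * (k - 2)\<close>, which is at most \<open>N * (max 2 k - 2)\<close>: for
  \<open>k > 2\<close> the last level is the worst, for \<open>k \<le> 2\<close> no level exceeds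
  the first. This is the origin of \<open>max 2 (d k)\<close>. The shifts \<open>N + 1\<close> and
  \<open>j + 1\<close> from counting grid points are absorbed by \<open>2 ^ D\<close>, so the
  constant depends on the dimensions only through \<open>D\<close>.\<close>

lemma dyadic_term_le:
  fixes n j N S k D r :: nat
  assumes "j \<le> N" "k + S \<le> D" "2 ^ (N * (max 2 k + S - 2) + 2 * r) \<le> n"
  shows "(1/2::real)^j * sqrt (2 ^ ((N + 1) * S + (j + 1) * k) / real n) \<le> 2 ^ D * (1/2)^r"
proof -
  have n: "n \<ge> 1" using assms(3) by (metis one_le_numeral one_le_power order_trans)
  define e where "e = max 2 k - 2"
  have e: "max 2 k + S - 2 = e + S" "k \<le> e + 2" by (auto simp: e_def)
  have "j * k \<le> j * (e + 2)" using e by (intro mult_left_mono) auto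
  also have "\<dots> \<le> N * e + 2 * j" using assms(1) by (simp add: algebra_simps)
  finally have "(N + 1) * S + (j + 1) * k + 2 * r \<le> (2 * D + 2 * j) + (N * (e + S) + 2 * r)"
    using assms(2) by (simp add: algebra_simps)
  then have "(2::nat) ^ ((N + 1) * S + (j + 1) * k + 2 * r) \<le> 2 ^ ((2 * D + 2 * j) + (N * (e + S) + 2 * r))"
    by (intro power_increasing) auto
  also have "\<dots> \<le> 2 ^ (2 * D + 2 * j) * n"
    unfolding power_add[of 2 "2 * D + 2 * j" "N * (e + S) + 2 * r"] using assms(3) e by (intro mult_left_mono) auto
  finally have "real (2 ^ ((N + 1) * S + (j + 1) * k + 2 * r)) \<le> real (2 ^ (2 * D + 2 * j) * n)"
    by (simp only: of_nat_le_iff)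
  then have le: "2 ^ ((N + 1) * S + (j + 1) * k) * 2 ^ (2 * r) \<le> (2::real) ^ (2 * D + 2 * j) * real n"
    by (simp only: of_nat_power of_nat_numeral of_nat_mult power_add)
  have "2 ^ ((N + 1) * S + (j + 1) * k) / real n \<le> (2 ^ (2 * D + 2 * j)) / 2 ^ (2 * r)"
    using le n by (simp add: field_simps)
  also have "\<dots> = (2 ^ D * 2 ^ j / 2 ^ r)^2"
    by (simp add: power_divide power_mult_distrib power_add power_mult[symmetric] mult.commute)
  finally have "sqrt (2 ^ ((N + 1) * S + (j + 1) * k) / real n) \<le> sqrt ((2 ^ D * 2 ^ j / 2 ^ r)^2)"
    by (rule real_sqrt_le_mono)
  then have "sqrt (2 ^ ((N + 1) * S + (j + 1) * k) / real n) \<le> 2 ^ D * 2 ^ j / 2 ^ r" by simp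
  then have "(1/2::real)^j * sqrt (2 ^ ((N + 1) * S + (j + 1) * k) / real n) \<le> (1/2)^j * (2 ^ D * 2 ^ j / 2 ^ r)"
    by (intro mult_left_mono) auto
  also have "\<dots> = 2 ^ D * (1/2)^r" by (simp add: power_one_over)
  finally show ?thesis .
qed

text \<open>The logarithm in the rate is the number of levels, all bounded by the same quantity. As
  \<open>b \<ge> 2\<close> and \<open>ln 2 \<ge> 2/3\<close>, \<open>J \<le> ln n\<close>; the
  additional level 0 is absorbed by the factor 2.\<close>

lemma Suc_level_le_ln:
  fixes b n J :: nat
  assumes "2 \<le> b" "2 ^ (J * b) \<le> n"
  shows "real (J + 1) \<le> 2 * max (ln (real n)) 1"
proof -
  have "(2::nat) ^ (J * 2) \<le> 2 ^ (J * b)" using assms(1) by (intro power_increasing) auto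
  then have "real (2 ^ (J * 2)) \<le> real n" using assms(2) by (simp only: of_nat_le_iff)
  then have "ln (2 ^ (J * 2)) \<le> ln (real n)" by (intro ln_mono) auto
  then have "real (J * 2) * ln 2 \<le> ln (real n)" by (simp add: ln_realpow)
  moreover have "real J \<le> real (J * 2) * ln 2"
    using mult_left_mono[OF ln2_ge_two_thirds, of "real (J * 2)"] by simp
  ultimately show ?thesis by (simp add: max_def)
qed

theorem theorem1p5:
  fixes K :: nat and G :: "(nat \<times> nat) set" and L :: real and D :: nat
  assumes "K \<ge> 1"
    and "sorted_dag K G"
    and "\<forall>k\<in>{1..K}. fully_connected G (pa G k)"
    and "L > 0"
  shows "\<exists>C::real. C > 0 \<and>
    (\<forall>d :: nat \<Rightarrow> nat. (\<forall>k\<in>{1..K}. d k \<ge> 1) \<and> d_loc K G d = D \<longrightarrow>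
      (\<forall>n\<ge>1. minimax_risk K d {\<mu> \<in> bayes_net K G d. tv_lipschitz K G d L \<mu>} n
        \<le> ennreal (C * max (ln (real n)) 1 *
            (real n powr (- (2 / (2 + real D))) + real n powr (- (1 / real (d_max K d)))))))"
proof -
  \<comment> \<open>\<open>a\<close> is the Lipschitz constant of the downstream integrals,
    \<open>b\<close> the factor of \<open>4^-m\<close> in the bias, and the 4 in \<open>C\<close>
    pays for rounding both levels to integers. The dimensions enter only through \<open>D\<close>,
    so \<open>C\<close> is fixed before \<open>d\<close> and \<open>n\<close>.\<close>
  define a where "a = 1 + 6 * L * real K"
  define b where "b = real K * (8 * L * (a + 2 * L))"
  define C where "C = 4 * (1 + b + 8 * real K * a * 2 ^ D)"
  have a: "a \<ge> 1" and b: "b \<ge> 0" using assms(1,4) by (auto simp: a_def b_def)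
  have C: "C > 0" using a b by (simp add: C_def add_pos_nonneg)
  show ?thesis
  proof (intro exI[of _ C] conjI C allI impI)
    fix d :: "nat \<Rightarrow> nat" and n :: nat
    assume d: "(\<forall>k\<in>{1..K}. d k \<ge> 1) \<and> d_loc K G d = D" and n: "n \<ge> 1"
    define M where "M = d_max K d"
    have kD: "max 2 (d k) + (\<Sum>l\<in>pa G k. d l) \<le> D" if "k \<in> {1..K}" for k
    proof -
      have "max 2 (d k) + (\<Sum>l\<in>pa G k. d l) \<le> d_loc K G d"
        unfolding d_loc_def using that by (intro Max_ge) auto
      then show ?thesis using d by simp
    qed
    have kM: "max 2 (d k) \<le> M" if "k \<in> {1..K}" for k
      unfolding M_def d_max_def using that by (intro Max_ge) auto
    have M2: "2 \<le> M" using kM[of 1] assms(1) by simp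
    \<comment> \<open>Needed to place the coarse level below the fine one,
      \<open>m \<le> J\<close>.\<close>
    have MD: "M \<le> D + 2"
    proof -
      have "M \<in> (\<lambda>k. max 2 (d k)) ` {1..K}"
        unfolding M_def d_max_def using assms(1) by (intro Max_in) auto
      then obtain k where "k \<in> {1..K}" "M = max 2 (d k)" by auto
      then show ?thesis using kD[of k] by simp
    qed
    obtain m where m: "2 ^ (m * (D + 2)) \<le> n" "n < 2 ^ ((m + 1) * (D + 2))"
      using ex_dyadic_level[of "D + 2" n] n by auto
    obtain J where J: "2 ^ (J * M) \<le> n" "n < 2 ^ ((J + 1) * M)"
      using ex_dyadic_level[of M n] n M2 by auto
    have mJ: "m \<le> J"
    proof (rule ccontr)
      assume "\<not> m \<le> J"
      then have "(J + 1) * M \<le> m * (D + 2)" using MD by (intro mult_mono) auto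
      then have "(2::nat) ^ ((J + 1) * M) \<le> 2 ^ (m * (D + 2))" by (intro power_increasing) auto
      then show False using m(1) J(2) by linarith
    qed
    \<comment> \<open>Interpreted before any \<open>\<mu>\<close> is chosen, so that
      \<open>est n\<close> is one estimator for the whole class.\<close>
    interpret dyad_net K G d m J using assms mJ by unfold_locales auto
    define h where "h = (1/2::real)^m"
    define e where "e = (1/2::real)^J"
    define l where "l = max (ln (real n)) 1"
    have h0: "0 \<le> h" "0 \<le> e" "1 \<le> l" by (auto simp: h_def e_def l_def)
    have "minimax_risk K d {\<mu> \<in> bayes_net K G d. tv_lipschitz K G d L \<mu>} n
      \<le> (SUP \<mu>\<in>{\<mu> \<in> bayes_net K G d. tv_lipschitz K G d L \<mu>}.
          \<integral>\<^sup>+s. wasserstein (sup_dist d {1..K}) \<mu> (est n s) \<partial>PiM {..<n} (\<lambda>_. \<mu>))"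
      unfolding minimax_risk_def by (rule INF_lower) (rule measurable_est)
    also have "\<dots> \<le> ennreal (e + b * h^2 + real K * (real (J + 1) * (8 * a * 2 ^ D * (h^2 + e) / 2)))"
    proof (rule SUP_least)
      fix \<mu> assume \<mu>: "\<mu> \<in> {\<mu> \<in> bayes_net K G d. tv_lipschitz K G d L \<mu>}"
      interpret T: tv_net K G d m J L \<mu>
        using \<mu> d assms(4) by unfold_locales auto
      have term_le: "(1 + 6 * L * real K) * (2 * (1/2)^j) *
          (2 * sqrt (2 ^ ((m + 1) * (\<Sum>i\<in>pa G k. d i) + (min j m + 1) * d k) / n) + 2 * sqrt (2 ^ ((j + 1) * d k) / n))
          \<le> 8 * a * 2 ^ D * (h^2 + e) / 2" if k: "k \<in> {1..K}" and j: "j \<le> J" for k j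
      proof -
        let ?s = "\<Sum>i\<in>pa G k. d i"
        \<comment> \<open>Beyond level \<open>m\<close> the joint frequencies stay at level
          \<open>m\<close> while the weight keeps decreasing, so these levels are no worse than
          \<open>j = m\<close>.\<close>
        have "(1/2::real)^j * sqrt (2 ^ ((m + 1) * ?s + (min j m + 1) * d k) / n)
          \<le> (1/2)^(min j m) * sqrt (2 ^ ((m + 1) * ?s + (min j m + 1) * d k) / n)"
          by (intro mult_right_mono power_decreasing) auto
        also have "\<dots> \<le> 2 ^ D * (1/2)^(2 * m)"
        proof (rule dyadic_term_le)
          show "d k + ?s \<le> D" using kD[OF k] by simp
          \<comment> \<open>The balance that fixes \<open>m\<close>: for a term of order
            \<open>4^-m\<close>, the sample size must reach 2 to the power
            \<open>m * (max 2 (d k) + ?s - 2) + 4 * m\<close>, and this exponent is at most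
            \<open>m * (D + 2)\<close>.\<close>
          have "m * (max 2 (d k) + ?s - 2) + 2 * (2 * m) = m * (max 2 (d k) + ?s - 2 + 4)"
            by (simp only: distrib_left)
          also have "\<dots> \<le> m * (D + 2)" using kD[OF k] by (intro mult_left_mono) auto
          finally have "(2::nat) ^ (m * (max 2 (d k) + ?s - 2) + 2 * (2 * m)) \<le> 2 ^ (m * (D + 2))"
            by (intro power_increasing) auto
          then show "2 ^ (m * (max 2 (d k) + ?s - 2) + 2 * (2 * m)) \<le> n" using m(1) by linarith
        qed simp
        also have "(1/2::real)^(2 * m) = h^2" by (simp add: h_def power_mult[symmetric] mult.commute)
        finally have 1: "(1/2::real)^j * sqrt (2 ^ ((m + 1) * ?s + (min j m + 1) * d k) / n) \<le> 2 ^ D * h^2" .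
        have 2: "(1/2::real)^j * sqrt (2 ^ ((j + 1) * d k) / n) \<le> 2 ^ D * e"
        proof -
          \<comment> \<open>The marginal term is the case without parents, with target
            \<open>2^-J\<close> in place of \<open>4^-m\<close>.\<close>
          have "(1/2::real)^j * sqrt (2 ^ ((J + 1) * 0 + (j + 1) * d k) / n) \<le> 2 ^ D * (1/2)^J"
          proof (rule dyadic_term_le[OF j])
            show "d k + 0 \<le> D" using kD[OF k] by simp
            have "J * (max 2 (d k) + 0 - 2) + 2 * J = J * max 2 (d k)" by (simp add: algebra_simps diff_mult_distrib2 max_def)
            also have "\<dots> \<le> J * M" using kM[OF k] by (rule mult_left_mono) simp
            finally have "(2::nat) ^ (J * (max 2 (d k) + 0 - 2) + 2 * J) \<le> 2 ^ (J * M)"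
              by (intro power_increasing) auto
            then show "2 ^ (J * (max 2 (d k) + 0 - 2) + 2 * J) \<le> n" using J(1) by linarith
          qed
          then show ?thesis by (simp add: e_def)
        qed
        have "a * (2 * (1/2)^j) * (2 * sqrt (2 ^ ((m + 1) * ?s + (min j m + 1) * d k) / n) + 2 * sqrt (2 ^ ((j + 1) * d k) / n))
          = 4 * a * ((1/2)^j * sqrt (2 ^ ((m + 1) * ?s + (min j m + 1) * d k) / n) + (1/2)^j * sqrt (2 ^ ((j + 1) * d k) / n))"
          by (simp only: distrib_left mult_ac)
        also have "\<dots> \<le> 4 * a * (2 ^ D * h^2 + 2 ^ D * e)"
          using 1 2 a by (intro mult_left_mono add_mono) auto
        also have "\<dots> = 8 * a * 2 ^ D * (h^2 + e) / 2" by (simp add: algebra_simps)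
        finally show ?thesis by (simp only: a_def)
      qed
      have bias: "T.bias_const = b * h^2"
        unfolding T.bias_const_def b_def a_def h_def[symmetric] by (simp add: power2_eq_square algebra_simps)
      have "(\<Sum>k=1..K. \<Sum>j\<le>J. (1 + 6 * L * real K) * (2 * (1/2)^j) *
          (2 * sqrt (2 ^ ((m + 1) * (\<Sum>i\<in>pa G k. d i) + (min j m + 1) * d k) / n) + 2 * sqrt (2 ^ ((j + 1) * d k) / n)))
        \<le> (\<Sum>k=1..K. \<Sum>j\<le>J. 8 * a * 2 ^ D * (h^2 + e) / 2)"
        using term_le by (intro sum_mono) auto
      also have "\<dots> = real K * (real (J + 1) * (8 * a * 2 ^ D * (h^2 + e) / 2))" by simp
      finally show "(\<integral>\<^sup>+s. wasserstein (sup_dist d {1..K}) \<mu> (est n s) \<partial>PiM {..<n} (\<lambda>_. \<mu>))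
        \<le> ennreal (e + b * h^2 + real K * (real (J + 1) * (8 * a * 2 ^ D * (h^2 + e) / 2)))"
        using T.risk_le[OF assms(1) n] unfolding bias e_def[symmetric]
        by (elim order_trans) (intro ennreal_leI add_left_mono)
    qed
    also have "\<dots> \<le> ennreal (C * l * (real n powr (- (2 / (2 + real D))) + real n powr (- (1 / real M))))"
    proof (rule ennreal_leI)
      have Jl: "real (J + 1) \<le> 2 * l" unfolding l_def by (rule Suc_level_le_ln[OF M2 J(1)])
      have he: "0 \<le> h^2 + e" using h0 by simp
      have "e + b * h^2 \<le> l * ((1 + b) * (h^2 + e))"
      proof -
        have "e + b * h^2 \<le> (1 + b) * (h^2 + e)" using b h0 by (simp add: algebra_simps)
        also have "\<dots> = 1 * ((1 + b) * (h^2 + e))" by simp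
        also have "\<dots> \<le> l * ((1 + b) * (h^2 + e))" using h0 b he by (intro mult_right_mono) auto
        finally show ?thesis .
      qed
      moreover have "real K * (real (J + 1) * (8 * a * 2 ^ D * (h^2 + e) / 2)) \<le> real K * ((2 * l) * (8 * a * 2 ^ D * (h^2 + e) / 2))"
        using Jl a he by (intro mult_left_mono mult_right_mono) auto
      ultimately have "e + b * h^2 + real K * (real (J + 1) * (8 * a * 2 ^ D * (h^2 + e) / 2))
        \<le> l * ((1 + b) * (h^2 + e)) + real K * ((2 * l) * (8 * a * 2 ^ D * (h^2 + e) / 2))" by (rule add_mono)
      also have "\<dots> = l * (1 + b + 8 * real K * a * 2 ^ D) * (h^2 + e)" by (simp add: algebra_simps)
      also have "\<dots> \<le> l * (1 + b + 8 * real K * a * 2 ^ D)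
          * (4 * real n powr (- (2 / (2 + real D))) + 4 * real n powr (- (1 / real M)))"
      proof (intro mult_left_mono add_mono)
        have "h \<le> 2 * real n powr (- (1 / real (D + 2)))"
          unfolding h_def by (rule dyadic_level_powr[OF _ n m(2)]) simp
        then have "h^2 \<le> (2 * real n powr (- (1 / real (D + 2))))^2" using h0 by (intro power_mono) auto
        also have "\<dots> = 4 * (real n powr (- (1 / real (D + 2))) * real n powr (- (1 / real (D + 2))))"
          by (simp add: power2_eq_square)
        also have "\<dots> = 4 * real n powr (- (2 / (2 + real D)))"
          unfolding powr_add[symmetric] by (simp add: add_divide_distrib[symmetric] add.commute)
        finally show "h^2 \<le> 4 * real n powr (- (2 / (2 + real D)))" .
        have "e \<le> 2 * real n powr (- (1 / real M))"
          unfolding e_def using M2 by (intro dyadic_level_powr[OF _ n J(2)]) auto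
        then show "e \<le> 4 * real n powr (- (1 / real M))" by (smt (verit) powr_ge_zero)
        show "0 \<le> l * (1 + b + 8 * real K * a * 2 ^ D)" using h0 a b by (intro mult_nonneg_nonneg add_nonneg_nonneg) auto
      qed
      also have "\<dots> = C * l * (real n powr (- (2 / (2 + real D))) + real n powr (- (1 / real M)))"
        by (simp add: C_def algebra_simps)
      finally show "e + b * h^2 + real K * (real (J + 1) * (8 * a * 2 ^ D * (h^2 + e) / 2))
        \<le> C * l * (real n powr (- (2 / (2 + real D))) + real n powr (- (1 / real M)))" .
    qed
    finally show "minimax_risk K d {\<mu> \<in> bayes_net K G d. tv_lipschitz K G d L \<mu>} n
        \<le> ennreal (C * max (ln (real n)) 1 *
            (real n powr (- (2 / (2 + real D))) + real n powr (- (1 / real (d_max K d)))))"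
      unfolding l_def M_def .
  qed
qed

end
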